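(* Fix $k\in\mathbb{N}$. For every $n\ge k$ let $\vec m_{2n}=(m_1,\dots,m_{2n})$ be uniformly distributed on the moment space $\mathcal{M}_{2n}([0,1])$, and let $$H_{n,k}=(D_{n,2}(\vec m_{2n}),\dots,D_{n,2k}(\vec m_{2n}))^T,\qquad H^0_{n,k}=(D^0_{n,2},\dots,D^0_{n,2k})^T .$$ Then, as $n\to\infty$, $$\sqrt{4n}\,\big(H_{n,k}-H^0_{n,k}\big)\ \xrightarrow{d}\ \mathcal{N}(0,\Sigma_k),\qquad \Sigma_k=(i\wedge j)_{i,j=1}^k ,$$ where $\xrightarrow{d}$ denotes convergence in distribution.
   Context: For a probability measure $\mu$ on $[0,1]$ write $m_j(\mu)=\int_0^1 x^j\,\mu(dx)$. The moment space is $\mathcal{M}_{2n}([0,1])=\{(m_1(\mu),\dots,m_{2n}(\mu)) : \mu \text{ a probability measure on } [0,1]\}\subset\mathbb{R}^{2n}$, a compact convex set with nonempty interior; "uniformly distributed" means with respect to normalized Lebesgue measure on this set. For $\vec m_{2n}=(m_1,\dots,m_{2n})$ put $m_0=1$ and, for $0\le \ell\le n$, $$D_{n,2\ell}(\vec m_{2n})=\log\det (m_{i+j})_{i,j=0}^{\ell}$$ (almost surely well defined under the uniform distribution). $D^0_{n,2\ell}$ denotes the log-determinant of the Hankel matrix of moments of the arcsine distribution on $[0,1]$ (density $1/(\pi\sqrt{x(1-x)})$): $$D^0_{n,2\ell}=\log\det\Big(\tbinom{2(i+j)}{i+j}2^{-2(i+j)}\Big)_{i,j=0,\dots,\ell}=-\ell(2\ell+1)\log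 2 .$$ $i\wedge j=\min(i,j)$. *)

theory Defs
  imports
    "HOL-Probability.Probability"
    "Jordan_Normal_Form.Determinant"
    "Jordan_Normal_Form.Gauss_Jordan_Elimination"
begin

text \<open>Real vectors with entries numbered \<open>1, \<dots>, N\<close> are extensional functions on \<open>{1..N}\<close>, that is,
  points of the space of \<open>PiM {1..N} (\<lambda>_. borel)\<close>.\<close>

definition moment :: "real measure \<Rightarrow> nat \<Rightarrow> real" where
  "moment \<mu> j = (\<integral>x. x ^ j \<partial>\<mu>)"

definition prob_measures_01 :: "real measure set" where
  "prob_measures_01 = {\<mu>. prob_space \<mu> \<and> sets \<mu> = sets (restrict_space borel {0..1})}"

definition moment_space :: "nat \<Rightarrow> (nat \<Rightarrow> real) set" where
  "moment_space N = (\<lambda>\<mu>. restrict (moment \<mu>) {1..N}) ` prob_measures_01"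

definition uniform_moment_space :: "nat \<Rightarrow> (nat \<Rightarrow> real) measure" where
  "uniform_moment_space N = uniform_measure (PiM {1..N} (\<lambda>_. lborel)) (moment_space N)"

definition log_hankel_det :: "nat \<Rightarrow> (nat \<Rightarrow> real) \<Rightarrow> real" where
  "log_hankel_det l m = ln (Determinant.det (mat (l + 1) (l + 1) (\<lambda>(i, j). m (i + j))))"

text \<open>A point of the moment space has no entry at index 0, so the convention \<open>m\<^sub>0 = 1\<close> is imposed
  by an update. Outside the null event that the determinant is not positive, \<open>ln\<close> is the
  logarithm proper.\<close>

definition D_moments :: "nat \<Rightarrow> (nat \<Rightarrow> real) \<Rightarrow> real" where
  "D_moments l m = log_hankel_det l (m(0 := 1))"

definition arcsine_measure :: "real measure" where
  "arcsine_measure =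
     density (restrict_space lborel {0..1}) (\<lambda>x. ennreal (1 / (pi * sqrt (x * (1 - x)))))"

definition D_arcsine :: "nat \<Rightarrow> real" where
  "D_arcsine l = log_hankel_det l (moment arcsine_measure)"

text \<open>The normal law on \<open>\<real>\<^sup>k\<close> with mean \<open>\<mu>\<close> and positive definite covariance matrix \<open>\<Sigma>\<close>,
  given by its Lebesgue density. Library matrices are indexed from 0, hence the shifts.
  For singular \<open>\<Sigma>\<close> the definition has no meaning.\<close>

definition multivariate_normal ::
    "nat \<Rightarrow> (nat \<Rightarrow> real) \<Rightarrow> (nat \<Rightarrow> nat \<Rightarrow> real) \<Rightarrow> (nat \<Rightarrow> real) measure" where
  "multivariate_normal k \<mu> \<Sigma> =
     (let S = mat k k (\<lambda>(i, j). \<Sigma> (i + 1) (j + 1));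
          y = (\<lambda>x. vec k (\<lambda>i. x (i + 1) - \<mu> (i + 1)))
      in density (PiM {1..k} (\<lambda>_. lborel))
           (\<lambda>x. ennreal (exp (- scalar_prod (y x) (mult_mat_vec (the (mat_inverse S)) (y x)) / 2)
                  / sqrt ((2 * pi) ^ k * Determinant.det S))))"

text \<open>Weak convergence of Borel measures on \<open>\<real>\<^sup>I\<close>, \<open>I\<close> finite: the topology on
  \<open>PiE I (\<lambda>_. UNIV)\<close> is the one induced by the product topology on functions.\<close>

definition weak_conv_PiM ::
    "'i set \<Rightarrow> (nat \<Rightarrow> ('i \<Rightarrow> real) measure) \<Rightarrow> ('i \<Rightarrow> real) measure \<Rightarrow> bool" where
  "weak_conv_PiM I \<mu> \<nu> \<longleftrightarrow>
     (\<forall>f :: ('i \<Rightarrow> real) \<Rightarrow> real.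
        continuous_on (PiE I (\<lambda>_. UNIV)) f \<and> bounded (f ` PiE I (\<lambda>_. UNIV)) \<longrightarrow>
        (\<lambda>n. \<integral>x. f x \<partial>\<mu> n) \<longlonglongrightarrow> (\<integral>x. f x \<partial>\<nu>))"

definition conv_in_distribution ::
    "'i set \<Rightarrow> (nat \<Rightarrow> 'a measure) \<Rightarrow> (nat \<Rightarrow> 'a \<Rightarrow> 'i \<Rightarrow> real) \<Rightarrow> ('i \<Rightarrow> real) measure \<Rightarrow> bool" where
  "conv_in_distribution I M X \<nu> \<longleftrightarrow>
     weak_conv_PiM I (\<lambda>n. distr (M n) (PiM I (\<lambda>_. borel)) (X n)) \<nu>"

end

theory Submission
  imports Defs "HOL-Complex_Analysis.Cauchy_Integral_Formula" "HOL-Real_Asymp.Real_Asymp"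
begin

text \<open>Write \<open>x = (1 + cos t) / 2\<close>. A probability measure on \<open>[0,1]\<close> becomes a law of the angle \<open>t\<close>, and its
  power moments are a triangular linear image of the numbers \<open>\<integral> cos (j t)\<close>. The Szego recursion
  \<open>\<Phi>\<^bsub>k+1\<^esub> = z \<Phi>\<^sub>k - a\<^bsub>k+1\<^esub> \<Phi>\<^sup>*\<^sub>k\<close> with \<open>\<Phi>\<^sub>k\<close> orthogonal to \<open>1, \<dots>, z\<^bsup>k-1\<^esup>\<close> turns the moments into real Verblunsky
  coefficients \<open>a\<^sub>1, a\<^sub>2, \<dots>\<close>; in terms of the canonical moments of \<open>[0,1]\<close>, \<open>a\<^sub>i = 2 p\<^sub>i - 1\<close>. The squared norm of
  \<open>\<Phi>\<^sub>k\<close> is \<open>E\<^sub>k = (1 - a\<^sub>1\<^sup>2) \<cdots> (1 - a\<^sub>k\<^sup>2)\<close>. The theorem rests on three facts about these coordinates.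

  First, they make the uniform law explicit. One has
  \<open>m\<^bsub>j+1\<^esub> = r\<^sub>j(a\<^sub>1, \<dots>, a\<^sub>j) + 2 \<cdot> 4\<^bsup>-(j+1)\<^esup> E\<^sub>j a\<^bsub>j+1\<^esub>\<close> (\<open>cos_moment_step\<close>), so moments and coefficients are related
  by a triangular substitution whose Jacobian is a product of powers of \<open>1 - a\<^sub>i\<^sup>2\<close>. Up to a null set the
  moment space is the cube \<open>\<bar>a\<^sub>i\<bar> < 1\<close> (\<open>AE_moment_space_iff\<close>): positivity of \<open>E\<^bsub>j+1\<^esub>\<close> confines the coefficients
  of a measure to the closed cube, and every point of the open cube is realised by the Bernstein-Szego
  measure with density \<open>E\<^sub>N / (2 \<pi> \<bar>\<Phi>\<^sub>N\<bar>\<^sup>2)\<close> in \<open>t\<close>. Hence under the uniform law on the moment space of order \<open>N\<close>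
  the \<open>a\<^sub>i\<close> are independent with densities proportional to \<open>(1 - a\<^sup>2)\<^bsup>N-i\<^esup>\<close> (\<open>distr_scaled_canonical\<close>).

  Second, the symmetrised polynomials \<open>z\<^bsup>-k\<^esup> (\<Phi>\<^bsub>2k\<^esub> + \<Phi>\<^sup>*\<^bsub>2k\<^esub>)\<close> are polynomials in \<open>x\<close> orthogonal on \<open>[0,1]\<close>, which gives
  the Hankel determinant as the product of \<open>2 \<cdot> 16\<^bsup>-k\<^esup> E\<^bsub>2k-1\<^esub> (1 + a\<^bsub>2k\<^esub>)\<close> over \<open>1 \<le> k \<le> l\<close> (\<open>det_hankel_cos_moment\<close>).
  The arcsine law is the uniform law of \<open>t\<close> and has \<open>a = 0\<close>, so the centred log-determinant is the sum of
  \<open>ln E\<^bsub>2k-1\<^esub> + ln (1 + a\<^bsub>2k\<^esub>)\<close>.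

  Third, for \<open>N = 2n\<close> the density of \<open>z\<^sub>i = \<surd>(4n) a\<^sub>i\<close> tends pointwise to the standard normal one and is dominated
  by a Gaussian. In the centred log-determinant \<open>E\<^bsub>2k-1\<^esub>\<close> is of second order in \<open>a\<close> and disappears after
  multiplication by \<open>\<surd>(4n)\<close>, while \<open>\<surd>(4n) ln (1 + a\<^bsub>2k\<^esub>) \<rightarrow> z\<^bsub>2k\<^esub>\<close>. By dominated convergence (\<open>tendsto_integral_weight\<close>)
  the limit is the law of the partial sums \<open>z\<^sub>2 + z\<^sub>4 + \<cdots> + z\<^bsub>2l\<^esub>\<close>, a Gaussian random walk, whose covariance
  matrix is \<open>min i j\<close> (\<open>integral_even_coordinates\<close>).\<close>


section \<open>Szego polynomials and Verblunsky coefficients\<close>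

text \<open>The monic orthogonal polynomials \<open>\<Phi>\<^sub>k\<close> on the unit circle and their reversals \<open>\<Phi>\<^sup>*\<^sub>k\<close>, as functions on the
  plane. The coefficient used in step \<open>k + 1\<close> is numbered \<open>k + 1\<close>, so that \<open>a\<^sub>i\<close> belongs to the \<open>i\<close>-th moment.\<close>
fun szego :: "(nat \<Rightarrow> real) \<Rightarrow> nat \<Rightarrow> complex \<Rightarrow> complex"
  and szego_rev :: "(nat \<Rightarrow> real) \<Rightarrow> nat \<Rightarrow> complex \<Rightarrow> complex" where
  "szego a 0 z = 1"
| "szego_rev a 0 z = 1"
| "szego a (Suc k) z = z * szego a k z - of_real (a (Suc k)) * szego_rev a k z"
| "szego_rev a (Suc k) z = szego_rev a k z - of_real (a (Suc k)) * (z * szego a k z)"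

definition verblunsky_energy :: "(nat \<Rightarrow> real) \<Rightarrow> nat \<Rightarrow> real" where
  "verblunsky_energy a k = (\<Prod>i\<in>{1..k}. 1 - (a i)\<^sup>2)"

lemma verblunsky_energy_0 [simp]: "verblunsky_energy a 0 = 1"
  by (simp add: verblunsky_energy_def)

lemma verblunsky_energy_Suc [simp]:
  "verblunsky_energy a (Suc k) = (1 - (a (Suc k))\<^sup>2) * verblunsky_energy a k"
  by (simp add: verblunsky_energy_def)

lemma verblunsky_energy_pos:
  assumes "\<And>i. i \<in> {1..k} \<Longrightarrow> \<bar>a i\<bar> < 1"
  shows "verblunsky_energy a k > 0"
  unfolding verblunsky_energy_def
  using assms by (intro prod_pos) (simp add: abs_square_less_1)

lemma szego_rev_circle: "szego_rev a k (cis t) = cis (real k * t) * cnj (szego a k (cis t))"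
proof (induction k)
  case (Suc k)
  have 1: "cis (real (Suc k) * t) * cnj (cis t) = cis (real k * t)"
    by (simp add: cis_cnj cis_mult algebra_simps)
  have 2: "cis (real (Suc k) * t) = cis t * cis (real k * t)"
    by (simp add: cis_mult algebra_simps)
  have 3: "cis (real k * t) * cnj (cis (real k * t)) = 1"
    by (simp add: cis_cnj cis_mult)
  have "cis (real (Suc k) * t) * cnj (szego a (Suc k) (cis t)) =
      (cis (real (Suc k) * t) * cnj (cis t)) * cnj (szego a k (cis t)) -
      of_real (a (Suc k)) * (cis t * (cis (real k * t) * cnj (cis (real k * t))) * szego a k (cis t))"
    unfolding szego.simps Suc.IH 2 by (simp add: algebra_simps)
  then show ?case
    by (simp only: 1 3) (simp only: szego_rev.simps Suc.IH mult_1_right)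
qed simp

text \<open>The recursion gives \<open>\<bar>\<Phi>\<^sup>*\<^bsub>k+1\<^esub>\<bar>\<^sup>2 - \<bar>\<Phi>\<^bsub>k+1\<^esub>\<bar>\<^sup>2 = (1 - a\<^sup>2) (\<bar>\<Phi>\<^sup>*\<^sub>k\<bar>\<^sup>2 - \<bar>z \<Phi>\<^sub>k\<bar>\<^sup>2)\<close>, which is nonnegative by induction.
  The lemma serves to make \<open>1 / \<Phi>\<^sup>*\<^sub>k\<close> holomorphic in the disc.\<close>
lemma szego_norm_le_rev:
  assumes "\<And>i. i \<in> {1..k} \<Longrightarrow> \<bar>a i\<bar> < 1" and "norm z \<le> 1"
  shows "norm (szego a k z) \<le> norm (szego_rev a k z) \<and> szego_rev a k z \<noteq> 0"
  using assms(1)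
proof (induction k)
  case (Suc k)
  define p where "p = z * szego a k z"
  define q where "q = szego_rev a k z"
  define c where "c = a (Suc k)"
  have c: "\<bar>c\<bar> < 1" using Suc.prems[of "Suc k"] by (simp add: c_def)
  have IH: "norm (szego a k z) \<le> norm q" "q \<noteq> 0"
    using Suc.IH Suc.prems by (auto simp: q_def)
  have pq: "norm p \<le> norm q"
    using IH(1) assms(2) by (auto simp: p_def norm_mult intro: order_trans[OF mult_left_le_one_le])
  have "norm (of_real c * p) < norm q"
  proof -
    have "norm (of_real c * p) \<le> \<bar>c\<bar> * norm q"
      using pq by (simp add: norm_mult mult_left_mono)
    also have "\<dots> < norm q" using c IH(2) by simp
    finally show ?thesis .
  qed
  then have nz: "q - of_real c * p \<noteq> 0" by force
  have "(norm (q - of_real c * p))\<^sup>2 - (norm (p - of_real c * q))\<^sup>2 =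
      (1 - c\<^sup>2) * ((norm q)\<^sup>2 - (norm p)\<^sup>2)"
    unfolding cmod_power2 by (simp add: power2_eq_square algebra_simps)
  also have "\<dots> \<ge> 0"
    using pq c by (intro mult_nonneg_nonneg) (auto simp: abs_square_le_1)
  finally have "(norm (p - of_real c * q))\<^sup>2 \<le> (norm (q - of_real c * p))\<^sup>2"
    by linarith
  then have "norm (p - of_real c * q) \<le> norm (q - of_real c * p)"
    by (rule power2_le_imp_le) (rule norm_ge_zero)
  then show ?case using nz unfolding szego.simps szego_rev.simps p_def q_def c_def by blast
qed simp

lemma szego_circle_nonzero:
  assumes "\<And>i. i \<in> {1..k} \<Longrightarrow> \<bar>a i\<bar> < 1"
  shows "szego a k (cis t) \<noteq> 0"
proof
  assume "szego a k (cis t) = 0"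
  then have "szego_rev a k (cis t) = 0" by (simp add: szego_rev_circle)
  then show False using szego_norm_le_rev[of k a "cis t"] assms by simp
qed

lemma szego_coefficients:
  "\<exists>c::nat \<Rightarrow> real. c k = 1 \<and> (k > 0 \<longrightarrow> c 0 = - a k) \<and>
     (\<forall>z. szego a k z = (\<Sum>i\<le>k. of_real (c i) * z ^ i)) \<and>
     (\<forall>z. szego_rev a k z = (\<Sum>i\<le>k. of_real (c (k - i)) * z ^ i))"
proof (induction k)
  case 0
  show ?case by (intro exI[of _ "\<lambda>_. 1"]) simp
next
  case (Suc k)
  then obtain c :: "nat \<Rightarrow> real" where c: "c k = 1"
    "\<And>z. szego a k z = (\<Sum>i\<le>k. of_real (c i) * z ^ i)"
    "\<And>z. szego_rev a k z = (\<Sum>i\<le>k. of_real (c (k - i)) * z ^ i)" by blast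
  define d where "d i = (if i = 0 then 0 else c (i - 1)) - a (Suc k) * (if i \<le> k then c (k - i) else 0)" for i
  have shift: "z * szego a k z = (\<Sum>i\<le>Suc k. of_real (if i = 0 then 0 else c (i - 1)) * z ^ i)" for z
    by (subst sum.atMost_Suc_shift) (simp add: c sum_distrib_left algebra_simps)
  have pad: "szego_rev a k z = (\<Sum>i\<le>Suc k. of_real (if i \<le> k then c (k - i) else 0) * z ^ i)" for z
    by (simp add: c)
  have "szego a (Suc k) z = (\<Sum>i\<le>Suc k. of_real (d i) * z ^ i)" for z
    unfolding szego.simps shift pad sum_distrib_left sum_subtractf[symmetric]
    by (intro sum.cong refl) (simp add: d_def algebra_simps)
  moreover have "szego_rev a (Suc k) z = (\<Sum>i\<le>Suc k. of_real (d (Suc k - i)) * z ^ i)" for z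
    unfolding szego_rev.simps shift pad sum_distrib_left sum_subtractf[symmetric]
  proof (intro sum.cong refl)
    fix i assume "i \<in> {..Suc k}"
    then have "i = Suc k \<or> i \<le> k" by auto
    then have "d (Suc k - i) = (if i \<le> k then c (k - i) else 0) - a (Suc k) * (if i = 0 then 0 else c (i - 1))"
      by (auto simp: d_def Suc_diff_le)
    then have "complex_of_real (d (Suc k - i)) = complex_of_real (if i \<le> k then c (k - i) else 0) -
        complex_of_real (a (Suc k)) * complex_of_real (if i = 0 then 0 else c (i - 1))"
      by (metis of_real_diff of_real_mult)
    then show "complex_of_real (if i \<le> k then c (k - i) else 0) * z ^ i -
         complex_of_real (a (Suc k)) * (complex_of_real (if i = 0 then 0 else c (i - 1)) * z ^ i) =
         complex_of_real (d (Suc k - i)) * z ^ i"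
      by (simp only: left_diff_distrib mult.assoc)
  qed
  moreover have "d (Suc k) = 1" "d 0 = - a (Suc k)" by (auto simp: d_def c)
  ultimately show ?case by blast
qed

text \<open>The real part of \<open>\<langle>\<Phi>\<^sub>k, z\<^sup>s\<rangle>\<close> in \<open>L\<^sup>2\<close> of the law \<open>\<nu>\<close> of the angle. For \<open>k = 0\<close> these are the trigonometric
  moments.\<close>
definition szego_moment :: "real measure \<Rightarrow> (nat \<Rightarrow> real) \<Rightarrow> nat \<Rightarrow> int \<Rightarrow> real" where
  "szego_moment \<nu> a k s = (\<integral>t. Re (cis (- (of_int s * t)) * szego a k (cis t)) \<partial>\<nu>)"

lemma continuous_szego:
  "continuous_on UNIV (\<lambda>t. szego a k (cis t))" "continuous_on UNIV (\<lambda>t. szego_rev a k (cis t))"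
proof (induction k)
  case (Suc k)
  { case 1 show ?case using Suc by (auto intro!: continuous_intros) }
  { case 2 show ?case using Suc by (auto intro!: continuous_intros) }
qed (auto intro!: continuous_intros)

lemma Re_mult_real: "Re (complex_of_real x * z) = x * Re z"
  by simp

lemma borel_measurable_szego [measurable]: "(\<lambda>t. szego a k (cis t)) \<in> borel_measurable borel"
  by (intro borel_measurable_continuous_onI continuous_szego)

lemma borel_measurable_cis [measurable]: "cis \<in> borel_measurable borel"
  by (intro borel_measurable_continuous_onI continuous_intros)

lemma szego_bounded: "\<exists>C. \<forall>t. norm (szego a k (cis t)) \<le> C"
proof -
  obtain c :: "nat \<Rightarrow> real" where c: "\<And>z. szego a k z = (\<Sum>i\<le>k. of_real (c i) * z ^ i)"
    using szego_coefficients[of k a] by blast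
  have "norm (szego a k (cis t)) \<le> (\<Sum>i\<le>k. \<bar>c i\<bar>)" for t
    unfolding c by (rule order_trans[OF norm_sum]) (simp add: norm_mult norm_power)
  then show ?thesis by blast
qed

locale circle_measure = finite_measure \<nu> for \<nu> :: "real measure" +
  assumes sets_eq [measurable_cong, simp]: "sets \<nu> = sets borel"
begin

lemma integrable_bounded:
  fixes f :: "real \<Rightarrow> real"
  assumes [measurable]: "f \<in> borel_measurable borel" and "\<And>t. \<bar>f t\<bar> \<le> C"
  shows "integrable \<nu> f"
  by (rule integrable_const_bound[of _ C]) (use assms(2) in auto)

lemma integrable_szego:
  "integrable \<nu> (\<lambda>t. Re (cis (s * t) * szego a k (cis t)))"
proof -
  obtain C where C: "\<And>t. norm (szego a k (cis t)) \<le> C" using szego_bounded by blast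
  show ?thesis
  proof (rule integrable_bounded[of _ C])
    fix t
    have "norm (cis (s * t) * szego a k (cis t)) \<le> C" by (simp add: norm_mult C)
    then show "\<bar>Re (cis (s * t) * szego a k (cis t))\<bar> \<le> C"
      using abs_Re_le_cmod order_trans by blast
  qed measurable
qed

lemma integrable_cos: "integrable \<nu> (\<lambda>t. cos (s * t))"
  by (rule integrable_bounded[of _ 1]) auto

lemma szego_moment_0: "szego_moment \<nu> a 0 s = (\<integral>t. cos (of_int s * t) \<partial>\<nu>)"
  by (simp add: szego_moment_def)

text \<open>On the circle \<open>\<Phi>\<^sup>*\<^sub>k = z\<^sup>k cnj \<Phi>\<^sub>k\<close>, so the inner products with \<open>\<Phi>\<^sup>*\<^sub>k\<close> are again inner products with \<open>\<Phi>\<^sub>k\<close>. The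
  orthogonality relations below are consequences of this two-index recursion alone.\<close>
lemma szego_moment_Suc:
  "szego_moment \<nu> a (Suc k) s =
     szego_moment \<nu> a k (s - 1) - a (Suc k) * szego_moment \<nu> a k (int k - s)"
proof -
  have "Re (cis (- (of_int s * t)) * szego a (Suc k) (cis t)) =
      Re (cis (- (of_int (s - 1) * t)) * szego a k (cis t)) -
      a (Suc k) * Re (cis (- (of_int (int k - s) * t)) * szego a k (cis t))" for t
  proof -
    have 1: "cis (- (of_int s * t)) * (cis t * szego a k (cis t)) = cis (- (of_int (s - 1) * t)) * szego a k (cis t)"
    proof -
      have "cis (- (of_int s * t)) * cis t = cis (- (of_int (s - 1) * t))"
        by (simp add: cis_mult algebra_simps)
      then show ?thesis by (simp only: mult.assoc[symmetric])
    qed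
    have 2: "cis (- (of_int s * t)) * szego_rev a k (cis t) = cnj (cis (- (of_int (int k - s) * t)) * szego a k (cis t))"
    proof -
      have "cis (- (of_int s * t)) * cis (real k * t) = cnj (cis (- (of_int (int k - s) * t)))"
        by (simp add: cis_mult cis_cnj algebra_simps)
      then show ?thesis by (simp only: szego_rev_circle mult.assoc[symmetric] complex_cnj_mult)
    qed
    have "cis (- (of_int s * t)) * szego a (Suc k) (cis t) =
        cis (- (of_int s * t)) * (cis t * szego a k (cis t)) -
        of_real (a (Suc k)) * (cis (- (of_int s * t)) * szego_rev a k (cis t))"
      by (simp add: algebra_simps)
    then show ?thesis unfolding 1 2 by (simp only: minus_complex.sel Re_mult_real cnj.sel)
  qed
  moreover have int: "integrable \<nu> (\<lambda>t. Re (cis (- (of_int s * t)) * szego a k (cis t)))" for s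
    using integrable_szego[of "- of_int s"] by (simp only: minus_mult_left)
  ultimately show ?thesis
    unfolding szego_moment_def
    by (simp only: Bochner_Integration.integral_diff[OF int integrable_mult_right[OF int]] integral_mult_right_zero)
qed

lemma szego_moment_coefficients:
  assumes "\<And>z. szego a k z = (\<Sum>i\<le>k. of_real (c i) * z ^ i)"
  shows "szego_moment \<nu> a k s = (\<Sum>i\<le>k. c i * (\<integral>t. cos (of_int (int i - s) * t) \<partial>\<nu>))"
proof -
  have "Re (cis (- (of_int s * t)) * szego a k (cis t)) = (\<Sum>i\<le>k. c i * cos (of_int (int i - s) * t))" for t
    unfolding assms sum_distrib_left Re_sum
  proof (intro sum.cong refl)
    fix i
    have "cis (- (of_int s * t)) * (of_real (c i) * cis t ^ i) = of_real (c i) * cis (of_int (int i - s) * t)"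
      by (simp add: Complex.DeMoivre cis_mult left_diff_distrib)
    then show "Re (cis (- (of_int s * t)) * (of_real (c i) * cis t ^ i)) = c i * cos (of_int (int i - s) * t)"
      by (simp only: Re_complex_of_real Re_mult_real cis.sel)
  qed
  then show ?thesis
    unfolding szego_moment_def by (simp add: Bochner_Integration.integral_sum integrable_cos)
qed

end

text \<open>Orthogonality to the constants alone determines the trigonometric moments up to order \<open>N\<close> one after the
  other, and it implies full orthogonality by the recursion.\<close>
definition has_verblunsky :: "real measure \<Rightarrow> (nat \<Rightarrow> real) \<Rightarrow> nat \<Rightarrow> bool" where
  "has_verblunsky \<nu> a N \<longleftrightarrow> (\<forall>k\<in>{1..N}. szego_moment \<nu> a k 0 = 0)"

context circle_measure begin

text \<open>For \<open>1 \<le> s \<le> k\<close> both terms of the recursion vanish by induction, the case \<open>s = 0\<close> is the hypothesis, and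
  the hypothesis read backwards gives \<open>\<langle>z \<Phi>\<^sub>k, 1\<rangle> = a\<^bsub>k+1\<^esub> E\<^sub>k\<close>, from which the new norm is computed.\<close>
lemma verblunsky_orthogonality:
  assumes "has_verblunsky \<nu> a N" "measure \<nu> UNIV = 1" "k \<le> N"
  shows "(\<forall>s. 0 \<le> s \<and> s < int k \<longrightarrow> szego_moment \<nu> a k s = 0) \<and>
         szego_moment \<nu> a k (int k) = verblunsky_energy a k"
  using assms(3)
proof (induction k)
  case 0
  have "space \<nu> = UNIV" using sets_eq_imp_space_eq[OF sets_eq] by simp
  then show ?case using assms(2) by (simp add: szego_moment_0)
next
  case (Suc k)
  let ?B = "szego_moment \<nu> a"
  have IH: "\<And>s. 0 \<le> s \<Longrightarrow> s < int k \<Longrightarrow> ?B k s = 0" "?B k (int k) = verblunsky_energy a k"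
    using Suc by auto
  have z: "?B (Suc k) 0 = 0"
    using assms(1) Suc.prems by (simp add: has_verblunsky_def)
  have X: "?B k (- 1) = a (Suc k) * verblunsky_energy a k"
    using szego_moment_Suc[of a k 0] z IH(2) by simp
  have "?B (Suc k) s = 0" if "0 \<le> s" "s < int (Suc k)" for s
    using that IH(1)[of "s - 1"] IH(1)[of "int k - s"] z szego_moment_Suc[of a k s]
    by (cases "s = 0") auto
  moreover have "?B (Suc k) (int (Suc k)) = verblunsky_energy a (Suc k)"
    using szego_moment_Suc[of a k "int (Suc k)"] IH(2) X by (simp add: algebra_simps power2_eq_square)
  ultimately show ?case by blast
qed

lemma verblunsky_next:
  assumes "has_verblunsky \<nu> a N" "measure \<nu> UNIV = 1"
  shows "has_verblunsky \<nu> a (Suc N) \<longleftrightarrow> szego_moment \<nu> a N (- 1) = a (Suc N) * verblunsky_energy a N"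
proof -
  have "has_verblunsky \<nu> a (Suc N) \<longleftrightarrow> szego_moment \<nu> a (Suc N) 0 = 0"
    using assms(1) by (auto simp: has_verblunsky_def atLeastAtMostSuc_conv)
  also have "\<dots> \<longleftrightarrow> szego_moment \<nu> a N (- 1) = a (Suc N) * verblunsky_energy a N"
    using verblunsky_orthogonality[OF assms, of N] szego_moment_Suc[of a N 0] by auto
  finally show ?thesis .
qed

lemma verblunsky_energy_eq_integral:
  assumes "has_verblunsky \<nu> a k" "measure \<nu> UNIV = 1"
  shows "verblunsky_energy a k = (\<integral>t. (norm (szego a k (cis t)))\<^sup>2 \<partial>\<nu>)"
proof -
  obtain c :: "nat \<Rightarrow> real" where c: "c k = 1" "\<And>z. szego a k z = (\<Sum>i\<le>k. of_real (c i) * z ^ i)"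
    using szego_coefficients[of k a] by blast
  have "(norm (szego a k (cis t)))\<^sup>2 = (\<Sum>i\<le>k. c i * Re (cis (- (of_int (int i) * t)) * szego a k (cis t)))" for t
  proof -
    have "(norm (szego a k (cis t)))\<^sup>2 = Re (cnj (szego a k (cis t)) * szego a k (cis t))"
      by (metis Re_complex_of_real complex_norm_square mult.commute)
    also have "cnj (szego a k (cis t)) = (\<Sum>i\<le>k. of_real (c i) * cis (- (of_int (int i) * t)))"
      unfolding c by (simp add: cis_cnj Complex.DeMoivre)
    finally show ?thesis by (simp add: sum_distrib_right mult.assoc Re_sum)
  qed
  then have "(\<integral>t. (norm (szego a k (cis t)))\<^sup>2 \<partial>\<nu>) = (\<Sum>i\<le>k. c i * szego_moment \<nu> a k (int i))"
    using integrable_szego[of "- of_int (int _)" a k]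
    by (simp add: szego_moment_def Bochner_Integration.integral_sum)
  also have "\<dots> = (\<Sum>i\<le>k. if i = k then verblunsky_energy a k else 0)"
    using verblunsky_orthogonality[OF assms, of k] c(1) by (intro sum.cong) auto
  also have "\<dots> = verblunsky_energy a k" by simp
  finally show ?thesis ..
qed

text \<open>The Szego recursion can be inverted, \<open>(1 - a\<^sup>2) z \<Phi>\<^sub>k = \<Phi>\<^bsub>k+1\<^esub> + a \<Phi>\<^sup>*\<^bsub>k+1\<^esub>\<close>, so orthogonality of the last
  polynomial descends to all earlier ones. At \<open>k = 0\<close> it says that the total mass is 1.\<close>
lemma verblunsky_backward:
  assumes a: "\<And>i. i \<in> {1..N} \<Longrightarrow> \<bar>a i\<bar> < 1"
    and top: "\<And>s. 0 \<le> s \<Longrightarrow> s < int N \<Longrightarrow> szego_moment \<nu> a N s = 0"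
      "szego_moment \<nu> a N (int N) = verblunsky_energy a N"
  shows "has_verblunsky \<nu> a N" "measure \<nu> UNIV = 1"
proof -
  let ?B = "szego_moment \<nu> a"
  have "(\<forall>s. 0 \<le> s \<and> s < int k \<longrightarrow> ?B k s = 0) \<and> ?B k (int k) = verblunsky_energy a k"
    if "k \<le> N" for k
    using that
  proof (induction rule: inc_induct)
    case base
    then show ?case using top by auto
  next
    case (step k)
    have nz: "1 - (a (Suc k))\<^sup>2 \<noteq> 0"
      using a[of "Suc k"] step.hyps abs_square_less_1[of "a (Suc k)"] by auto
    have inv: "(1 - (a (Suc k))\<^sup>2) * ?B k s = ?B (Suc k) (s + 1) + a (Suc k) * ?B (Suc k) (int k - s)" for s
      by (simp add: szego_moment_Suc algebra_simps power2_eq_square)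
    have "?B k s = 0" if "0 \<le> s" "s < int k" for s
      using inv[of s] nz step.IH that by auto
    moreover have "?B k (int k) = verblunsky_energy a k"
      using inv[of "int k"] nz step.IH by (auto simp: add.commute)
    ultimately show ?case by blast
  qed note * = this
  show "has_verblunsky \<nu> a N" using * by (auto simp: has_verblunsky_def)
  have "space \<nu> = UNIV" using sets_eq_imp_space_eq[OF sets_eq] by simp
  then show "measure \<nu> UNIV = 1" using *[of 0] by (simp add: szego_moment_0)
qed

end

section \<open>Bernstein-Szego measures and moments on the unit interval\<close>

lemma holomorphic_szego:
  "szego a k holomorphic_on A" "szego_rev a k holomorphic_on A"
proof (induction k)
  case 0
  { case 1 show ?case by (simp add: holomorphic_on_def[abs_def] cong: holomorphic_cong) }
  { case 2 show ?case by (simp cong: holomorphic_cong) }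
next
  case (Suc k)
  { case 1 show ?case using Suc by (auto intro!: holomorphic_intros cong: holomorphic_cong) }
  { case 2 show ?case using Suc by (auto intro!: holomorphic_intros cong: holomorphic_cong) }
qed

lemma circle_mean_value:
  fixes h :: "complex \<Rightarrow> complex"
  assumes "h holomorphic_on cball 0 1"
  shows "((\<lambda>t. h (cis t)) has_integral 2 * pi * h 0) {0..2*pi}"
proof -
  have "((\<lambda>u. h u / (u - 0)) has_contour_integral (2 * of_real pi * \<i> * h 0)) (circlepath 0 1)"
    by (rule Cauchy_integral_circlepath_simple[OF assms]) simp
  then have "((\<lambda>t. h (0 + of_real 1 * cis t) / (0 + of_real 1 * cis t - 0) * of_real 1 * \<i> * cis t)
      has_integral (2 * of_real pi * \<i> * h 0)) {0..2*pi}"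
    unfolding circlepath_def by (subst (asm) has_contour_integral_part_circlepath_iff) auto
  then have "((\<lambda>t. h (cis t) * \<i>) has_integral (2 * of_real pi * \<i> * h 0)) {0..2*pi}"
    by simp
  note * = has_integral_mult_right[OF this, of "- \<i>"]
  have "- \<i> * (z * \<i>) = z" "- \<i> * (2 * of_real pi * \<i> * z) = 2 * of_real pi * z" for z
    by (simp_all add: complex_eq_iff)
  then show ?thesis using * by (simp only: of_real_mult of_real_numeral)
qed

text \<open>The measure on the circle all of whose Verblunsky coefficients beyond \<open>N\<close> vanish.\<close>
definition bernstein_szego :: "(nat \<Rightarrow> real) \<Rightarrow> nat \<Rightarrow> real measure" where
  "bernstein_szego a N = density lborel (\<lambda>t. ennreal
     (indicator {0..2*pi} t * (verblunsky_energy a N / (2 * pi * (norm (szego a N (cis t)))\<^sup>2))))"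

context
  fixes a :: "nat \<Rightarrow> real" and N :: nat
  assumes a_bound: "\<And>i. i \<in> {1..N} \<Longrightarrow> \<bar>a i\<bar> < 1"
begin

private definition g :: "real \<Rightarrow> real" where
  "g t = verblunsky_energy a N / (2 * pi * (norm (szego a N (cis t)))\<^sup>2)"

private lemma g_nonneg: "0 \<le> indicator {0..2*pi} t * g t"
  using verblunsky_energy_pos[of N a] a_bound by (simp add: g_def)

private lemma continuous_g: "continuous_on A g"
  unfolding g_def using szego_circle_nonzero[of N a] a_bound
  by (auto intro!: continuous_intros continuous_on_subset[OF continuous_szego(1)])

private lemma g_measurable [measurable]: "g \<in> borel_measurable borel"
  by (intro borel_measurable_continuous_onI continuous_g)

private lemma bernstein_szego_g: "bernstein_szego a N = density lborel (\<lambda>t. ennreal (indicator {0..2*pi} t * g t))"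
  by (simp add: bernstein_szego_def g_def)

lemma circle_measure_bernstein_szego: "circle_measure (bernstein_szego a N)"
proof (intro circle_measure.intro finite_measureI circle_measure_axioms.intro)
  have "set_integrable lborel {0..2*pi} g"
    by (intro borel_integrable_atLeastAtMost' continuous_g)
  then have "integrable lborel (\<lambda>t. indicator {0..2*pi} t * g t)"
    by (simp add: set_integrable_def)
  then have "(\<integral>\<^sup>+t. ennreal (indicator {0..2*pi} t * g t) \<partial>lborel) \<noteq> \<infinity>"
    by (subst nn_integral_eq_integral) (auto simp: g_nonneg)
  then show "emeasure (bernstein_szego a N) (space (bernstein_szego a N)) \<noteq> \<infinity>"
    unfolding bernstein_szego_g by (subst emeasure_density) auto
  show "sets (bernstein_szego a N) = sets borel"
    by (simp add: bernstein_szego_def)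
qed

private lemma integral_bernstein_szego:
  assumes "continuous_on UNIV f"
  shows "(\<integral>t. f t \<partial>bernstein_szego a N) = integral {0..2*pi} (\<lambda>t. g t * f t)"
proof -
  have [measurable]: "f \<in> borel_measurable borel"
    using assms by (rule borel_measurable_continuous_onI)
  have "(\<integral>t. f t \<partial>bernstein_szego a N) = (\<integral>t. (indicator {0..2*pi} t * g t) *\<^sub>R f t \<partial>lborel)"
    unfolding bernstein_szego_g by (rule integral_density) (auto simp: g_nonneg)
  also have "\<dots> = set_lebesgue_integral lborel {0..2*pi} (\<lambda>t. g t * f t)"
    by (simp add: set_lebesgue_integral_def mult.assoc)
  also have "\<dots> = integral {0..2*pi} (\<lambda>t. g t * f t)"
    by (intro set_borel_integral_eq_integral borel_integrable_atLeastAtMost' continuous_on_mult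
        continuous_g continuous_on_subset[OF assms]) auto
  finally show ?thesis .
qed

text \<open>On the circle \<open>z\<^bsup>-s\<^esup> \<Phi>\<^sub>N / \<bar>\<Phi>\<^sub>N\<bar>\<^sup>2 = z\<^bsup>N-s\<^esup> / \<Phi>\<^sup>*\<^sub>N\<close>, and the right-hand side is holomorphic in the disc, so the
  integral is its value at the origin. The case \<open>s = -1\<close> expresses that the next coefficient vanishes.\<close>
lemma szego_moment_bernstein_szego:
  assumes "s \<le> int N"
  shows "szego_moment (bernstein_szego a N) a N s = (if s = int N then verblunsky_energy a N else 0)"
proof -
  define h where "h z = z ^ nat (int N - s) / szego_rev a N z" for z
  define E where "E = verblunsky_energy a N"
  have "h holomorphic_on cball 0 1"
    unfolding h_def using szego_norm_le_rev[of N a] a_bound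
    by (auto intro!: holomorphic_intros holomorphic_szego)
  then have "((\<lambda>t. h (cis t)) has_integral 2 * pi * h 0) {0..2*pi}"
    by (rule circle_mean_value)
  then have "((\<lambda>t. Re (h (cis t))) has_integral Re (2 * pi * h 0)) {0..2*pi}"
    by (rule has_integral_Re)
  from has_integral_mult_right[OF this, of "E / (2 * pi)"]
  have "((\<lambda>t. E / (2 * pi) * Re (h (cis t))) has_integral (E * Re (h 0))) {0..2*pi}"
    by simp
  moreover have "E / (2 * pi) * Re (h (cis t)) = g t * Re (cis (- (of_int s * t)) * szego a N (cis t))" for t
  proof -
    let ?\<Phi> = "szego a N (cis t)"
    have nz: "?\<Phi> \<noteq> 0" using szego_circle_nonzero[of N a t] a_bound by simp
    have 1: "cis t ^ nat (int N - s) = cis (real N * t) * cis (- (of_int s * t))"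
      using assms by (simp add: Complex.DeMoivre cis_mult left_diff_distrib)
    have "h (cis t) = cis (- (of_int s * t)) / cnj ?\<Phi>"
      unfolding h_def 1 szego_rev_circle by simp
    also have "\<dots> = cis (- (of_int s * t)) * ?\<Phi> / (cnj ?\<Phi> * ?\<Phi>)"
      using nz by simp
    also have "cnj ?\<Phi> * ?\<Phi> = of_real ((norm ?\<Phi>)\<^sup>2)"
      by (simp only: complex_norm_square mult.commute)
    finally have "h (cis t) = cis (- (of_int s * t)) * ?\<Phi> / of_real ((norm ?\<Phi>)\<^sup>2)" .
    then have "Re (h (cis t)) = Re (cis (- (of_int s * t)) * ?\<Phi>) / (norm ?\<Phi>)\<^sup>2"
      by (simp only: Re_divide_of_real)
    then show ?thesis by (simp only: g_def E_def) (simp add: field_simps)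
  qed
  ultimately have "((\<lambda>t. g t * Re (cis (- (of_int s * t)) * szego a N (cis t))) has_integral (E * Re (h 0))) {0..2*pi}"
    by (simp only:)
  then have "szego_moment (bernstein_szego a N) a N s = E * Re (h 0)"
    unfolding szego_moment_def
    by (subst integral_bernstein_szego) (auto intro!: continuous_intros continuous_szego simp del: times_complex.sel dest: integral_unique)
  also have "Re (h 0) = (if s = int N then 1 else 0)"
  proof -
    have "szego_rev a k 0 = 1" for k by (induction k) auto
    then show ?thesis using assms by (simp add: h_def power_0_left)
  qed
  finally show ?thesis by (simp add: E_def)
qed

lemma bernstein_szego_verblunsky:
  "has_verblunsky (bernstein_szego a N) a N" "measure (bernstein_szego a N) UNIV = 1"
proof -
  interpret circle_measure "bernstein_szego a N" by (rule circle_measure_bernstein_szego)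
  show "has_verblunsky (bernstein_szego a N) a N" "measure (bernstein_szego a N) UNIV = 1"
    using verblunsky_backward[of N a] a_bound szego_moment_bernstein_szego by auto
qed

end

text \<open>The moments of the law that \<open>\<nu>\<close> induces on \<open>[0,1]\<close>.\<close>
definition cos_moment :: "real measure \<Rightarrow> nat \<Rightarrow> real" where
  "cos_moment \<nu> j = (\<integral>t. ((1 + cos t) / 2) ^ j \<partial>\<nu>)"

lemma half_angle_power:
  "((1 + cos t) / 2) ^ j = (\<Sum>r\<le>2*j. real (2 * j choose r) * cos (of_int (int r - int j) * t)) / 4 ^ j"
proof -
  have "of_real (2 * cos (t / 2)) = cis (t / 2) + cis (- (t / 2))"
    by (simp add: complex_eq_iff)
  then have "of_real ((2 * cos (t / 2)) ^ (2 * j)) = (cis (t / 2) + cis (- (t / 2))) ^ (2 * j)"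
    by (metis of_real_power)
  also have "\<dots> = (\<Sum>r\<le>2*j. of_nat (2 * j choose r) * cis (t / 2) ^ r * cis (- (t / 2)) ^ (2 * j - r))"
    by (rule binomial_ring)
  also have "\<dots> = (\<Sum>r\<le>2*j. of_real (real (2 * j choose r)) * cis (of_int (int r - int j) * t))"
  proof (intro sum.cong refl)
    fix r assume "r \<in> {..2 * j}"
    then have r: "r \<le> 2 * j" by simp
    have "cis (t / 2) ^ r * cis (- (t / 2)) ^ (2 * j - r) = cis (of_int (int r - int j) * t)"
      unfolding Complex.DeMoivre cis_mult using r
      by (intro arg_cong[where f=cis]) (simp add: of_nat_diff field_simps)
    then show "of_nat (2 * j choose r) * cis (t / 2) ^ r * cis (- (t / 2)) ^ (2 * j - r) =
        of_real (real (2 * j choose r)) * cis (of_int (int r - int j) * t)"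
      by (simp add: mult.assoc)
  qed
  finally have "Re (of_real ((2 * cos (t / 2)) ^ (2 * j))) =
      Re (\<Sum>r\<le>2*j. of_real (real (2 * j choose r)) * cis (of_int (int r - int j) * t))" by (rule arg_cong)
  then have "(2 * cos (t / 2)) ^ (2 * j) = (\<Sum>r\<le>2*j. real (2 * j choose r) * cos (of_int (int r - int j) * t))"
    by (simp only: Re_sum Re_mult_real Re_complex_of_real cis.sel)
  moreover have "(2 * cos (t / 2)) ^ (2 * j) = ((1 + cos t) / 2) ^ j * 4 ^ j"
  proof -
    have "(2 * cos (t / 2))\<^sup>2 = (1 + cos t) / 2 * 4"
      using cos_double_cos[of "t / 2"] by (simp add: power_mult_distrib)
    then show ?thesis by (simp only: power_mult power_mult_distrib)
  qed
  ultimately show ?thesis by (simp add: field_simps)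
qed

context circle_measure begin

lemma cos_moment_trig:
  "cos_moment \<nu> j = (\<Sum>r\<le>2*j. real (2 * j choose r) * (\<integral>t. cos (of_int (int r - int j) * t) \<partial>\<nu>)) / 4 ^ j"
  unfolding cos_moment_def half_angle_power
  using integrable_cos by (simp add: Bochner_Integration.integral_sum)

end

text \<open>Two laws with the same coefficients up to \<open>N\<close> have the same trigonometric moments up to \<open>N\<close>, and the
  difference of the next ones can be read off from \<open>\<langle>z \<Phi>\<^sub>N, 1\<rangle>\<close>, because \<open>\<Phi>\<^sub>N\<close> is monic.\<close>
locale circle_measure_pair = circle_measure \<nu> + \<nu>': circle_measure \<nu>' for \<nu> \<nu>' :: "real measure" +
  fixes a :: "nat \<Rightarrow> real" and N :: nat
  assumes mass: "measure \<nu> UNIV = 1" "measure \<nu>' UNIV = 1"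
    and verb: "has_verblunsky \<nu> a N" "has_verblunsky \<nu>' a N"
begin

definition trig_diff :: "int \<Rightarrow> real" where
  "trig_diff i = (\<integral>t. cos (of_int i * t) \<partial>\<nu>) - (\<integral>t. cos (of_int i * t) \<partial>\<nu>')"

lemma trig_diff_minus: "trig_diff (- i) = trig_diff i"
  by (simp add: trig_diff_def)

lemma trig_diff_0: "trig_diff 0 = 0"
proof -
  have "space \<nu> = UNIV" "space \<nu>' = UNIV"
    using sets_eq_imp_space_eq[OF sets_eq] sets_eq_imp_space_eq[OF \<nu>'.sets_eq] by auto
  then show ?thesis using mass by (simp add: trig_diff_def)
qed

lemma szego_moment_diff:
  assumes "\<And>i. i < k \<Longrightarrow> trig_diff (int i - s) = 0"
  shows "szego_moment \<nu> a k s - szego_moment \<nu>' a k s = trig_diff (int k - s)"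
proof -
  obtain c :: "nat \<Rightarrow> real" where c: "c k = 1" "\<And>z. szego a k z = (\<Sum>i\<le>k. of_real (c i) * z ^ i)"
    using szego_coefficients[of k a] by blast
  have "szego_moment \<nu> a k s - szego_moment \<nu>' a k s = (\<Sum>i\<le>k. c i * trig_diff (int i - s))"
    unfolding szego_moment_coefficients[OF c(2)] \<nu>'.szego_moment_coefficients[OF c(2)]
    by (simp add: trig_diff_def sum_subtractf right_diff_distrib)
  also have "\<dots> = (\<Sum>i\<le>k. if i = k then trig_diff (int k - s) else 0)"
    using assms c(1) by (intro sum.cong) auto
  finally show ?thesis by simp
qed

lemma trig_diff_eq_0: "i \<le> N \<Longrightarrow> trig_diff (int i) = 0"
proof (induction i rule: less_induct)
  case (less i)
  show ?case
  proof (cases "i = 0")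
    case False
    then have "szego_moment \<nu> a i 0 = 0" "szego_moment \<nu>' a i 0 = 0"
      using verb less.prems by (auto simp: has_verblunsky_def)
    then show ?thesis using szego_moment_diff[of i 0] less by simp
  qed (simp add: trig_diff_0)
qed

lemma trig_diff_Suc: "trig_diff (int (Suc N)) = szego_moment \<nu> a N (- 1) - szego_moment \<nu>' a N (- 1)"
proof -
  have "trig_diff (int i + 1) = 0" if "i < N" for i
    using trig_diff_eq_0[of "Suc i"] that by (simp add: add.commute)
  then show ?thesis using szego_moment_diff[of N "- 1"] by (simp add: add.commute)
qed

lemma cos_moment_diff:
  "cos_moment \<nu> j - cos_moment \<nu>' j = (\<Sum>r\<le>2*j. real (2 * j choose r) * trig_diff (int r - int j)) / 4 ^ j"
  unfolding cos_moment_trig \<nu>'.cos_moment_trig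
  by (simp add: trig_diff_def sum_subtractf right_diff_distrib diff_divide_distrib)

lemma trig_diff_eq_0_abs: "\<bar>i\<bar> \<le> int N \<Longrightarrow> trig_diff i = 0"
  using trig_diff_eq_0[of "nat \<bar>i\<bar>"] trig_diff_minus[of i] by (cases "i \<ge> 0") auto

text \<open>Only the frequencies \<open>\<plusminus>(N + 1)\<close> survive in the expansion of \<open>((1 + cos t) / 2)\<^bsup>N+1\<^esup>\<close>, each with coefficient
  \<open>4\<^bsup>-(N+1)\<^esup>\<close>.\<close>
lemma cos_moment_Suc_diff:
  "cos_moment \<nu> (Suc N) - cos_moment \<nu>' (Suc N) =
     2 / 4 ^ Suc N * (szego_moment \<nu> a N (- 1) - szego_moment \<nu>' a N (- 1))"
proof -
  let ?j = "Suc N"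
  have "(\<Sum>r\<le>2*?j. real (2 * ?j choose r) * trig_diff (int r - int ?j)) =
      (\<Sum>r\<in>{0, 2*?j}. real (2 * ?j choose r) * trig_diff (int r - int ?j))"
  proof (rule sum.mono_neutral_right)
    show "\<forall>r\<in>{..2*?j} - {0, 2*?j}. real (2 * ?j choose r) * trig_diff (int r - int ?j) = 0"
    proof
      fix r assume "r \<in> {..2*?j} - {0, 2*?j}"
      then have "\<bar>int r - int ?j\<bar> \<le> int N" by auto
      then show "real (2 * ?j choose r) * trig_diff (int r - int ?j) = 0"
        by (simp only: trig_diff_eq_0_abs mult_zero_right)
    qed
  qed auto
  also have "\<dots> = 2 * trig_diff (int ?j)"
    using trig_diff_minus[of "int ?j"] by simp
  finally show ?thesis
    unfolding cos_moment_diff by (simp only: trig_diff_Suc times_divide_eq_left)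
qed

end

section \<open>Hankel determinants\<close>

text \<open>Chebyshev polynomials transplanted to \<open>[0,1]\<close>.\<close>
fun cheb :: "nat \<Rightarrow> real poly" where
  "cheb 0 = 1"
| "cheb (Suc 0) = [:- 1, 2:]"
| "cheb (Suc (Suc k)) = [:- 2, 4:] * cheb (Suc k) - cheb k"

lemma poly_cheb: "poly (cheb k) ((1 + cos t) / 2) = cos (real k * t)"
proof (induction k rule: cheb.induct)
  case (3 k)
  have "cos (real (Suc (Suc k)) * t) = 2 * cos t * cos (real (Suc k) * t) - cos (real k * t)"
  proof -
    have "cos (real (Suc (Suc k)) * t) = cos (real (Suc k) * t + t)"
      "cos (real k * t) = cos (real (Suc k) * t - t)"
      by (simp_all add: algebra_simps)
    then show ?thesis by (simp add: cos_add cos_diff)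
  qed
  moreover have "poly [:- 2, 4:] ((1 + cos t) / 2) = 2 * cos t" by (simp add: field_simps)
  ultimately show ?case
    by (simp only: cheb.simps poly_diff poly_mult 3)
qed (simp_all add: field_simps)

lemma coeff_cheb_above: "k < i \<Longrightarrow> Polynomial.coeff (cheb k) i = 0"
proof (induction k arbitrary: i rule: cheb.induct)
  case (3 k)
  then show ?case by (cases i) (auto simp: coeff_pCons)
qed (auto simp: coeff_pCons split: nat.splits)

lemma coeff_cheb_lead: "Polynomial.coeff (cheb k) k = (if k = 0 then 1 else 2 ^ (2 * k - 1))"
proof (induction k rule: cheb.induct)
  case (3 k)
  then show ?case by (auto simp: coeff_cheb_above coeff_pCons)
qed (auto simp: coeff_pCons)

text \<open>On the circle \<open>z\<^bsup>-k\<^esup> (\<Phi>\<^bsub>2k\<^esub> + \<Phi>\<^sup>*\<^bsub>2k\<^esub>)\<close> is twice the real part of \<open>z\<^bsup>-k\<^esup> \<Phi>\<^bsub>2k\<^esub>\<close>, a cosine polynomial of degree \<open>k\<close>.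
  Its top frequency collects the leading coefficient 1 and the constant coefficient \<open>-a\<^bsub>2k\<^esub>\<close> of \<open>\<Phi>\<^bsub>2k\<^esub>\<close>.\<close>
lemma orthogonal_polynomial_exists:
  assumes "k > 0"
  shows "\<exists>U :: real poly. (\<forall>i>k. Polynomial.coeff U i = 0) \<and> Polynomial.coeff U k = 4 ^ k * (1 - a (2 * k)) \<and>
    (\<forall>t. poly U ((1 + cos t) / 2) = 2 * Re (cis (- (real k * t)) * szego a (2 * k) (cis t)))"
proof -
  obtain c :: "nat \<Rightarrow> real" where c: "c (2 * k) = 1" "c 0 = - a (2 * k)"
    "\<And>z. szego a (2 * k) z = (\<Sum>i\<le>2*k. of_real (c i) * z ^ i)"
    using szego_coefficients[of "2 * k" a] assms by auto
  define d where "d i = nat \<bar>int i - int k\<bar>" for i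
  define U where "U = (\<Sum>i\<le>2*k. Polynomial.smult (2 * c i) (cheb (d i)))"
  have "Polynomial.coeff U i = 0" if "i > k" for i
    unfolding U_def coeff_sum using that
    by (intro sum.neutral) (auto simp: d_def intro!: coeff_cheb_above)
  moreover have "Polynomial.coeff U k = 4 ^ k * (1 - a (2 * k))"
  proof -
    have "Polynomial.coeff U k = (\<Sum>i\<in>{0, 2*k}. 2 * c i * Polynomial.coeff (cheb (d i)) k)"
      unfolding U_def coeff_sum coeff_smult
    proof (rule sum.mono_neutral_right)
      show "\<forall>i\<in>{..2*k} - {0, 2*k}. 2 * c i * Polynomial.coeff (cheb (d i)) k = 0"
      proof
        fix i assume "i \<in> {..2*k} - {0, 2*k}"
        then have "d i < k" by (auto simp: d_def)
        then show "2 * c i * Polynomial.coeff (cheb (d i)) k = 0" by (simp add: coeff_cheb_above)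
      qed
    qed auto
    also have "\<dots> = 2 * 2 ^ (2 * k - 1) * (1 - a (2 * k))"
      using assms c by (simp add: d_def coeff_cheb_lead algebra_simps)
    also have "2 * 2 ^ (2 * k - 1) = (4::real) ^ k"
      using assms by (simp add: power_mult flip: power_Suc)
    finally show ?thesis .
  qed
  moreover have "poly U ((1 + cos t) / 2) = 2 * Re (cis (- (real k * t)) * szego a (2 * k) (cis t))" for t
  proof -
    have "cis (- (real k * t)) * szego a (2 * k) (cis t) =
        (\<Sum>i\<le>2*k. of_real (c i) * cis (of_int (int i - int k) * t))"
      unfolding c(3) sum_distrib_left
      by (intro sum.cong refl) (simp add: Complex.DeMoivre cis_mult left_diff_distrib)
    then have "Re (cis (- (real k * t)) * szego a (2 * k) (cis t)) =
        (\<Sum>i\<le>2*k. c i * cos (of_int (int i - int k) * t))"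
      by (simp only: Re_sum Re_mult_real cis.sel)
    moreover have "cos (of_int (int i - int k) * t) = cos (real (d i) * t)" for i
    proof (cases "i \<ge> k")
      case False
      then have "real (d i) * t = - (of_int (int i - int k) * t)" by (simp add: d_def of_nat_diff algebra_simps)
      then show ?thesis by (simp only: cos_minus)
    qed (simp add: d_def)
    ultimately show ?thesis
      by (simp only: U_def poly_sum poly_smult poly_cheb sum_distrib_left mult.assoc)
  qed
  ultimately show ?thesis by blast
qed

lemma Re_mult_2_cos:
  "2 * Re w * cos x = Re (cis (- x) * w) + Re (cis x * w)"
  by simp

context circle_measure begin

text \<open>Expanding \<open>x\<^sup>j\<close> in cosines, the integral is a combination of \<open>\<langle>\<Phi>\<^bsub>2k\<^esub>, z\<^sup>s\<rangle>\<close> with \<open>k - j \<le> s \<le> k + j\<close>, all of which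
  vanish unless \<open>s = 2k\<close>.\<close>
lemma integral_orthogonal_polynomial:
  assumes V: "has_verblunsky \<nu> a (2 * k)" "measure \<nu> UNIV = 1" and "k > 0" "j \<le> k"
    and U: "\<And>t. poly U ((1 + cos t) / 2) = 2 * Re (cis (- (real k * t)) * szego a (2 * k) (cis t))"
  shows "(\<integral>t. poly U ((1 + cos t) / 2) * ((1 + cos t) / 2) ^ j \<partial>\<nu>) =
    (if j = k then 2 / 4 ^ k * verblunsky_energy a (2 * k) else 0)"
proof -
  let ?B = "szego_moment \<nu> a (2 * k)"
  have B: "(\<integral>t. poly U ((1 + cos t) / 2) * cos (of_int s * t) \<partial>\<nu>) = ?B (int k + s) + ?B (int k - s)" for s
  proof -
    have "poly U ((1 + cos t) / 2) * cos (of_int s * t) =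
        Re (cis (- (of_int (int k + s) * t)) * szego a (2 * k) (cis t)) +
        Re (cis (- (of_int (int k - s) * t)) * szego a (2 * k) (cis t))" for t
    proof -
      have "cis (- (of_int s * t)) * cis (- (real k * t)) = cis (- (of_int (int k + s) * t))"
        "cis (of_int s * t) * cis (- (real k * t)) = cis (- (of_int (int k - s) * t))"
        by (simp_all add: cis_mult algebra_simps)
      then show ?thesis unfolding U Re_mult_2_cos mult.assoc[symmetric] by (simp only:)
    qed
    moreover have int: "integrable \<nu> (\<lambda>t. Re (cis (- (of_int s * t)) * szego a (2 * k) (cis t)))" for s
      using integrable_szego[of "- of_int s"] by (simp only: minus_mult_left)
    ultimately show ?thesis
      unfolding szego_moment_def by (simp only: Bochner_Integration.integral_add[OF int int])
  qed
  have intU: "integrable \<nu> (\<lambda>t. poly U ((1 + cos t) / 2) * cos (of_int s * t))" for s :: int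
  proof -
    have "integrable \<nu> (\<lambda>t. Re (cis ((- of_int s - real k) * t) * szego a (2 * k) (cis t)) +
       Re (cis ((of_int s - real k) * t) * szego a (2 * k) (cis t)))"
      by (intro Bochner_Integration.integrable_add integrable_szego)
    moreover have "poly U ((1 + cos t) / 2) * cos (of_int s * t) =
       Re (cis ((- of_int s - real k) * t) * szego a (2 * k) (cis t)) +
       Re (cis ((of_int s - real k) * t) * szego a (2 * k) (cis t))" for t
    proof -
      have "cis (- (of_int s * t)) * cis (- (real k * t)) = cis ((- of_int s - real k) * t)"
        "cis (of_int s * t) * cis (- (real k * t)) = cis ((of_int s - real k) * t)"
        by (simp_all add: cis_mult algebra_simps)
      then show ?thesis unfolding U Re_mult_2_cos mult.assoc[symmetric] by (simp only:)
    qed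
    ultimately show ?thesis by (simp only:)
  qed
  have "(\<integral>t. poly U ((1 + cos t) / 2) * ((1 + cos t) / 2) ^ j \<partial>\<nu>) =
      (\<integral>t. (\<Sum>r\<le>2*j. real (2 * j choose r) / 4 ^ j * (poly U ((1 + cos t) / 2) * cos (of_int (int r - int j) * t))) \<partial>\<nu>)"
    unfolding half_angle_power by (intro Bochner_Integration.integral_cong refl)
      (simp add: sum_distrib_left sum_divide_distrib mult_ac)
  also have "\<dots> = (\<Sum>r\<le>2*j. real (2 * j choose r) / 4 ^ j *
      (?B (int k + (int r - int j)) + ?B (int k - (int r - int j))))"
    by (subst Bochner_Integration.integral_sum)
      (simp_all only: B integral_mult_right_zero integrable_mult_right[OF intU])
  also have "\<dots> = (if j = k then 2 / 4 ^ k * verblunsky_energy a (2 * k) else 0)"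
  proof -
    have orth: "?B s = (if s = int (2 * k) then verblunsky_energy a (2 * k) else 0)"
      if "0 \<le> s" "s \<le> int (2 * k)" for s
      using verblunsky_orthogonality[OF V order_refl] that by auto
    have summand: "?B (int k + (int r - int j)) + ?B (int k - (int r - int j)) =
        (if j = k \<and> (r = 0 \<or> r = 2 * j) then verblunsky_energy a (2 * k) else 0)" if "r \<le> 2 * j" for r
      using that \<open>j \<le> k\<close> \<open>k > 0\<close> by (subst (1 2) orth) auto
    show ?thesis
    proof (cases "j = k")
      case True
      have "(\<Sum>r\<le>2*j. real (2 * j choose r) / 4 ^ j *
          (?B (int k + (int r - int j)) + ?B (int k - (int r - int j)))) =
          (\<Sum>r\<le>2*j. if r \<in> {0, 2*j} then real (2 * j choose r) / 4 ^ j * verblunsky_energy a (2 * k) else 0)"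
        using True summand by (intro sum.cong refl) (simp only: atMost_iff insert_iff empty_iff simp_thms if_distrib[of "(*) _"] mult_zero_right)
      also have "\<dots> = (\<Sum>r\<in>{0, 2*j}. real (2 * j choose r) / 4 ^ j * verblunsky_energy a (2 * k))"
        by (intro sum.mono_neutral_cong_right) auto
      also have "\<dots> = 2 / 4 ^ k * verblunsky_energy a (2 * k)" using True \<open>k > 0\<close> by simp
      finally show ?thesis using True by simp
    qed (simp add: summand)
  qed
  finally show ?thesis .
qed

text \<open>Let \<open>W\<close> be the matrix of coefficients of the orthogonal polynomials and \<open>H\<close> the Hankel matrix. Then \<open>W\<close> is
  lower triangular and, by orthogonality, \<open>W * H\<close> is upper triangular, with both diagonals known.\<close>
lemma det_hankel_cos_moment:
  assumes V: "has_verblunsky \<nu> a (2 * l)" "measure \<nu> UNIV = 1"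
    and a: "\<And>i. i \<in> {1..2*l} \<Longrightarrow> \<bar>a i\<bar> < 1"
  shows "Determinant.det (Matrix.mat (l + 1) (l + 1) (\<lambda>(i, j). cos_moment \<nu> (i + j))) =
    (\<Prod>k\<in>{1..l}. 2 / 16 ^ k * verblunsky_energy a (2 * k - 1) * (1 + a (2 * k)))"
proof -
  have "\<forall>k. \<exists>U :: real poly. k > 0 \<longrightarrow> (\<forall>i>k. Polynomial.coeff U i = 0) \<and> Polynomial.coeff U k = 4 ^ k * (1 - a (2 * k)) \<and>
    (\<forall>t. poly U ((1 + cos t) / 2) = 2 * Re (cis (- (real k * t)) * szego a (2 * k) (cis t)))"
    using orthogonal_polynomial_exists by blast
  then obtain U0 :: "nat \<Rightarrow> real poly" where U0: "\<And>k. k > 0 \<Longrightarrow> (\<forall>i>k. Polynomial.coeff (U0 k) i = 0) \<and> Polynomial.coeff (U0 k) k = 4 ^ k * (1 - a (2 * k)) \<and>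
    (\<forall>t. poly (U0 k) ((1 + cos t) / 2) = 2 * Re (cis (- (real k * t)) * szego a (2 * k) (cis t)))"
    by metis
  define U where "U k = (if k = 0 then 1 else U0 k)" for k
  have U_above: "Polynomial.coeff (U k) i = 0" if "i > k" for k i using U0[of k] that by (simp add: U_def)
  have U_lead: "Polynomial.coeff (U k) k = (if k = 0 then 1 else 4 ^ k * (1 - a (2 * k)))" for k
    using U0[of k] by (simp add: U_def)
  define H where "H = Matrix.mat (l + 1) (l + 1) (\<lambda>(i, j). cos_moment \<nu> (i + j))"
  define W where "W = Matrix.mat (l + 1) (l + 1) (\<lambda>(k, i). Polynomial.coeff (U k) i)"
  have carr: "H \<in> carrier_mat (l + 1) (l + 1)" "W \<in> carrier_mat (l + 1) (l + 1)"
    by (simp_all add: H_def W_def)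
  have cos_bd: "\<bar>(1 + cos t) / 2\<bar> \<le> 1" for t :: real
  proof -
    have "0 \<le> 1 + cos t" using cos_ge_minus_one[of t] by linarith
    then have "0 \<le> (1 + cos t) / 2" "(1 + cos t) / 2 \<le> 1" by simp_all
    then show ?thesis by (simp only: abs_of_nonneg)
  qed
  have int_pow: "integrable \<nu> (\<lambda>t. ((1 + cos t) / 2) ^ i)" for i
    by (rule integrable_bounded[of _ 1]) (measurable, simp only: power_abs power_le_one[OF abs_ge_zero cos_bd])
  have WH: "(W * H) $$ (k, j) = (\<integral>t. poly (U k) ((1 + cos t) / 2) * ((1 + cos t) / 2) ^ j \<partial>\<nu>)"
    if "k < l + 1" "j < l + 1" for k j
  proof -
    have "poly (U k) x = (\<Sum>i<l+1. Polynomial.coeff (U k) i * x ^ i)" for x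
    proof -
      have "degree (U k) \<le> k" using U_above by (intro degree_le) auto
      then show ?thesis unfolding poly_altdef
        using that by (intro sum.mono_neutral_left) (auto simp: coeff_eq_0)
    qed
    then have "(\<integral>t. poly (U k) ((1 + cos t) / 2) * ((1 + cos t) / 2) ^ j \<partial>\<nu>) =
        (\<integral>t. (\<Sum>i<l+1. Polynomial.coeff (U k) i * ((1 + cos t) / 2) ^ (i + j)) \<partial>\<nu>)"
      by (simp only: sum_distrib_right power_add mult.assoc)
    also have "\<dots> = (\<Sum>i<l+1. Polynomial.coeff (U k) i * cos_moment \<nu> (i + j))"
      unfolding cos_moment_def
      by (subst Bochner_Integration.integral_sum) (simp_all only: integral_mult_right_zero integrable_mult_right[OF int_pow])
    also have "\<dots> = (W * H) $$ (k, j)"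
      using that by (simp add: W_def H_def scalar_prod_def atLeast0LessThan)
    finally show ?thesis ..
  qed
  have mass0: "cos_moment \<nu> 0 = 1"
    using sets_eq_imp_space_eq[OF sets_eq] V(2) by (simp add: cos_moment_def)
  have WH_entry: "(W * H) $$ (k, j) = (if j = k then (if k = 0 then 1 else 2 / 4 ^ k * verblunsky_energy a (2 * k)) else 0)"
    if "k < l + 1" "j \<le> k" for k j
  proof (cases "k = 0")
    case True
    then show ?thesis using that mass0 by (subst WH) (auto simp: U_def cos_moment_def)
  next
    case False
    have "has_verblunsky \<nu> a (2 * k)" using V(1) that by (auto simp: has_verblunsky_def)
    moreover have "k > 0" using False by simp
    moreover from this have "poly (U k) ((1 + cos t) / 2) = 2 * Re (cis (- (real k * t)) * szego a (2 * k) (cis t))" for t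
    proof -
      have "U k = U0 k" using False by (simp only: U_def if_False)
      then show ?thesis using U0[OF \<open>k > 0\<close>] by (simp only:)
    qed
    ultimately have "(\<integral>t. poly (U k) ((1 + cos t) / 2) * ((1 + cos t) / 2) ^ j \<partial>\<nu>) =
        (if j = k then 2 / 4 ^ k * verblunsky_energy a (2 * k) else 0)"
      using V(2) that(2) by (intro integral_orthogonal_polynomial) auto
    then show ?thesis using that False by (simp only: WH if_False)
  qed
  have diag_prod: "prod_list (diag_mat M) = (\<Prod>k\<in>{1..l}. M $$ (k, k))"
    if "M \<in> carrier_mat (l + 1) (l + 1)" "M $$ (0, 0) = 1" for M :: "real mat"
  proof -
    have "prod_list (diag_mat M) = prod_list (map (\<lambda>k. M $$ (k, k)) [0..<l+1])"
      using that(1) by (simp add: diag_mat_def del: upt_Suc)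
    also have "\<dots> = (\<Prod>k\<in>set [0..<l+1]. M $$ (k, k))"
      by (rule prod.distinct_set_conv_list[symmetric]) simp
    also have "set [0..<l+1] = {0..<l+1}" by (rule set_upt)
    also have "{0..<l+1} = insert 0 {1..l}" by auto
    finally show ?thesis using that(2) by simp
  qed
  have "Determinant.det W = (\<Prod>k\<in>{1..l}. W $$ (k, k))"
    by (subst det_lower_triangular[OF _ carr(2)], simp add: W_def U_above, rule diag_prod[OF carr(2)])
      (simp add: W_def U_def)
  also have "\<dots> = (\<Prod>k\<in>{1..l}. 4 ^ k * (1 - a (2 * k)))"
    by (intro prod.cong refl) (simp add: W_def U_lead)
  finally have detW: "Determinant.det W = (\<Prod>k\<in>{1..l}. 4 ^ k * (1 - a (2 * k)))" .
  have carrWH: "W * H \<in> carrier_mat (l + 1) (l + 1)" using carr by simp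
  have "Determinant.det (W * H) = prod_list (diag_mat (W * H))"
  proof (rule det_upper_triangular[OF _ carrWH])
    have "dim_row (W * H) = l + 1" using carrWH by (rule carrier_matD)
    then show "upper_triangular (W * H)"
      using WH_entry by (auto simp del: index_mult_mat)
  qed
  also have "\<dots> = (\<Prod>k\<in>{1..l}. (W * H) $$ (k, k))"
    by (rule diag_prod[OF carrWH]) (subst WH_entry; simp)
  also have "\<dots> = (\<Prod>k\<in>{1..l}. 2 / 4 ^ k * verblunsky_energy a (2 * k))"
    by (intro prod.cong refl) (subst WH_entry; simp)
  finally have "Determinant.det W * Determinant.det H = (\<Prod>k\<in>{1..l}. 2 / 4 ^ k * verblunsky_energy a (2 * k))"
    by (simp only: det_mult[OF carr(2,1)])
  also have "\<dots> = Determinant.det W * (\<Prod>k\<in>{1..l}. 2 / 16 ^ k * verblunsky_energy a (2 * k - 1) * (1 + a (2 * k)))"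
    unfolding detW prod.distrib[symmetric]
  proof (intro prod.cong refl)
    fix k assume "k \<in> {1..l}"
    then have "2 * k = Suc (2 * k - 1)" by auto
    then have "verblunsky_energy a (2 * k) = (1 - (a (2 * k))\<^sup>2) * verblunsky_energy a (2 * k - 1)"
      by (metis verblunsky_energy_Suc)
    moreover have "(16::real) ^ k = 4 ^ k * 4 ^ k" by (simp flip: power_mult_distrib)
    ultimately show "2 / 4 ^ k * verblunsky_energy a (2 * k) =
        4 ^ k * (1 - a (2 * k)) * (2 / 16 ^ k * verblunsky_energy a (2 * k - 1) * (1 + a (2 * k)))"
      by (simp only:) (simp add: power2_eq_square field_simps)
  qed
  finally show ?thesis
  proof -
    assume "Determinant.det W * Determinant.det H = Determinant.det W * (\<Prod>k\<in>{1..l}. 2 / 16 ^ k * verblunsky_energy a (2 * k - 1) * (1 + a (2 * k)))"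
    moreover have "1 - a (2 * k) \<noteq> 0" if "k \<in> {1..l}" for k using a[of "2 * k"] that by auto
    then have "Determinant.det W \<noteq> 0" unfolding detW by (simp add: prod_zero_iff)
    ultimately show ?thesis by (simp add: H_def)
  qed
qed

end

section \<open>Triangular substitutions\<close>

(* Keeps index ranges in the normal form {1..k} that the measurability rules match. *)
declare One_nat_def [simp del]

text \<open>The inverse of a triangular map \<open>x \<mapsto> m\<close> given by \<open>m\<^bsub>j+1\<^esub> = r\<^sub>j x + b\<^sub>j x \<cdot> x\<^bsub>j+1\<^esub>\<close>, where \<open>r\<^sub>j\<close> and \<open>b\<^sub>j\<close> depend on
  the first \<open>j\<close> coordinates of \<open>x\<close>. The value \<open>undefined\<close> outside \<open>{1..N}\<close> makes the result a point of the
  product space on \<open>{1..N}\<close>.\<close>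
primrec tri_inv :: "(nat \<Rightarrow> (nat \<Rightarrow> real) \<Rightarrow> real) \<Rightarrow> (nat \<Rightarrow> (nat \<Rightarrow> real) \<Rightarrow> real) \<Rightarrow>
    nat \<Rightarrow> (nat \<Rightarrow> real) \<Rightarrow> nat \<Rightarrow> real" where
  "tri_inv r b 0 m = (\<lambda>_. undefined)"
| "tri_inv r b (Suc j) m = (tri_inv r b j m)(Suc j := (m (Suc j) - r j (tri_inv r b j m)) / b j (tri_inv r b j m))"

lemma tri_inv_extensional: "tri_inv r b N m \<in> extensional {1..N}"
  by (induction N) (auto simp: extensional_def)

lemma tri_inv_cong: "(\<And>i. i \<in> {1..N} \<Longrightarrow> m i = m' i) \<Longrightarrow> tri_inv r b N m = tri_inv r b N m'"
  by (induction N) auto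

lemma tri_inv_restrict: "j \<le> N \<Longrightarrow> restrict (tri_inv r b N m) {1..j} = tri_inv r b j m"
proof (induction rule: dec_induct)
  case base
  show ?case by (rule extensional_restrict[OF tri_inv_extensional])
next
  case (step N)
  have "restrict (tri_inv r b (Suc N) m) {1..j} = restrict (tri_inv r b N m) {1..j}"
    using step.hyps by (auto simp: restrict_def fun_eq_iff)
  then show ?case by (simp only: step.IH)
qed

lemma tri_inv_nth:
  "j < N \<Longrightarrow> tri_inv r b N m (Suc j) =
     (m (Suc j) - r j (tri_inv r b j m)) / b j (tri_inv r b j m)"
  using tri_inv_restrict[of "Suc j" N r b m, THEN fun_cong, of "Suc j"] by simp

locale triangular =
  fixes r b :: "nat \<Rightarrow> (nat \<Rightarrow> real) \<Rightarrow> real"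
  assumes r_measurable [measurable]: "\<And>j. r j \<in> borel_measurable (PiM {1..j} (\<lambda>_. borel))"
    and b_measurable [measurable]: "\<And>j. b j \<in> borel_measurable (PiM {1..j} (\<lambda>_. borel))"
    and b_pos: "\<And>j x. b j x > 0"
begin

lemma measurable_tri_inv: "tri_inv r b N \<in> measurable (PiM {1..N'} (\<lambda>_. borel)) (PiM {1..N} (\<lambda>_. borel))"
  if "N \<le> N'"
  using that
proof (induction N)
  case (Suc N)
  have [measurable]: "tri_inv r b N \<in> measurable (PiM {1..N'} (\<lambda>_. borel)) (PiM {1..N} (\<lambda>_. borel))"
    using Suc by simp
  have [measurable]: "Suc N \<in> {1..N'}" using Suc.prems by simp
  have "{1..Suc N} = insert (Suc N) {1..N}" by auto
  then show ?case
    unfolding tri_inv.simps(2)[abs_def] by (simp only:) measurable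
next
  case 0
  have "tri_inv r b 0 = (\<lambda>_ _. undefined)" by (rule ext) simp
  then show ?case by (simp add: space_PiM)
qed

interpretation product_sigma_finite "\<lambda>_::nat. lborel :: real measure" ..

text \<open>Fubini with the last coordinate innermost reduces each step to an affine substitution on the line, so no
  multivariate Jacobian is needed.\<close>
lemma nn_integral_tri_inv:
  assumes "g \<in> borel_measurable (PiM {1..N} (\<lambda>_. borel))"
  shows "(\<integral>\<^sup>+m. g (tri_inv r b N m) \<partial>PiM {1..N} (\<lambda>_. lborel)) =
    (\<integral>\<^sup>+x. g x * (\<Prod>j<N. ennreal (b j (restrict x {1..j}))) \<partial>PiM {1..N} (\<lambda>_. lborel))"
  using assms
proof (induction N arbitrary: g)
  case 0
  have "{1..0::nat} = {}" by simp
  then show ?case by (simp only: nn_integral_empty zero_le) simp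
next
  case (Suc N)
  have ins: "{1..Suc N} = insert (Suc N) {1..N}" by auto
  have sets_eq: "sets (PiM I (\<lambda>_::nat. lborel :: real measure)) = sets (PiM I (\<lambda>_. borel))" for I
    by (rule sets_PiM_cong) auto
  note [measurable_cong] = sets_eq
  note [measurable] = Suc.prems[unfolded ins] measurable_tri_inv[OF order_refl]
  have upd: "tri_inv r b N (m(Suc N := t)) = tri_inv r b N m" for m t
    by (rule tri_inv_cong) auto
  define h where "h x = ennreal (b N x) * (\<integral>\<^sup>+s. g (x(Suc N := s)) \<partial>lborel)" for x
  have [measurable]: "h \<in> borel_measurable (PiM {1..N} (\<lambda>_. borel))"
    unfolding h_def by measurable
  have restr: "restrict (x(Suc N := t)) {1..j} = restrict x {1..j}" if "j \<le> N" for x :: "nat \<Rightarrow> real" and t j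
    using that by (auto simp: restrict_def)
  have bm [measurable]: "(\<lambda>x. b j (restrict x {1..j})) \<in> borel_measurable (PiM (insert (Suc N) {1..N}) (\<lambda>_. borel))"
    "(\<lambda>x. b j (restrict x {1..j})) \<in> borel_measurable (PiM {1..N} (\<lambda>_. borel))" if "j \<le> N" for j
    using that by (intro measurable_compose[OF measurable_restrict_subset b_measurable]; auto)+
  have "(\<integral>\<^sup>+m. g (tri_inv r b (Suc N) m) \<partial>PiM {1..Suc N} (\<lambda>_. lborel)) =
      (\<integral>\<^sup>+m. \<integral>\<^sup>+t. g ((tri_inv r b N m)(Suc N := (t - r N (tri_inv r b N m)) / b N (tri_inv r b N m))) \<partial>lborel
        \<partial>PiM {1..N} (\<lambda>_. lborel))"
  proof -
    have "(\<lambda>m. g (tri_inv r b (Suc N) m)) \<in> borel_measurable (PiM (insert (Suc N) {1..N}) (\<lambda>_. lborel))"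
      using measurable_compose[OF measurable_tri_inv[of "Suc N", OF order_refl] Suc.prems]
      by (simp only: ins measurable_cong_sets[OF sets_eq refl])
    then show ?thesis
      unfolding ins by (subst product_nn_integral_insert) (auto simp: upd)
  qed
  also have "\<dots> = (\<integral>\<^sup>+m. h (tri_inv r b N m) \<partial>PiM {1..N} (\<lambda>_. lborel))"
  proof (rule nn_integral_cong)
    fix m :: "nat \<Rightarrow> real"
    define x where "x = tri_inv r b N m"
    have x [measurable]: "x \<in> space (PiM {1..N} (\<lambda>_. borel))"
      using tri_inv_extensional[of r b N m] by (auto simp: x_def space_PiM PiE_def)
    have [measurable]: "(\<lambda>t. g (x(Suc N := t))) \<in> borel_measurable borel"
      by (rule measurable_compose[OF measurable_component_update[OF x] Suc.prems[unfolded ins]]) simp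
    have "(\<integral>\<^sup>+t. g (x(Suc N := (t - r N x) / b N x)) \<partial>lborel) =
        ennreal \<bar>b N x\<bar> * (\<integral>\<^sup>+s. g (x(Suc N := (r N x + b N x * s - r N x) / b N x)) \<partial>lborel)"
      using b_pos[of N x] by (intro nn_integral_real_affine) auto
    also have "\<dots> = h x"
      using b_pos[of N x] by (simp add: h_def)
    finally show "(\<integral>\<^sup>+t. g ((tri_inv r b N m)(Suc N := (t - r N (tri_inv r b N m)) / b N (tri_inv r b N m))) \<partial>lborel) =
        h (tri_inv r b N m)" by (simp add: x_def)
  qed
  also have "\<dots> = (\<integral>\<^sup>+x. h x * (\<Prod>j<N. ennreal (b j (restrict x {1..j}))) \<partial>PiM {1..N} (\<lambda>_. lborel))"
    by (rule Suc.IH) measurable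
  also have "\<dots> = (\<integral>\<^sup>+x. \<integral>\<^sup>+s. g (x(Suc N := s)) * (\<Prod>j<Suc N. ennreal (b j (restrict (x(Suc N := s)) {1..j}))) \<partial>lborel
      \<partial>PiM {1..N} (\<lambda>_. lborel))"
  proof (rule nn_integral_cong)
    fix x assume "x \<in> space (PiM {1..N} (\<lambda>_. lborel :: real measure))"
    then have x: "x \<in> space (PiM {1..N} (\<lambda>_. borel))" by (simp add: space_PiM)
    have [measurable]: "(\<lambda>t. g (x(Suc N := t))) \<in> borel_measurable borel"
      by (rule measurable_compose[OF measurable_component_update[OF x] Suc.prems[unfolded ins]]) simp
    have "restrict x {1..N} = x" using x by (auto simp: space_PiM PiE_def extensional_restrict)
    then have "(\<integral>\<^sup>+s. g (x(Suc N := s)) * (\<Prod>j<Suc N. ennreal (b j (restrict (x(Suc N := s)) {1..j}))) \<partial>lborel) =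
        (\<integral>\<^sup>+s. g (x(Suc N := s)) * ((\<Prod>j<N. ennreal (b j (restrict x {1..j}))) * ennreal (b N x)) \<partial>lborel)"
      by (simp add: restr)
    also have "\<dots> = h x * (\<Prod>j<N. ennreal (b j (restrict x {1..j})))"
      by (subst nn_integral_multc) (auto simp: h_def mult_ac)
    finally show "h x * (\<Prod>j<N. ennreal (b j (restrict x {1..j}))) =
        (\<integral>\<^sup>+s. g (x(Suc N := s)) * (\<Prod>j<Suc N. ennreal (b j (restrict (x(Suc N := s)) {1..j}))) \<partial>lborel)" ..
  qed
  also have "\<dots> = (\<integral>\<^sup>+x. g x * (\<Prod>j<Suc N. ennreal (b j (restrict x {1..j}))) \<partial>PiM {1..Suc N} (\<lambda>_. lborel))"
    unfolding ins
    by (subst product_nn_integral_insert) (auto simp del: prod.lessThan_Suc)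
  finally show ?case .
qed

end

section \<open>Canonical coordinates of the moment space\<close>

lemma measurable_szego_joint:
  assumes "k \<le> N"
  shows "(\<lambda>p. szego (fst p) k (cis (snd p))) \<in> borel_measurable (PiM {1..N} (\<lambda>_. borel) \<Otimes>\<^sub>M borel) \<and>
    (\<lambda>p. szego_rev (fst p) k (cis (snd p))) \<in> borel_measurable (PiM {1..N} (\<lambda>_. borel) \<Otimes>\<^sub>M borel)"
  using assms
proof (induction k)
  case (Suc k)
  have [measurable]: "(\<lambda>p. szego (fst p) k (cis (snd p))) \<in> borel_measurable (PiM {1..N} (\<lambda>_. borel) \<Otimes>\<^sub>M borel)"
    "(\<lambda>p. szego_rev (fst p) k (cis (snd p))) \<in> borel_measurable (PiM {1..N} (\<lambda>_. borel) \<Otimes>\<^sub>M borel)"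
    using Suc by auto
  have [measurable]: "Suc k \<in> {1..N}" using Suc.prems by simp
  show ?case unfolding szego.simps szego_rev.simps by (intro conjI; measurable)
qed simp

lemma measurable_verblunsky_energy:
  "k \<le> N \<Longrightarrow> (\<lambda>a. verblunsky_energy a k) \<in> borel_measurable (PiM {1..N} (\<lambda>_. borel))"
  unfolding verblunsky_energy_def
  by (intro borel_measurable_prod borel_measurable_diff borel_measurable_const borel_measurable_power
      measurable_component_singleton) auto

text \<open>The \<open>(j+1)\<close>-st moment that belongs to the coefficients \<open>a\<^sub>1, \<dots>, a\<^sub>j, 0\<close>.\<close>
definition ref_moment :: "nat \<Rightarrow> (nat \<Rightarrow> real) \<Rightarrow> real" where
  "ref_moment j a = cos_moment (bernstein_szego a j) (Suc j)"

text \<open>Outside the cube the value 1 replaces \<open>E\<^sub>j\<close>, which may be zero or negative there; with a positive slope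
  everywhere, the substitution is a bijection of the whole space.\<close>
definition slope :: "nat \<Rightarrow> (nat \<Rightarrow> real) \<Rightarrow> real" where
  "slope j a = 2 / 4 ^ Suc j * (if \<forall>i\<in>{1..j}. \<bar>a i\<bar> < 1 then verblunsky_energy a j else 1)"

lemma slope_pos: "slope j a > 0"
  using verblunsky_energy_pos[of j a] by (auto simp: slope_def)

lemma measurable_slope [measurable]: "slope j \<in> borel_measurable (PiM {1..j} (\<lambda>_. borel))"
proof -
  have [measurable]: "(\<lambda>a. verblunsky_energy a j) \<in> borel_measurable (PiM {1..j} (\<lambda>_. borel))"
    by (rule measurable_verblunsky_energy) simp
  show ?thesis unfolding slope_def[abs_def] by measurable
qed

lemma measurable_ref_moment [measurable]: "ref_moment j \<in> borel_measurable (PiM {1..j} (\<lambda>_. borel))"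
proof -
  define w where "w p = max 0 (indicator {0..2*pi} (snd p) *
     (verblunsky_energy (fst p) j / (2 * pi * (norm (szego (fst p) j (cis (snd p))))\<^sup>2)))" for p
  have [measurable]: "(\<lambda>a. verblunsky_energy a j) \<in> borel_measurable (PiM {1..j} (\<lambda>_. borel))"
    by (rule measurable_verblunsky_energy) simp
  note measurable_szego_joint[OF order_refl, THEN conjunct1, measurable]
  have [measurable]: "w \<in> borel_measurable (PiM {1..j} (\<lambda>_. borel) \<Otimes>\<^sub>M borel)"
    unfolding w_def by measurable
  have "ref_moment j a = (\<integral>t. w (a, t) * ((1 + cos t) / 2) ^ Suc j \<partial>lborel)" for a
  proof -
    have [measurable]: "(\<lambda>t. w (a, t)) \<in> borel_measurable borel"
      unfolding w_def by simp
    have "bernstein_szego a j = density lborel (\<lambda>t. ennreal (w (a, t)))"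
      unfolding bernstein_szego_def w_def fst_conv snd_conv by (intro arg_cong2[where f=density] refl ext) (simp add: max_def ennreal_neg)
    then show ?thesis
      unfolding ref_moment_def cos_moment_def
      by (simp add: integral_density w_def[symmetric]) (subst integral_density; simp add: w_def)
  qed
  then have eq: "ref_moment j = (\<lambda>a. \<integral>t. w (a, t) * ((1 + cos t) / 2) ^ Suc j \<partial>lborel)"
    by (rule ext)
  show ?thesis unfolding eq
    by (rule lborel.borel_measurable_lebesgue_integral) measurable
qed

lemma szego_cong:
  assumes "\<And>i. i \<in> {1..k} \<Longrightarrow> a i = a' i"
  shows "szego a k z = szego a' k z \<and> szego_rev a k z = szego_rev a' k z"
  using assms by (induction k) auto

lemma verblunsky_energy_cong:
  "(\<And>i. i \<in> {1..k} \<Longrightarrow> a i = a' i) \<Longrightarrow> verblunsky_energy a k = verblunsky_energy a' k"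
  by (simp add: verblunsky_energy_def)

lemma szego_moment_cong:
  assumes "\<And>i. i \<in> {1..k} \<Longrightarrow> a i = a' i"
  shows "szego_moment \<nu> a k s = szego_moment \<nu> a' k s"
  using szego_cong[OF assms] by (simp add: szego_moment_def)

lemma has_verblunsky_cong:
  assumes "\<And>i. i \<in> {1..k} \<Longrightarrow> a i = a' i"
  shows "has_verblunsky \<nu> a k \<longleftrightarrow> has_verblunsky \<nu> a' k"
proof -
  have "szego_moment \<nu> a j 0 = szego_moment \<nu> a' j 0" if "j \<in> {1..k}" for j
    using that assms by (intro szego_moment_cong) auto
  then show ?thesis by (auto simp: has_verblunsky_def)
qed

lemma has_verblunsky_mono: "has_verblunsky \<nu> a N \<Longrightarrow> k \<le> N \<Longrightarrow> has_verblunsky \<nu> a k"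
  by (auto simp: has_verblunsky_def)

lemma ref_moment_cong:
  assumes "\<And>i. i \<in> {1..j} \<Longrightarrow> a i = a' i"
  shows "ref_moment j a = ref_moment j a'"
proof -
  have "bernstein_szego a j = bernstein_szego a' j"
    using szego_cong[OF assms] verblunsky_energy_cong[OF assms] by (simp add: bernstein_szego_def)
  then show ?thesis by (simp add: ref_moment_def)
qed

interpretation canonical: triangular ref_moment slope
  by unfold_locales (rule measurable_ref_moment measurable_slope slope_pos)+

abbreviation canonical :: "nat \<Rightarrow> (nat \<Rightarrow> real) \<Rightarrow> nat \<Rightarrow> real" where
  "canonical \<equiv> tri_inv ref_moment slope"

context circle_measure begin

lemma cos_moment_step:
  assumes V: "has_verblunsky \<nu> a j" "measure \<nu> UNIV = 1"
    and a: "\<And>i. i \<in> {1..j} \<Longrightarrow> \<bar>a i\<bar> < 1"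
  shows "cos_moment \<nu> (Suc j) = ref_moment j a + 2 / 4 ^ Suc j * szego_moment \<nu> a j (- 1)"
proof -
  interpret bs: circle_measure "bernstein_szego a j"
    by (rule circle_measure_bernstein_szego[OF a])
  interpret circle_measure_pair \<nu> "bernstein_szego a j" a j
    using V bernstein_szego_verblunsky[OF a] by unfold_locales auto
  have "szego_moment (bernstein_szego a j) a j (- 1) = 0"
    using szego_moment_bernstein_szego[OF a, where s="- 1"] by simp
  then show ?thesis using cos_moment_Suc_diff by (simp add: ref_moment_def)
qed

text \<open>The coordinates that are computed algebraically from the moments of a law are its Verblunsky coefficients,
  as long as none of them has absolute value 1. They stay in the cube because the norm \<open>E\<^bsub>j+1\<^esub> = (1 - a\<^bsub>j+1\<^esub>\<^sup>2) E\<^sub>j\<close> is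
  nonnegative.\<close>
lemma canonical_of_measure:
  assumes mass: "measure \<nu> UNIV = 1"
    and m: "\<And>i. i < N \<Longrightarrow> m (Suc i) = cos_moment \<nu> (Suc i)"
    and ne: "\<And>i. i \<in> {1..N} \<Longrightarrow> \<bar>canonical N m i\<bar> \<noteq> 1"
    and "j \<le> N"
  shows "has_verblunsky \<nu> (canonical j m) j \<and> (\<forall>i\<in>{1..j}. \<bar>canonical j m i\<bar> < 1)"
  using assms(4)
proof (induction j)
  case 0
  show ?case by (simp add: has_verblunsky_def)
next
  case (Suc j)
  define a where "a = canonical j m"
  define x where "x = (m (Suc j) - ref_moment j a) / slope j a"
  have step: "canonical (Suc j) m = a(Suc j := x)" by (simp add: a_def x_def)
  have V: "has_verblunsky \<nu> a j" and a: "\<And>i. i \<in> {1..j} \<Longrightarrow> \<bar>a i\<bar> < 1"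
    using Suc by (auto simp: a_def)
  have E: "verblunsky_energy a j > 0" by (rule verblunsky_energy_pos[OF a])
  have slope: "slope j a = 2 / 4 ^ Suc j * verblunsky_energy a j"
    using a by (simp add: slope_def)
  have "slope j a * x = 2 / 4 ^ Suc j * szego_moment \<nu> a j (- 1)"
    using cos_moment_step[OF V mass a] m[of j] Suc.prems slope_pos[of j a] by (simp add: x_def)
  then have X: "szego_moment \<nu> a j (- 1) = x * verblunsky_energy a j"
    unfolding slope by (simp add: field_simps)
  have agree: "(a(Suc j := x)) i = a i" if "i \<in> {1..j}" for i using that by auto
  have "has_verblunsky \<nu> (a(Suc j := x)) j"
    using V has_verblunsky_cong[of j "a(Suc j := x)" a, OF agree] by blast
  from verblunsky_next[OF this mass] have V': "has_verblunsky \<nu> (a(Suc j := x)) (Suc j)"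
    using X szego_moment_cong[of j "a(Suc j := x)" a, OF agree] verblunsky_energy_cong[of j "a(Suc j := x)" a, OF agree] by simp
  have "verblunsky_energy (a(Suc j := x)) (Suc j) \<ge> 0"
    unfolding verblunsky_energy_eq_integral[OF V' mass] by (intro integral_nonneg_AE) simp
  then have "0 \<le> (1 - x\<^sup>2) * verblunsky_energy a j"
    using verblunsky_energy_cong[of j "a(Suc j := x)" a, OF agree] by simp
  then have "\<bar>x\<bar> \<le> 1" using E by (simp add: zero_le_mult_iff abs_square_le_1)
  moreover have "\<bar>x\<bar> \<noteq> 1"
  proof -
    have "canonical N m (Suc j) = x"
      using tri_inv_nth[of j N ref_moment slope m] Suc.prems by (simp add: x_def a_def)
    then show ?thesis using ne[of "Suc j"] Suc.prems by auto
  qed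
  ultimately have "\<bar>x\<bar> < 1" by simp
  then have "\<forall>i\<in>{1..Suc j}. \<bar>(a(Suc j := x)) i\<bar> < 1" using a by (auto simp: le_Suc_eq)
  then show ?case unfolding step using V' by blast
qed

end

text \<open>Conversely, every point with coordinates in the open cube is the moment vector of a Bernstein-Szego
  measure.\<close>
lemma cos_moment_canonical:
  assumes a: "\<And>i. i \<in> {1..N} \<Longrightarrow> \<bar>canonical N m i\<bar> < 1" and "j < N"
  shows "cos_moment (bernstein_szego (canonical N m) N) (Suc j) = m (Suc j)"
proof -
  define a where "a = canonical N m"
  note a' = a[folded a_def]
  interpret circle_measure "bernstein_szego a N"
    by (rule circle_measure_bernstein_szego[OF a'])
  note V = bernstein_szego_verblunsky[OF a']
  have Vj: "has_verblunsky (bernstein_szego a N) a j" "has_verblunsky (bernstein_szego a N) a (Suc j)"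
    using has_verblunsky_mono[OF V(1)] \<open>j < N\<close> by auto
  have aj: "\<bar>a i\<bar> < 1" if "i \<in> {1..j}" for i using a' that \<open>j < N\<close> by auto
  have agree: "canonical j m i = a i" if "i \<in> {1..j}" for i
    using fun_cong[OF tri_inv_restrict[of j N ref_moment slope m], of i] that \<open>j < N\<close> by (simp add: a_def)
  have "slope j (canonical j m) = slope j a"
    using verblunsky_energy_cong[of j "canonical j m" a, OF agree] agree by (simp add: slope_def)
  then have "m (Suc j) = ref_moment j a + slope j a * a (Suc j)"
    using tri_inv_nth[OF \<open>j < N\<close>, of ref_moment slope m] slope_pos[of j a] ref_moment_cong[of j "canonical j m" a, OF agree]
    by (simp add: a_def)
  moreover have "cos_moment (bernstein_szego a N) (Suc j) = ref_moment j a + slope j a * a (Suc j)"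
    using cos_moment_step[OF Vj(1) V(2) aj] verblunsky_next[OF Vj(1) V(2)] Vj(2) aj
    by (simp add: slope_def mult_ac)
  ultimately show ?thesis by (simp add: a_def)
qed

lemma circle_measure_of_prob_measure_01:
  assumes "\<mu> \<in> prob_measures_01"
  obtains \<nu> where "circle_measure \<nu>" "measure \<nu> UNIV = 1" "\<And>j. moment \<mu> j = cos_moment \<nu> j"
proof -
  have "prob_space \<mu>" and sets: "sets \<mu> = sets (restrict_space borel {0..1})"
    using assms by (auto simp: prob_measures_01_def)
  interpret prob_space \<mu> by fact
  have sp: "space \<mu> = {0..1}" using sets_eq_imp_space_eq[OF sets] by (simp add: space_restrict_space)
  have "(\<lambda>x. arccos (2 * x - 1)) \<in> borel_measurable (restrict_space borel {0..1})"
    by (intro borel_measurable_continuous_on_restrict continuous_intros) auto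
  then have [measurable]: "(\<lambda>x. arccos (2 * x - 1)) \<in> borel_measurable \<mu>"
    by (simp add: measurable_cong_sets[OF sets refl])
  define \<nu> where "\<nu> = distr \<mu> borel (\<lambda>x. arccos (2 * x - 1))"
  interpret nu: prob_space \<nu> unfolding \<nu>_def by (rule prob_space_distr) measurable
  have "circle_measure \<nu>" by unfold_locales (simp add: \<nu>_def)
  moreover have "measure \<nu> UNIV = 1" using nu.prob_space by (simp add: \<nu>_def)
  moreover have "moment \<mu> j = cos_moment \<nu> j" for j
  proof -
    have "cos_moment \<nu> j = (\<integral>x. ((1 + cos (arccos (2 * x - 1))) / 2) ^ j \<partial>\<mu>)"
      unfolding cos_moment_def \<nu>_def by (rule integral_distr) auto
    also have "\<dots> = moment \<mu> j"
      unfolding moment_def by (intro Bochner_Integration.integral_cong refl) (auto simp: sp cos_arccos)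
    finally show ?thesis ..
  qed
  ultimately show thesis by (rule that)
qed

lemma prob_measure_01_of_circle_measure:
  assumes "circle_measure \<nu>" "measure \<nu> UNIV = 1"
  shows "\<exists>\<mu>\<in>prob_measures_01. \<forall>j. moment \<mu> j = cos_moment \<nu> j"
proof -
  interpret circle_measure \<nu> by fact
  interpret prob_space \<nu>
    using assms(2) sets_eq_imp_space_eq[OF sets_eq] by (intro prob_spaceI) (simp add: emeasure_eq_measure)
  have [measurable]: "(\<lambda>t. (1 + cos t) / 2) \<in> measurable \<nu> (restrict_space borel {0..1})"
  proof (rule measurable_restrict_space2)
    have "0 \<le> (1 + cos t) / 2 \<and> (1 + cos t) / 2 \<le> 1" for t :: real
      using cos_ge_minus_one[of t] cos_le_one[of t] by (auto simp del: cos_ge_minus_one)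
    then show "(\<lambda>t. (1 + cos t) / 2) \<in> space \<nu> \<rightarrow> {0..1}" by auto
  qed measurable
  define \<mu> where "\<mu> = distr \<nu> (restrict_space borel {0..1}) (\<lambda>t. (1 + cos t) / 2)"
  have "prob_space \<mu>" unfolding \<mu>_def by (rule prob_space_distr) measurable
  then have "\<mu> \<in> prob_measures_01" by (simp add: prob_measures_01_def \<mu>_def)
  moreover have "moment \<mu> j = cos_moment \<nu> j" for j
    unfolding moment_def cos_moment_def \<mu>_def
    by (rule integral_distr) (auto intro!: measurable_restrict_space1)
  ultimately show ?thesis by blast
qed

lemma (in product_sigma_finite) AE_PiM_component_notin:
  assumes "finite I" "i \<in> I" "A \<in> null_sets (M i)"
  shows "AE x in PiM I M. x i \<notin> A"
proof -
  have A: "A \<in> sets (M i)" "emeasure (M i) A = 0" using assms(3) by auto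
  have "emeasure (PiM I M) (PiE I (\<lambda>j. if j = i then A else space (M j))) =
      (\<Prod>j\<in>I. emeasure (M j) (if j = i then A else space (M j)))"
    using assms A by (intro emeasure_PiM) auto
  also have "\<dots> = 0"
    using assms A by (intro prod_zero) auto
  finally have "PiE I (\<lambda>j. if j = i then A else space (M j)) \<in> null_sets (PiM I M)"
    using assms A by (intro null_setsI sets_PiM_I_finite) auto
  then show ?thesis
    by (rule AE_I') (auto simp: space_PiM PiE_def Pi_iff)
qed

lemma sets_PiM_lborel: "sets (PiM I (\<lambda>_. lborel)) = sets (PiM I (\<lambda>_. borel :: real measure))"
  by (rule sets_PiM_cong) auto

text \<open>The hyperplanes \<open>x\<^sub>i = \<plusminus>1\<close> are null sets, and the substitution carries Lebesgue measure to a measure that has a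
  density with respect to it.\<close>
lemma AE_canonical_ne_1:
  "AE m in PiM {1..N} (\<lambda>_. lborel). \<forall>i\<in>{1..N}. \<bar>canonical N m i\<bar> \<noteq> 1"
proof -
  interpret product_sigma_finite "\<lambda>_::nat. lborel :: real measure" ..
  note [measurable_cong] = sets_PiM_lborel
  define g :: "(nat \<Rightarrow> real) \<Rightarrow> ennreal" where "g x = (if \<exists>i\<in>{1..N}. \<bar>x i\<bar> = 1 then 1 else 0)" for x
  have g [measurable]: "g \<in> borel_measurable (PiM {1..N} (\<lambda>_. borel))"
    unfolding g_def[abs_def] by measurable
  note [measurable] = canonical.measurable_tri_inv[of N, OF order_refl]
  have "AE x in PiM {1..N} (\<lambda>_. lborel). \<forall>i\<in>{1..N}. x i \<notin> {-1, 1 :: real}"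
    by (intro AE_finite_allI AE_PiM_component_notin finite_imp_null_set_lborel) auto
  then have "AE x in PiM {1..N} (\<lambda>_. lborel). g x * (\<Prod>j<N. ennreal (slope j (restrict x {1..j}))) = 0"
    by eventually_elim (auto simp: g_def abs_if split: if_splits)
  then have "(\<integral>\<^sup>+m. g (canonical N m) \<partial>PiM {1..N} (\<lambda>_. lborel)) = 0"
    unfolding canonical.nn_integral_tri_inv[OF g] by (subst nn_integral_cong_AE) auto
  then have "AE m in PiM {1..N} (\<lambda>_. lborel). g (canonical N m) = 0"
    by (subst (asm) nn_integral_0_iff_AE) measurable
  then show ?thesis by eventually_elim (auto simp: g_def split: if_splits)
qed

lemma AE_moment_space_iff:
  "AE m in PiM {1..N} (\<lambda>_. lborel). m \<in> moment_space N \<longleftrightarrow> (\<forall>i\<in>{1..N}. \<bar>canonical N m i\<bar> < 1)"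
  using AE_canonical_ne_1[of N] AE_space
proof eventually_elim
  case (elim m)
  show ?case
  proof
    assume "m \<in> moment_space N"
    then obtain \<mu> where \<mu>: "\<mu> \<in> prob_measures_01" "m = restrict (moment \<mu>) {1..N}"
      by (auto simp: moment_space_def)
    obtain \<nu> where \<nu>: "circle_measure \<nu>" "measure \<nu> UNIV = 1" "\<And>j. moment \<mu> j = cos_moment \<nu> j"
      using circle_measure_of_prob_measure_01[OF \<mu>(1)] by blast
    show "\<forall>i\<in>{1..N}. \<bar>canonical N m i\<bar> < 1"
      using circle_measure.canonical_of_measure[OF \<nu>(1,2), of N m N] elim(1) \<mu>(2) \<nu>(3) by auto
  next
    assume a: "\<forall>i\<in>{1..N}. \<bar>canonical N m i\<bar> < 1"
    define \<nu> where "\<nu> = bernstein_szego (canonical N m) N"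
    have "circle_measure \<nu>" "measure \<nu> UNIV = 1"
      using a circle_measure_bernstein_szego[of N "canonical N m"] bernstein_szego_verblunsky[of N "canonical N m"]
      by (auto simp: \<nu>_def)
    then obtain \<mu> where \<mu>: "\<mu> \<in> prob_measures_01" "\<And>j. moment \<mu> j = cos_moment \<nu> j"
      using prob_measure_01_of_circle_measure by blast
    have "m i = moment \<mu> i" if "i \<in> {1..N}" for i
      using cos_moment_canonical[of N m "i - 1"] a that by (auto simp: \<mu>(2) \<nu>_def)
    then have "m = restrict (moment \<mu>) {1..N}"
      using elim(2) by (auto simp: space_PiM PiE_def extensional_def fun_eq_iff)
    then show "m \<in> moment_space N" using \<mu>(1) by (auto simp: moment_space_def)
  qed
qed

section \<open>The uniform law in canonical coordinates\<close>

text \<open>If \<open>A\<close> were not measurable, its measure would be 0 by convention and the density of \<open>uniform_measure M A\<close>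
  would take the values 0 and \<open>\<infinity>\<close> only. The integral of such a function is 0 or \<open>\<infinity>\<close>, since doubling a simple
  minorant gives a simple minorant. In this way the measurability of the moment space follows from the
  existence of a uniformly distributed vector.\<close>
lemma uniform_measure_prob_space_imp_sets:
  assumes "prob_space (uniform_measure M A)"
  shows "A \<in> sets M"
proof (rule ccontr)
  assume "A \<notin> sets M"
  then have A: "emeasure M A = 0" by (rule emeasure_notin_sets)
  define h :: "'a \<Rightarrow> ennreal" where "h x = (indicator A x / emeasure M A) * indicator (space M) x" for x
  have h: "h x = 0 \<or> h x = \<top>" for x
    by (auto simp: h_def A indicator_def divide_ennreal_def ennreal_top_mult)
  have "emeasure (uniform_measure M A) (space M) = 1"
    using prob_space.emeasure_space_1[OF assms] by simp
  then have "(\<integral>\<^sup>+x. h x \<partial>M) = 1"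
    unfolding uniform_measure_def density_def h_def
    by (subst (asm) emeasure_measure_of_conv) (auto split: if_splits)
  moreover have "\<exists>g. simple_function M g \<and> g \<le> h \<and> 1 / 2 < (\<integral>\<^sup>+x. g x \<partial>M)"
  proof -
    have "(1 / 2 :: ennreal) < 1"
    proof -
      have "(1 / 2 :: ennreal) = ennreal (1 / 2)"
        using ennreal_divide_numeral[of 1 "num.Bit0 num.One"] by simp
      then show ?thesis by (simp only: ennreal_less_one_iff)
    qed
    also have "1 = (SUP g \<in> {g. simple_function M g \<and> g \<le> h}. integral\<^sup>S M g)"
      using calculation \<open>(\<integral>\<^sup>+x. h x \<partial>M) = 1\<close> by (simp add: nn_integral_def)
    finally show ?thesis
      by (auto simp: less_SUP_iff nn_integral_eq_simple_integral)
  qed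
  then obtain g where g: "simple_function M g" "g \<le> h" "1 / 2 < (\<integral>\<^sup>+x. g x \<partial>M)" by blast
  have "2 * g x \<le> h x" for x
    using h[of x] le_funD[OF g(2), of x] by auto
  then have "(\<integral>\<^sup>+x. 2 * g x \<partial>M) \<le> (\<integral>\<^sup>+x. h x \<partial>M)" by (rule nn_integral_mono)
  moreover have "(\<integral>\<^sup>+x. 2 * g x \<partial>M) = 2 * (\<integral>\<^sup>+x. g x \<partial>M)"
    using g(1) by (intro nn_integral_cmult borel_measurable_simple_function)
  moreover have "(1::ennreal) < 2 * (\<integral>\<^sup>+x. g x \<partial>M)"
  proof -
    have "2 * (1 / 2) < 2 * (\<integral>\<^sup>+x. g x \<partial>M)"
      by (intro ennreal_mult_strict_left_mono g(3)) auto
    moreover have "2 * (1 / 2 :: ennreal) = 1"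
      by (simp add: ennreal_times_divide ennreal_divide_self)
    ultimately show ?thesis by simp
  qed
  ultimately show False by simp
qed

text \<open>The density of a symmetric beta law with both parameters \<open>N - i + 1\<close>, carried over to \<open>(-1, 1)\<close> and not
  normalised.\<close>
definition beta_weight :: "nat \<Rightarrow> nat \<Rightarrow> real \<Rightarrow> real" where
  "beta_weight N i x = (if \<bar>x\<bar> < 1 then (1 - x\<^sup>2) ^ (N - i) else 0)"

lemma beta_weight_nonneg: "beta_weight N i x \<ge> 0"
  by (simp add: beta_weight_def abs_square_le_1 less_imp_le)

lemma measurable_beta_weight [measurable]: "beta_weight N i \<in> borel_measurable borel"
  unfolding beta_weight_def[abs_def] by measurable

lemma prod_verblunsky_energy:
  "(\<Prod>j<N. verblunsky_energy x j) = (\<Prod>i\<in>{1..N}. (1 - (x i)\<^sup>2) ^ (N - i))"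
proof (induction N)
  case (Suc N)
  have "(\<Prod>i\<in>{1..Suc N}. (1 - (x i)\<^sup>2) ^ (Suc N - i)) =
      (\<Prod>i\<in>{1..N}. (1 - (x i)\<^sup>2) ^ (N - i) * (1 - (x i)\<^sup>2))"
    by (simp add: Suc_diff_le mult.commute)
  then show ?case using Suc by (simp add: prod.distrib verblunsky_energy_def)
qed simp

text \<open>The Jacobian of the passage to canonical coordinates factorises over the coordinates. The indicator of the
  cube is absorbed in the weights.\<close>
lemma prod_slope_eq:
  "(if \<forall>i\<in>{1..N}. \<bar>x i\<bar> < 1 then 1 else 0) * (\<Prod>j<N. ennreal (slope j (restrict x {1..j}))) =
     ennreal (\<Prod>j<N. 2 / 4 ^ Suc j) * (\<Prod>i\<in>{1..N}. ennreal (beta_weight N i (x i)))"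
proof (cases "\<forall>i\<in>{1..N}. \<bar>x i\<bar> < 1")
  case True
  have "slope j (restrict x {1..j}) = 2 / 4 ^ Suc j * verblunsky_energy x j" if "j < N" for j
  proof -
    have "verblunsky_energy (restrict x {1..j}) j = verblunsky_energy x j"
      by (rule verblunsky_energy_cong) auto
    then show ?thesis using True that by (auto simp: slope_def)
  qed
  then have "(\<Prod>j<N. ennreal (slope j (restrict x {1..j}))) = (\<Prod>j<N. ennreal (2 / 4 ^ Suc j * verblunsky_energy x j))"
    by simp
  also have "\<dots> = ennreal (\<Prod>j<N. 2 / 4 ^ Suc j * verblunsky_energy x j)"
    using True by (intro prod_ennreal mult_nonneg_nonneg less_imp_le[OF verblunsky_energy_pos]) auto
  also have "(\<Prod>j<N. 2 / 4 ^ Suc j * verblunsky_energy x j) =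
      (\<Prod>j<N. 2 / 4 ^ Suc j) * (\<Prod>i\<in>{1..N}. beta_weight N i (x i))"
    unfolding prod.distrib prod_verblunsky_energy using True by (simp add: beta_weight_def)
  also have "ennreal \<dots> = ennreal (\<Prod>j<N. 2 / 4 ^ Suc j) * (\<Prod>i\<in>{1..N}. ennreal (beta_weight N i (x i)))"
    by (simp add: ennreal_mult' prod_nonneg prod_ennreal beta_weight_nonneg)
  finally show ?thesis unfolding if_P[OF True] mult_1 .
next
  case False
  then obtain i where "i \<in> {1..N}" "beta_weight N i (x i) = 0" by (auto simp: beta_weight_def)
  then have "(\<Prod>i\<in>{1..N}. ennreal (beta_weight N i (x i))) = 0"
    by (intro prod_zero bexI[of _ i]) auto
  then show ?thesis unfolding if_not_P[OF False] by (simp only: mult_zero_left mult_zero_right)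
qed

lemma tri_inv_scale:
  "tri_inv (\<lambda>_ _. 0) (\<lambda>_ _. 1 / s) N m = (\<lambda>i\<in>{1..N}. s * m i)"
  by (induction N) (auto simp: fun_eq_iff restrict_def le_Suc_eq)

context
  fixes N K :: nat and s :: real
  assumes KN: "K \<le> N" and s: "s > 0"
    and prob: "prob_space (uniform_moment_space N)"
begin

interpretation product_sigma_finite "\<lambda>_::nat. lborel :: real measure" ..

private lemma moment_space_sets: "moment_space N \<in> sets (PiM {1..N} (\<lambda>_. lborel))"
  using uniform_measure_prob_space_imp_sets prob by (auto simp: uniform_moment_space_def)

private lemma nn_integral_canonical:
  "\<exists>\<kappa>. \<forall>g \<in> borel_measurable (PiM {1..N} (\<lambda>_. borel)).
     (\<integral>\<^sup>+m. g (canonical N m) \<partial>uniform_moment_space N) =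
     \<kappa> * (\<integral>\<^sup>+x. g x * (\<Prod>i\<in>{1..N}. ennreal (beta_weight N i (x i))) \<partial>PiM {1..N} (\<lambda>_. lborel))"
proof (intro exI ballI)
  let ?L = "PiM {1..N} (\<lambda>_::nat. lborel :: real measure)"
  note [measurable_cong] = sets_PiM_lborel
  note [measurable] = canonical.measurable_tri_inv[of N, OF order_refl] moment_space_sets
  fix g :: "(nat \<Rightarrow> real) \<Rightarrow> ennreal" assume g [measurable]: "g \<in> borel_measurable (PiM {1..N} (\<lambda>_. borel))"
  define q :: "(nat \<Rightarrow> real) \<Rightarrow> ennreal" where "q x = (if \<forall>i\<in>{1..N}. \<bar>x i\<bar> < 1 then 1 else 0)" for x
  have [measurable]: "q \<in> borel_measurable (PiM {1..N} (\<lambda>_. borel))"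
    unfolding q_def[abs_def] by measurable
  have "(\<integral>\<^sup>+m. g (canonical N m) \<partial>uniform_moment_space N) =
      (\<integral>\<^sup>+m. g (canonical N m) * indicator (moment_space N) m \<partial>?L) / emeasure ?L (moment_space N)"
    unfolding uniform_moment_space_def by (rule nn_integral_uniform_measure) measurable
  also have "(\<integral>\<^sup>+m. g (canonical N m) * indicator (moment_space N) m \<partial>?L) =
      (\<integral>\<^sup>+m. g (canonical N m) * q (canonical N m) \<partial>?L)"
    using AE_moment_space_iff[of N] by (intro nn_integral_cong_AE) (auto simp: q_def elim!: eventually_mono)
  also have "\<dots> = (\<integral>\<^sup>+x. g x * q x * (\<Prod>j<N. ennreal (slope j (restrict x {1..j}))) \<partial>?L)"
    by (rule canonical.nn_integral_tri_inv) measurable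
  also have "\<dots> = (\<integral>\<^sup>+x. ennreal (\<Prod>j<N. 2 / 4 ^ Suc j) * (g x * (\<Prod>i\<in>{1..N}. ennreal (beta_weight N i (x i)))) \<partial>?L)"
    unfolding q_def using prod_slope_eq[of N] by (simp only: mult.assoc mult.left_commute)
  also have "\<dots> = ennreal (\<Prod>j<N. 2 / 4 ^ Suc j) * (\<integral>\<^sup>+x. g x * (\<Prod>i\<in>{1..N}. ennreal (beta_weight N i (x i))) \<partial>?L)"
    by (rule nn_integral_cmult) measurable
  finally show "(\<integral>\<^sup>+m. g (canonical N m) \<partial>uniform_moment_space N) =
     (ennreal (\<Prod>j<N. 2 / 4 ^ Suc j) / emeasure ?L (moment_space N)) *
       (\<integral>\<^sup>+x. g x * (\<Prod>i\<in>{1..N}. ennreal (beta_weight N i (x i))) \<partial>?L)"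
    by (simp add: divide_ennreal_def mult_ac)
qed

private lemma nn_integral_marginal:
  assumes [measurable]: "g \<in> borel_measurable (PiM {1..K} (\<lambda>_. borel))"
  shows "(\<integral>\<^sup>+x. g (restrict x {1..K}) * (\<Prod>i\<in>{1..N}. ennreal (beta_weight N i (x i))) \<partial>PiM {1..N} (\<lambda>_. lborel)) =
    (\<Prod>i\<in>{Suc K..N}. \<integral>\<^sup>+x. ennreal (beta_weight N i x) \<partial>lborel) *
    (\<integral>\<^sup>+x. g x * (\<Prod>i\<in>{1..K}. ennreal (beta_weight N i (x i))) \<partial>PiM {1..K} (\<lambda>_. lborel))"
proof -
  note [measurable_cong] = sets_PiM_lborel
  let ?J = "{Suc K..N}"
  let ?w = "\<lambda>i x. ennreal (beta_weight N i x)"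
  have un: "{1..N} = {1..K} \<union> ?J" and disj: "{1..K} \<inter> ?J = {}" using KN by auto
  have [measurable]: "(\<lambda>x. restrict x {1..K}) \<in> measurable (PiM ({1..K} \<union> ?J) (\<lambda>_. borel)) (PiM {1..K} (\<lambda>_. borel :: real measure))"
    by (rule measurable_restrict_subset) auto
  have "(\<integral>\<^sup>+x. g (restrict x {1..K}) * (\<Prod>i\<in>{1..N}. ?w i (x i)) \<partial>PiM {1..N} (\<lambda>_. lborel)) =
     (\<integral>\<^sup>+x. \<integral>\<^sup>+y. g (restrict (merge {1..K} ?J (x, y)) {1..K}) *
        (\<Prod>i\<in>{1..K} \<union> ?J. ?w i (merge {1..K} ?J (x, y) i)) \<partial>PiM ?J (\<lambda>_. lborel) \<partial>PiM {1..K} (\<lambda>_. lborel))"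
    unfolding un by (rule product_nn_integral_fold[OF disj]) (auto simp del: One_nat_def)
  also have "\<dots> = (\<integral>\<^sup>+x. (\<Prod>i\<in>?J. \<integral>\<^sup>+x. ?w i x \<partial>lborel) * (g x * (\<Prod>i\<in>{1..K}. ?w i (x i))) \<partial>PiM {1..K} (\<lambda>_. lborel))"
  proof (rule nn_integral_cong)
    fix x assume "x \<in> space (PiM {1..K} (\<lambda>_::nat. lborel :: real measure))"
    then have x: "restrict x {1..K} = x" by (auto simp: space_PiM PiE_def extensional_restrict)
    have "restrict (merge {1..K} ?J (x, y)) {1..K} = x" for y
      using x by (auto simp: fun_eq_iff restrict_def merge_def split: if_splits)
    moreover have "(\<Prod>i\<in>{1..K} \<union> ?J. ?w i (merge {1..K} ?J (x, y) i)) =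
        (\<Prod>i\<in>{1..K}. ?w i (x i)) * (\<Prod>i\<in>?J. ?w i (y i))" for y
      by (subst prod.union_disjoint) (auto intro!: arg_cong2[where f="(*)"] prod.cong simp: merge_def)
    ultimately have "(\<integral>\<^sup>+y. g (restrict (merge {1..K} ?J (x, y)) {1..K}) *
        (\<Prod>i\<in>{1..K} \<union> ?J. ?w i (merge {1..K} ?J (x, y) i)) \<partial>PiM ?J (\<lambda>_. lborel)) =
        (\<integral>\<^sup>+y. (g x * (\<Prod>i\<in>{1..K}. ?w i (x i))) * (\<Prod>i\<in>?J. ?w i (y i)) \<partial>PiM ?J (\<lambda>_. lborel))"
      by (simp only: mult.assoc)
    also have "\<dots> = (g x * (\<Prod>i\<in>{1..K}. ?w i (x i))) * (\<Prod>i\<in>?J. \<integral>\<^sup>+x. ?w i x \<partial>lborel)"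
      by (subst nn_integral_cmult) (measurable, subst product_nn_integral_prod, auto)
    finally show "(\<integral>\<^sup>+y. g (restrict (merge {1..K} ?J (x, y)) {1..K}) *
        (\<Prod>i\<in>{1..K} \<union> ?J. ?w i (merge {1..K} ?J (x, y) i)) \<partial>PiM ?J (\<lambda>_. lborel)) =
        (\<Prod>i\<in>?J. \<integral>\<^sup>+x. ?w i x \<partial>lborel) * (g x * (\<Prod>i\<in>{1..K}. ?w i (x i)))"
      by (simp only: mult.commute)
  qed
  also have "\<dots> = (\<Prod>i\<in>?J. \<integral>\<^sup>+x. ?w i x \<partial>lborel) * (\<integral>\<^sup>+x. g x * (\<Prod>i\<in>{1..K}. ?w i (x i)) \<partial>PiM {1..K} (\<lambda>_. lborel))"
    by (rule nn_integral_cmult) measurable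
  finally show ?thesis .
qed

private lemma nn_integral_scale:
  assumes [measurable]: "g \<in> borel_measurable (PiM {1..K} (\<lambda>_. borel))"
  shows "(\<integral>\<^sup>+x. g (\<lambda>i\<in>{1..K}. s * x i) \<partial>PiM {1..K} (\<lambda>_. lborel)) =
    ennreal (1 / s) ^ K * (\<integral>\<^sup>+x. g x \<partial>PiM {1..K} (\<lambda>_. lborel))"
proof -
  note [measurable_cong] = sets_PiM_lborel
  interpret scale: triangular "\<lambda>_ _. 0" "\<lambda>_ _. 1 / s"
    using s by unfold_locales auto
  show ?thesis
    using scale.nn_integral_tri_inv[OF assms]
    by (simp add: tri_inv_scale nn_integral_multc mult.commute)
qed

text \<open>Independence of the canonical coordinates under the uniform law, for the first \<open>K\<close> of them and after
  scaling. The constant is left unspecified, as it is determined by the total mass.\<close>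
lemma distr_scaled_canonical:
  "\<exists>\<kappa>. distr (uniform_moment_space N) (PiM {1..K} (\<lambda>_. borel)) (\<lambda>m. \<lambda>i\<in>{1..K}. s * canonical N m i) =
     density (PiM {1..K} (\<lambda>_. lborel)) (\<lambda>z. \<kappa> * ennreal (\<Prod>i\<in>{1..K}. beta_weight N i (z i / s)))"
proof -
  note [measurable_cong] = sets_PiM_lborel
  have sets_U: "sets (uniform_moment_space N) = sets (PiM {1..N} (\<lambda>_. borel))"
    by (simp add: uniform_moment_space_def sets_PiM_lborel)
  note [measurable] = canonical.measurable_tri_inv[of N, OF order_refl]
  have comp: "(\<lambda>x. x i) \<in> borel_measurable (PiM {1..N} (\<lambda>_. borel :: real measure))" if "i \<in> {1..K}" for i
    using that KN by (intro measurable_component_singleton) auto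
  have sc [measurable]: "(\<lambda>x. \<lambda>i\<in>{1..K}. s * x i) \<in> measurable (PiM {1..K} (\<lambda>_. borel)) (PiM {1..K} (\<lambda>_. borel))"
    by measurable
  have sc' [measurable]: "(\<lambda>x. \<lambda>i\<in>{1..K}. s * x i) \<in> measurable (PiM {1..N} (\<lambda>_. borel)) (PiM {1..K} (\<lambda>_. borel))"
    by (intro measurable_restrict borel_measurable_times comp) auto
  have T [measurable]: "(\<lambda>m. \<lambda>i\<in>{1..K}. s * canonical N m i) \<in> measurable (uniform_moment_space N) (PiM {1..K} (\<lambda>_. borel))"
    unfolding measurable_cong_sets[OF sets_U refl]
    using measurable_compose[OF canonical.measurable_tri_inv[of N, OF order_refl] sc'] by simp
  obtain \<kappa> where \<kappa>: "\<And>g. g \<in> borel_measurable (PiM {1..N} (\<lambda>_. borel)) \<Longrightarrow>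
     (\<integral>\<^sup>+m. g (canonical N m) \<partial>uniform_moment_space N) =
     \<kappa> * (\<integral>\<^sup>+x. g x * (\<Prod>i\<in>{1..N}. ennreal (beta_weight N i (x i))) \<partial>PiM {1..N} (\<lambda>_. lborel))"
    using nn_integral_canonical by blast
  define R where "R = (\<Prod>i\<in>{Suc K..N}. \<integral>\<^sup>+x. ennreal (beta_weight N i x) \<partial>lborel)"
  define \<kappa>' where "\<kappa>' = \<kappa> * (R * ennreal (1 / s) ^ K)"
  have "distr (uniform_moment_space N) (PiM {1..K} (\<lambda>_. borel)) (\<lambda>m. \<lambda>i\<in>{1..K}. s * canonical N m i) =
     density (PiM {1..K} (\<lambda>_. lborel)) (\<lambda>z. \<kappa>' * ennreal (\<Prod>i\<in>{1..K}. beta_weight N i (z i / s)))"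
    (is "?D = ?E")
  proof (rule measure_eqI)
    show "sets ?D = sets ?E" by (simp add: sets_PiM_lborel)
    fix A assume "A \<in> sets ?D"
    then have A [measurable]: "A \<in> sets (PiM {1..K} (\<lambda>_. borel))" by simp
    let ?S = "\<lambda>x :: nat \<Rightarrow> real. \<lambda>i\<in>{1..K}. s * x i"
    have "emeasure ?D A = (\<integral>\<^sup>+z. indicator A z \<partial>?D)" by simp
    also have "\<dots> = (\<integral>\<^sup>+m. indicator A (?S (canonical N m)) \<partial>uniform_moment_space N)"
      by (rule nn_integral_distr[OF T]) measurable
    also have "\<dots> = \<kappa> * (\<integral>\<^sup>+x. indicator A (?S x) * (\<Prod>i\<in>{1..N}. ennreal (beta_weight N i (x i))) \<partial>PiM {1..N} (\<lambda>_. lborel))"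
      by (rule \<kappa>) measurable
    also have "\<dots> = \<kappa> * (\<integral>\<^sup>+x. indicator A (?S (restrict x {1..K})) * (\<Prod>i\<in>{1..N}. ennreal (beta_weight N i (x i))) \<partial>PiM {1..N} (\<lambda>_. lborel))"
    proof -
      have "?S (restrict x {1..K}) = ?S x" for x by (auto simp: fun_eq_iff)
      then show ?thesis by simp
    qed
    also have "\<dots> = \<kappa> * (R * (\<integral>\<^sup>+x. indicator A (?S x) * (\<Prod>i\<in>{1..K}. ennreal (beta_weight N i (x i))) \<partial>PiM {1..K} (\<lambda>_. lborel)))"
      by (subst nn_integral_marginal[where g="\<lambda>x. indicator A (?S x)"]) (measurable, simp add: R_def)
    also have "(\<integral>\<^sup>+x. indicator A (?S x) * (\<Prod>i\<in>{1..K}. ennreal (beta_weight N i (x i))) \<partial>PiM {1..K} (\<lambda>_. lborel)) =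
        (\<integral>\<^sup>+x. indicator A (?S x) * (\<Prod>i\<in>{1..K}. ennreal (beta_weight N i (?S x i / s))) \<partial>PiM {1..K} (\<lambda>_. lborel))"
      using s by (intro nn_integral_cong arg_cong2[where f="(*)"] prod.cong refl) simp
    also have "\<dots> = ennreal (1 / s) ^ K * (\<integral>\<^sup>+z. indicator A z * (\<Prod>i\<in>{1..K}. ennreal (beta_weight N i (z i / s))) \<partial>PiM {1..K} (\<lambda>_. lborel))"
      by (rule nn_integral_scale) measurable
    also have "\<kappa> * (R * \<dots>) = \<kappa>' * (\<integral>\<^sup>+z. indicator A z * (\<Prod>i\<in>{1..K}. ennreal (beta_weight N i (z i / s))) \<partial>PiM {1..K} (\<lambda>_. lborel))"
      by (simp add: \<kappa>'_def mult.assoc)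
    also have "\<dots> = (\<integral>\<^sup>+z. \<kappa>' * (indicator A z * (\<Prod>i\<in>{1..K}. ennreal (beta_weight N i (z i / s)))) \<partial>PiM {1..K} (\<lambda>_. lborel))"
      by (rule nn_integral_cmult[symmetric]) measurable
    also have "\<dots> = emeasure ?E A"
      by (subst emeasure_density) (auto simp: prod_ennreal beta_weight_nonneg mult_ac sets_PiM_lborel intro!: nn_integral_cong)
    finally show "emeasure ?D A = emeasure ?E A" .
  qed
  then show ?thesis by blast
qed

end

section \<open>Log-determinants in canonical coordinates\<close>

lemma log_hankel_det_cos_moment:
  assumes "circle_measure \<nu>" and V: "has_verblunsky \<nu> a (2 * l)" "measure \<nu> UNIV = 1"
    and a: "\<And>i. i \<in> {1..2*l} \<Longrightarrow> \<bar>a i\<bar> < 1"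
    and m: "\<And>j. j \<le> 2 * l \<Longrightarrow> m j = cos_moment \<nu> j"
  shows "log_hankel_det l m =
    (\<Sum>k\<in>{1..l}. ln (2 / 16 ^ k) + ln (verblunsky_energy a (2 * k - 1)) + ln (1 + a (2 * k)))"
proof -
  have pos: "verblunsky_energy a (2 * k - 1) > 0 \<and> 1 + a (2 * k) > 0" if "k \<in> {1..l}" for k
  proof
    show "verblunsky_energy a (2 * k - 1) > 0" using that a by (intro verblunsky_energy_pos) auto
    show "1 + a (2 * k) > 0" using that a[of "2 * k"] by auto
  qed
  have "Matrix.mat (l + 1) (l + 1) (\<lambda>(i, j). m (i + j)) = Matrix.mat (l + 1) (l + 1) (\<lambda>(i, j). cos_moment \<nu> (i + j))"
    by (rule eq_matI) (auto simp: m)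
  then have "log_hankel_det l m = ln (\<Prod>k\<in>{1..l}. 2 / 16 ^ k * verblunsky_energy a (2 * k - 1) * (1 + a (2 * k)))"
    unfolding log_hankel_det_def using circle_measure.det_hankel_cos_moment[OF assms(1) V a] by simp
  also have "\<dots> = (\<Sum>k\<in>{1..l}. ln (2 / 16 ^ k * verblunsky_energy a (2 * k - 1) * (1 + a (2 * k))))"
  proof (rule ln_prod)
    fix k assume "k \<in> {1..l}"
    from pos[OF this] show "2 / 16 ^ k * verblunsky_energy a (2 * k - 1) * (1 + a (2 * k)) \<noteq> 0" by simp
  qed simp
  also have "\<dots> = (\<Sum>k\<in>{1..l}. ln (2 / 16 ^ k) + ln (verblunsky_energy a (2 * k - 1)) + ln (1 + a (2 * k)))"
  proof (intro sum.cong refl)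
    fix k assume "k \<in> {1..l}"
    note p = pos[OF this]
    have "2 / 16 ^ k > (0::real)" by simp
    with p show "ln (2 / 16 ^ k * verblunsky_energy a (2 * k - 1) * (1 + a (2 * k))) =
        ln (2 / 16 ^ k) + ln (verblunsky_energy a (2 * k - 1)) + ln (1 + a (2 * k))"
      by (simp only: ln_mult_pos mult_pos_pos)
  qed
  finally show ?thesis .
qed

lemma central_binomial_Suc:
  "real (2 * Suc j choose Suc j) * real (Suc j) = real (2 * j choose j) * (2 * (2 * real j + 1))"
proof -
  let ?X = "real (2 * Suc j choose Suc j)" and ?Y = "real (2 * j choose j)" and ?f = "fact j :: real"
  have "fact (Suc j) * fact (2 * Suc j - Suc j) * (2 * Suc j choose Suc j) = (fact (2 * Suc j) :: nat)"
    by (rule binomial_fact_lemma) simp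
  moreover have "2 * Suc j - Suc j = Suc j" by simp
  ultimately have "fact (Suc j) * fact (Suc j) * ?X = fact (2 * Suc j)"
    by (metis of_nat_fact of_nat_mult)
  moreover have "(fact (Suc j) :: real) = (real j + 1) * ?f" by (simp add: algebra_simps)
  moreover have "(fact (2 * Suc j) :: real) = (2 * real j + 2) * ((2 * real j + 1) * fact (2 * j))"
    by (simp add: algebra_simps)
  ultimately have X: "(real j + 1) * ?f * ((real j + 1) * ?f) * ?X =
      (2 * real j + 2) * ((2 * real j + 1) * fact (2 * j))"
    by (simp only:)
  have "fact j * fact (2 * j - j) * (2 * j choose j) = (fact (2 * j) :: nat)"
    by (rule binomial_fact_lemma) simp
  moreover have "2 * j - j = j" by simp
  ultimately have Y: "fact (2 * j) = ?f * ?f * ?Y"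
    by (metis of_nat_fact of_nat_mult)
  have "((real j + 1) * ?f * ?f) * (?X * (real j + 1)) = (real j + 1) * ?f * ((real j + 1) * ?f) * ?X"
    by (simp only: mult_ac)
  also have "\<dots> = ((real j + 1) * ?f * ?f) * (?Y * (2 * (2 * real j + 1)))"
    unfolding X Y by (simp only: algebra_simps)
  finally have "?X * (real j + 1) = ?Y * (2 * (2 * real j + 1))"
    by (subst (asm) mult_left_cancel) (auto simp: add_eq_0_iff)
  then show ?thesis by (simp only: of_nat_Suc add.commute)
qed

text \<open>Both sides satisfy the same recursion in \<open>j\<close>. Divided by \<open>\<pi>\<close>, they are the moments of the arcsine law.\<close>
lemma Beta_central_binomial:
  "Beta (real j + 1 / 2) (1 / 2) = pi * real (2 * j choose j) / 4 ^ j"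
proof (induction j)
  case 0
  show ?case by (simp add: Beta_def Gamma_one_half_real flip: power2_eq_square)
next
  case (Suc j)
  have nn: "real j + 1 / 2 \<notin> \<int>\<^sub>\<le>\<^sub>0" by (auto elim!: nonpos_Ints_cases')
  have "(real j + 1) * Beta (real (Suc j) + 1 / 2) (1 / 2) = (real j + 1 / 2) * Beta (real j + 1 / 2) (1 / 2)"
    using Beta_plus1_left[OF nn, of "1 / 2"] by (simp add: algebra_simps)
  also have "\<dots> = (real j + 1 / 2) * (pi * real (2 * j choose j) / 4 ^ j)" by (simp only: Suc.IH)
  also have "\<dots> = pi * (real (2 * j choose j) * (2 * (2 * real j + 1))) / (4 * 4 ^ j)"
    by (simp add: field_simps)
  also have "\<dots> = (real j + 1) * (pi * real (2 * Suc j choose Suc j) / 4 ^ Suc j)"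
    unfolding central_binomial_Suc[symmetric] by (simp del: binomial_Suc_Suc mult_Suc_right add: field_simps)
  finally show ?case by (simp only: mult_cancel_left) (auto simp: add_eq_0_iff)
qed

lemma moment_arcsine_measure: "moment arcsine_measure j = real (2 * j choose j) / 4 ^ j"
proof -
  have "moment arcsine_measure j =
      (\<integral>x. (1 / (pi * sqrt (x * (1 - x)))) *\<^sub>R x ^ j \<partial>restrict_space lborel {0..1})"
    unfolding moment_def arcsine_measure_def
    by (rule integral_density) (auto intro!: AE_I2 measurable_restrict_space1 simp: space_restrict_space)
  also have "\<dots> = set_lebesgue_integral lborel {0..1} (\<lambda>x. (1 / (pi * sqrt (x * (1 - x)))) *\<^sub>R x ^ j)"
    by (subst integral_restrict_space) (auto simp: set_lebesgue_integral_def)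
  also have "\<dots> = set_lebesgue_integral lborel {0..1} (\<lambda>x. 1 / pi * (x powr (real j + 1 / 2 - 1) * (1 - x) powr (1 / 2 - 1)))"
  proof (rule set_lebesgue_integral_cong)
    show "\<forall>x. x \<in> {0..1} \<longrightarrow> (1 / (pi * sqrt (x * (1 - x)))) *\<^sub>R x ^ j =
        1 / pi * (x powr (real j + 1 / 2 - 1) * (1 - x) powr (1 / 2 - 1))"
    proof (intro allI impI)
      fix x :: real assume x: "x \<in> {0..1}"
      (* At the endpoints both sides vanish, because 1 / 0 = 0 and 0 powr s = 0. *)
      show "(1 / (pi * sqrt (x * (1 - x)))) *\<^sub>R x ^ j =
        1 / pi * (x powr (real j + 1 / 2 - 1) * (1 - x) powr (1 / 2 - 1))"
      proof (cases "x = 0 \<or> x = 1")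
        case False
        then have x': "0 < x" "0 < 1 - x" using x by auto
        have "x powr (real j + 1 / 2 - 1) = x ^ j / sqrt x"
        proof -
          have "real j + 1 / 2 - 1 = real j - 1 / 2" by simp
          then show ?thesis
            using x' by (simp only: powr_diff powr_realpow powr_half_sqrt less_imp_le)
        qed
        moreover have "(1 - x) powr (1 / 2 - 1) = 1 / sqrt (1 - x)"
        proof -
          have "1 / 2 - 1 = - (1 / 2 :: real)" by simp
          then show ?thesis
            using x' by (simp only: powr_minus_divide powr_half_sqrt less_imp_le)
        qed
        ultimately show ?thesis by (simp only:) (simp add: real_sqrt_mult)
      qed auto
    qed
  qed simp
  also have "\<dots> = 1 / pi * set_lebesgue_integral lborel {0..1} (\<lambda>x. x powr (real j + 1 / 2 - 1) * (1 - x) powr (1 / 2 - 1))"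
    by (rule set_integral_mult_right)
  also have "set_lebesgue_integral lborel {0..1} (\<lambda>x. x powr (real j + 1 / 2 - 1) * (1 - x) powr (1 / 2 - 1)) =
      integral {0..1} (\<lambda>x. x powr (real j + 1 / 2 - 1) * (1 - x) powr (1 / 2 - 1))"
    by (intro set_borel_integral_eq_integral integrable_Beta) auto
  also have "\<dots> = Beta (real j + 1 / 2) (1 / 2)"
    by (intro integral_unique has_integral_Beta_real) auto
  finally show ?thesis by (simp only: Beta_central_binomial) simp
qed

text \<open>For \<open>a = 0\<close> the polynomials are \<open>\<Phi>\<^sub>k = z\<^sup>k\<close>.\<close>
lemma szego_moment_zero:
  assumes "circle_measure \<nu>"
  shows "szego_moment \<nu> (\<lambda>_. 0) k s = szego_moment \<nu> (\<lambda>_. 0) 0 (s - int k)"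
  using circle_measure.szego_moment_Suc[OF assms, of "\<lambda>_. 0"]
  by (induction k arbitrary: s) (simp_all add: algebra_simps)

text \<open>The moments of the arcsine law are those of the uniform law of the angle, whose Verblunsky coefficients all
  vanish.\<close>
lemma D_arcsine_eq: "D_arcsine l = (\<Sum>k\<in>{1..l}. ln (2 / 16 ^ k))"
proof -
  define \<nu> where "\<nu> = bernstein_szego (\<lambda>_. 0) 0"
  have cm: "circle_measure \<nu>" unfolding \<nu>_def by (rule circle_measure_bernstein_szego) simp
  then interpret circle_measure \<nu> .
  have neg: "szego_moment \<nu> (\<lambda>_. 0) 0 s = (if s = 0 then 1 else 0)" if "s \<le> 0" for s
    using szego_moment_bernstein_szego[of 0 "\<lambda>_. 0" s] that by (simp add: \<nu>_def)
  have trig: "(\<integral>t. cos (of_int s * t) \<partial>\<nu>) = (if s = 0 then 1 else 0)" for s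
    using neg[of s] neg[of "- s"] by (cases "s \<le> 0") (simp_all add: szego_moment_0)
  have V: "has_verblunsky \<nu> (\<lambda>_. 0) N" for N
    unfolding has_verblunsky_def by (subst szego_moment_zero[OF cm]) (auto simp: neg)
  have mass: "measure \<nu> UNIV = 1"
    unfolding \<nu>_def by (rule bernstein_szego_verblunsky) simp
  have "moment arcsine_measure j = cos_moment \<nu> j" for j
  proof -
    have "cos_moment \<nu> j = (\<Sum>r\<le>2*j. if r = j then real (2 * j choose j) else 0) / 4 ^ j"
      unfolding cos_moment_trig trig by (intro arg_cong2[where f="(/)"] sum.cong refl) auto
    then show ?thesis by (simp add: moment_arcsine_measure)
  qed
  then show ?thesis
    unfolding D_arcsine_def
    by (subst log_hankel_det_cos_moment[OF cm V mass]) (auto simp: verblunsky_energy_def)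
qed

lemma D_moments_canonical:
  assumes a: "\<And>i. i \<in> {1..2*n} \<Longrightarrow> \<bar>canonical (2 * n) m i\<bar> < 1" and "l \<le> n"
  shows "D_moments l m - D_arcsine l =
    (\<Sum>k\<in>{1..l}. ln (verblunsky_energy (canonical (2 * n) m) (2 * k - 1)) + ln (1 + canonical (2 * n) m (2 * k)))"
proof -
  define \<nu> where "\<nu> = bernstein_szego (canonical (2 * n) m) (2 * n)"
  have cm: "circle_measure \<nu>" unfolding \<nu>_def by (rule circle_measure_bernstein_szego[OF a])
  then interpret circle_measure \<nu> .
  have V: "has_verblunsky \<nu> (canonical (2 * n) m) (2 * l)" and mass: "measure \<nu> UNIV = 1"
    using bernstein_szego_verblunsky[OF a] has_verblunsky_mono[of _ _ "2 * n" "2 * l"] \<open>l \<le> n\<close>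
    by (auto simp: \<nu>_def)
  (* The moment of order 0 is the total mass, in agreement with the convention on the entry at 0. *)
  have "(m(0 := 1)) j = cos_moment \<nu> j" if "j \<le> 2 * l" for j
  proof (cases j)
    case 0
    then show ?thesis
      using mass sets_eq_imp_space_eq[OF sets_eq] by (simp add: cos_moment_def)
  next
    case (Suc i)
    then show ?thesis
      using cos_moment_canonical[OF a, of i] that \<open>l \<le> n\<close> by (simp add: \<nu>_def)
  qed
  then show ?thesis
    unfolding D_moments_def D_arcsine_eq using a \<open>l \<le> n\<close>
    by (subst log_hankel_det_cos_moment[OF cm V mass]) (auto simp: sum.distrib)
qed

section \<open>Gaussian limits\<close>

text \<open>The matrix \<open>min i j\<close> is \<open>L * L\<^sup>T\<close>, where \<open>L\<close> is the summation matrix with entries 1 on and below the diagonal.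
  Thus the quadratic form of its inverse, evaluated at the partial sums of \<open>u\<close>, is the square norm of \<open>u\<close>.\<close>
lemma mat_inverse_min:
  fixes u :: "nat \<Rightarrow> real" and k :: nat
  defines "S \<equiv> Matrix.mat k k (\<lambda>(i, j). real (min (i + 1) (j + 1)))"
    and "y \<equiv> Matrix.vec k (\<lambda>i. \<Sum>j\<le>i. u j)"
  shows "scalar_prod y (mult_mat_vec (the (mat_inverse S)) y) = (\<Sum>i<k. (u i)\<^sup>2)"
    and "Determinant.det S = 1"
proof -
  define L where "L = Matrix.mat k k (\<lambda>(i, j). if j \<le> i then 1 else 0 :: real)"
  have L: "L \<in> carrier_mat k k" and S: "S \<in> carrier_mat k k" and y: "y \<in> carrier_vec k"
    by (simp_all add: L_def S_def y_def)
  have LT: "L\<^sup>T \<in> carrier_mat k k" using L by simp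
  have SL: "S = L * L\<^sup>T"
  proof (rule eq_matI)
    fix i j assume "i < dim_row (L * L\<^sup>T)" "j < dim_col (L * L\<^sup>T)"
    then have ij: "i < k" "j < k" using L by auto
    have "(L * L\<^sup>T) $$ (i, j) = (\<Sum>l\<in>{0..<k}. if l \<le> i \<and> l \<le> j then 1 else 0)"
      using ij by (auto simp: L_def scalar_prod_def intro!: sum.cong)
    also have "\<dots> = real (card {l. l < k \<and> l \<le> i \<and> l \<le> j})"
      by (subst sum.inter_filter[symmetric]) (auto intro!: arg_cong[where f=card])
    also have "{l. l < k \<and> l \<le> i \<and> l \<le> j} = {..min i j}" using ij by auto
    finally show "S $$ (i, j) = (L * L\<^sup>T) $$ (i, j)" using ij by (simp add: S_def)
  qed (use L S in auto)
  have "Determinant.det L = prod_list (diag_mat L)"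
    by (rule det_lower_triangular[OF _ L]) (simp add: L_def)
  also have "diag_mat L = replicate k 1"
    by (rule nth_equalityI) (auto simp: diag_mat_def L_def)
  finally have "Determinant.det L = 1" by simp
  then show detS: "Determinant.det S = 1"
    unfolding SL by (simp add: det_mult[OF L LT] det_transpose[OF L])
  then have "S \<in> Units (ring_mat TYPE(real) k ())"
    by (intro det_non_zero_imp_unit[OF S]) simp
  then obtain B where B: "mat_inverse S = Some B"
    using mat_inverse(1)[OF S, where b="()"] by (cases "mat_inverse S") auto
  from mat_inverse(2)[OF S B] have SB: "S * B = 1\<^sub>m k" "B \<in> carrier_mat k k" by auto
  define w where "w = mult_mat_vec B y"
  have w: "w \<in> carrier_vec k" using SB y by (simp add: w_def)
  define v where "v = mult_mat_vec (L\<^sup>T) w"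
  have v: "v \<in> carrier_vec k" using LT w by (simp add: v_def)
  have "mult_mat_vec L v = mult_mat_vec (L * L\<^sup>T) w"
    unfolding v_def by (rule assoc_mult_mat_vec[OF L LT w, symmetric])
  also have "\<dots> = mult_mat_vec (S * B) y"
    unfolding w_def SL[symmetric] by (rule assoc_mult_mat_vec[OF S SB(2) y, symmetric])
  also have "\<dots> = y" unfolding SB(1) using y by simp
  finally have Lv: "mult_mat_vec L v = y" .
  have sums: "(\<Sum>j\<le>i. vec_index v j) = (\<Sum>j\<le>i. u j)" if "i < k" for i
  proof -
    have "(\<Sum>j\<le>i. vec_index v j) = (\<Sum>j\<in>{0..<k}. if j \<le> i then vec_index v j else 0)"
      using that by (intro sum.mono_neutral_cong_left) auto
    also have "\<dots> = vec_index (mult_mat_vec L v) i"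
      using that v by (auto simp: L_def scalar_prod_def intro!: sum.cong)
    also have "\<dots> = (\<Sum>j\<le>i. u j)" unfolding Lv using that by (simp add: y_def)
    finally show ?thesis .
  qed
  have vu: "vec_index v i = u i" if "i < k" for i
  proof (cases i)
    case 0
    then show ?thesis using sums[of 0] that by simp
  next
    case (Suc i')
    then show ?thesis using sums[of i'] sums[of i] that by simp
  qed
  have "scalar_prod y w = scalar_prod w (mult_mat_vec L v)"
    unfolding Lv by (rule comm_scalar_prod[OF y w])
  also have "\<dots> = scalar_prod v v"
    unfolding v_def by (rule transpose_vec_mult_scalar[OF L _ w, symmetric]) (use v v_def in simp)
  also have "\<dots> = (\<Sum>i<k. (u i)\<^sup>2)"
    using v vu by (auto simp: scalar_prod_def power2_eq_square atLeast0LessThan intro!: sum.cong)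
  finally show "scalar_prod y (mult_mat_vec (the (mat_inverse S)) y) = (\<Sum>i<k. (u i)\<^sup>2)"
    by (simp add: B w_def)
qed

text \<open>Taking successive differences is the triangular substitution with \<open>b = 1\<close> in which \<open>r\<^sub>j\<close> is the sum of the
  first \<open>j\<close> increments.\<close>
lemma tri_inv_differences:
  assumes "l \<le> N"
  shows "(\<Sum>i\<in>{1..l}. tri_inv (\<lambda>j y. \<Sum>i\<in>{1..j}. y i) (\<lambda>_ _. 1) N x i) = (if l = 0 then 0 else x l)"
proof (cases l)
  case (Suc j)
  let ?t = "tri_inv (\<lambda>j y. \<Sum>i\<in>{1..j}. y i) (\<lambda>_ _. 1)"
  have "(\<Sum>i\<in>{1..j}. ?t N x i) = (\<Sum>i\<in>{1..j}. ?t j x i)"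
    using fun_cong[OF tri_inv_restrict[of j N]] assms Suc by (intro sum.cong refl) (metis Suc_leD restrict_apply')
  then show ?thesis using Suc assms tri_inv_nth[of j N] by simp
qed simp

lemma PiM_density:
  fixes f :: "'i \<Rightarrow> real \<Rightarrow> real"
  assumes "finite I" and f [measurable]: "\<And>i. f i \<in> borel_measurable borel" and nn: "\<And>i x. f i x \<ge> 0"
    and prob: "\<And>i. prob_space (density lborel (f i))"
  shows "PiM I (\<lambda>i. density lborel (f i)) = density (PiM I (\<lambda>_. lborel)) (\<lambda>x. ennreal (\<Prod>i\<in>I. f i (x i)))"
proof -
  interpret L: product_sigma_finite "\<lambda>_::'i. lborel :: real measure" ..
  interpret D: product_sigma_finite "\<lambda>i. density lborel (f i)"
    using prob by (intro product_sigma_finite.intro prob_space_imp_sigma_finite)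
  note [measurable_cong] = sets_PiM_lborel
  have "density (PiM I (\<lambda>_. lborel)) (\<lambda>x. ennreal (\<Prod>i\<in>I. f i (x i))) = PiM I (\<lambda>i. density lborel (f i))"
  proof (rule D.PiM_eqI[OF \<open>finite I\<close>])
    show "sets (density (PiM I (\<lambda>_. lborel)) (\<lambda>x. ennreal (\<Prod>i\<in>I. f i (x i)))) = sets (PiM I (\<lambda>i. density lborel (f i)))"
      by (auto intro!: sets_PiM_cong)
    fix A assume "\<And>i. i \<in> I \<Longrightarrow> A i \<in> sets (density lborel (f i))"
    then have A [measurable]: "\<And>i. i \<in> I \<Longrightarrow> A i \<in> sets borel" by simp
    have PA: "PiE I A \<in> sets (PiM I (\<lambda>_. lborel))"
      using A \<open>finite I\<close> by (intro sets_PiM_I_finite) auto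
    have "emeasure (density (PiM I (\<lambda>_. lborel)) (\<lambda>x. ennreal (\<Prod>i\<in>I. f i (x i)))) (PiE I A) =
        (\<integral>\<^sup>+x. ennreal (\<Prod>i\<in>I. f i (x i)) * indicator (PiE I A) x \<partial>PiM I (\<lambda>_. lborel))"
      using PA by (intro emeasure_density) auto
    also have "\<dots> = (\<integral>\<^sup>+x. (\<Prod>i\<in>I. ennreal (f i (x i)) * indicator (A i) (x i)) \<partial>PiM I (\<lambda>_. lborel))"
    proof (intro nn_integral_cong)
      fix x assume x: "x \<in> space (PiM I (\<lambda>_. lborel :: real measure))"
      have "indicator (PiE I A) x = (\<Prod>i\<in>I. indicator (A i) (x i) :: ennreal)"
      proof (cases "x \<in> PiE I A")
        case False
        then obtain i where "i \<in> I" "x i \<notin> A i" using x by (auto simp: space_PiM PiE_def)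
        then have "(\<Prod>i\<in>I. indicator (A i) (x i) :: ennreal) = 0"
          using \<open>finite I\<close> by (intro prod_zero bexI[of _ i]) auto
        then show ?thesis using False by simp
      qed (auto simp: PiE_def Pi_def)
      then show "ennreal (\<Prod>i\<in>I. f i (x i)) * indicator (PiE I A) x = (\<Prod>i\<in>I. ennreal (f i (x i)) * indicator (A i) (x i))"
        by (simp add: prod.distrib prod_ennreal nn)
    qed
    also have "\<dots> = (\<Prod>i\<in>I. \<integral>\<^sup>+x. ennreal (f i x) * indicator (A i) x \<partial>lborel)"
      using \<open>finite I\<close> by (intro L.product_nn_integral_prod) auto
    also have "\<dots> = (\<Prod>i\<in>I. emeasure (density lborel (f i)) (A i))"
      using A by (intro prod.cong refl emeasure_density[symmetric]) auto
    finally show "emeasure (density (PiM I (\<lambda>_. lborel)) (\<lambda>x. ennreal (\<Prod>i\<in>I. f i (x i)))) (PiE I A) =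
        (\<Prod>i\<in>I. emeasure (density lborel (f i)) (A i))" .
  qed
  then show ?thesis ..
qed

text \<open>Composition with the restriction to \<open>I\<close> extends a continuous function on \<open>PiE I (\<lambda>_. UNIV)\<close> to a continuous
  function of all families of reals. On the space of these families, the Borel sets of the product topology are
  the measurable sets of the product.\<close>
lemma measurable_continuous_on_PiE:
  fixes f :: "(nat \<Rightarrow> real) \<Rightarrow> real"
  assumes "continuous_on (PiE I (\<lambda>_. UNIV)) f"
  shows "f \<in> borel_measurable (PiM I (\<lambda>_. borel))"
proof -
  have "continuous_on UNIV (\<lambda>x. restrict x I :: nat \<Rightarrow> real)"
  proof (rule continuous_on_coordinatewise_then_product)
    fix i
    show "continuous_on UNIV (\<lambda>x. restrict x I i :: real)" by (cases "i \<in> I") auto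
  qed
  then have "continuous_on UNIV (\<lambda>x. f (restrict x I))"
    by (rule continuous_on_compose2[OF assms]) auto
  then have 1: "(\<lambda>x. f (restrict x I)) \<in> borel_measurable (PiM UNIV (\<lambda>_. borel))"
    by (subst measurable_cong_sets[OF sets_PiM_equal_borel refl]) (rule borel_measurable_continuous_onI)
  have "(\<lambda>x i. if i \<in> I then x i else 0) \<in> measurable (PiM I (\<lambda>_. borel)) (PiM UNIV (\<lambda>_. borel :: real measure))"
  proof (rule measurable_PiM_single')
    fix i
    show "(\<lambda>x. if i \<in> I then x i else 0) \<in> borel_measurable (PiM I (\<lambda>_. borel :: real measure))"
      by (cases "i \<in> I") auto
  qed auto
  from measurable_compose[OF this 1]
  have "(\<lambda>x. f (restrict (\<lambda>i. if i \<in> I then x i else 0) I)) \<in> borel_measurable (PiM I (\<lambda>_. borel))" .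
  also have "?this \<longleftrightarrow> f \<in> borel_measurable (PiM I (\<lambda>_. borel))"
  proof (rule measurable_cong)
    fix x assume "x \<in> space (PiM I (\<lambda>_. borel :: real measure))"
    then have "restrict (\<lambda>i. if i \<in> I then x i else 0) I = x"
      by (auto simp: space_PiM PiE_def extensional_def restrict_def fun_eq_iff)
    then show "f (restrict (\<lambda>i. if i \<in> I then x i else 0) I) = f x" by simp
  qed
  finally show ?thesis .
qed

lemma tendsto_coordinatewise:
  fixes F :: "'c \<Rightarrow> 'i \<Rightarrow> 'b::topological_space"
  assumes "\<And>i. ((\<lambda>c. F c i) \<longlongrightarrow> L i) G"
  shows "(F \<longlongrightarrow> L) G"
  using assms unfolding limitin_canonical_iff[symmetric] euclidean_product_topology[symmetric] limitin_componentwise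
  by simp

lemma tendsto_scaled_ln:
  "(\<lambda>n. sqrt (4 * real n) * ln (1 + z / sqrt (4 * real n))) \<longlonglongrightarrow> z"
  by real_asymp

lemma eventually_scaled_less_1: "eventually (\<lambda>n. \<bar>z / sqrt (4 * real n)\<bar> < 1) sequentially"
proof -
  have "(\<lambda>n. z / sqrt (4 * real n)) \<longlonglongrightarrow> 0" by real_asymp
  from tendstoD[OF this, of 1] show ?thesis by (simp add: dist_real_def)
qed

text \<open>The factorisation \<open>1 - v\<^sup>2 = (1 + v) (1 - v)\<close> makes the two first-order terms cancel.\<close>
lemma tendsto_scaled_ln_square:
  "(\<lambda>n. sqrt (4 * real n) * ln (1 - (z / sqrt (4 * real n))\<^sup>2)) \<longlonglongrightarrow> 0"
proof -
  have "(\<lambda>n. sqrt (4 * real n) * ln (1 + z / sqrt (4 * real n)) +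
      sqrt (4 * real n) * ln (1 + (- z) / sqrt (4 * real n))) \<longlonglongrightarrow> z + (- z)"
    by (intro tendsto_add tendsto_scaled_ln)
  moreover have "eventually (\<lambda>n. sqrt (4 * real n) * ln (1 + z / sqrt (4 * real n)) +
      sqrt (4 * real n) * ln (1 + (- z) / sqrt (4 * real n)) =
      sqrt (4 * real n) * ln (1 - (z / sqrt (4 * real n))\<^sup>2)) sequentially"
    using eventually_scaled_less_1[of z]
  proof eventually_elim
    case (elim n)
    define v where "v = z / sqrt (4 * real n)"
    have "\<bar>v\<bar> < 1" using elim by (simp only: v_def)
    then have v: "0 < 1 + v" "0 < 1 - v" by auto
    have "1 - v\<^sup>2 = (1 + v) * (1 - v)" by (simp add: power2_eq_square algebra_simps)
    then have "ln (1 - v\<^sup>2) = ln (1 + v) + ln (1 - v)" using v by (simp only: ln_mult_pos)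
    then show ?case by (simp add: v_def algebra_simps)
  qed
  ultimately show ?thesis by (simp add: filterlim_cong[OF refl refl])
qed

lemma tendsto_beta_weight:
  "(\<lambda>n. beta_weight (2 * n) i (z / sqrt (4 * real n))) \<longlonglongrightarrow> exp (- z\<^sup>2 / 2)"
proof -
  define c where "c = - z\<^sup>2 / 4"
  have "(\<lambda>n. ((1 + c / real n) ^ n)\<^sup>2 / (1 + c / real n) ^ i) \<longlonglongrightarrow> (exp c)\<^sup>2 / (1 + 0) ^ i"
  proof (intro tendsto_divide)
    show "(\<lambda>n. ((1 + c / real n) ^ n)\<^sup>2) \<longlonglongrightarrow> (exp c)\<^sup>2"
      by (rule tendsto_power[OF tendsto_exp_limit_sequentially])
    have "(\<lambda>n. c / real n) \<longlonglongrightarrow> 0" by real_asymp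
    then show "(\<lambda>n. (1 + c / real n) ^ i) \<longlonglongrightarrow> (1 + 0) ^ i"
      by (intro tendsto_power tendsto_add tendsto_const)
  qed simp
  also have "(exp c)\<^sup>2 / (1 + 0) ^ i = exp (- z\<^sup>2 / 2)"
    by (simp add: c_def power2_eq_square flip: exp_add)
  finally have lim: "(\<lambda>n. ((1 + c / real n) ^ n)\<^sup>2 / (1 + c / real n) ^ i) \<longlonglongrightarrow> exp (- z\<^sup>2 / 2)" .
  have "eventually (\<lambda>n. ((1 + c / real n) ^ n)\<^sup>2 / (1 + c / real n) ^ i =
      beta_weight (2 * n) i (z / sqrt (4 * real n))) sequentially"
    using eventually_scaled_less_1[of z] eventually_ge_at_top[of "max 1 i"]
  proof eventually_elim
    case (elim n)
    have eq: "1 - (z / sqrt (4 * real n))\<^sup>2 = 1 + c / real n"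
      using elim by (simp add: c_def power_divide)
    have pos: "1 + c / real n > 0"
      unfolding eq[symmetric] using elim(1) by (simp only: abs_square_less_1 diff_gt_0_iff_gt)
    have "(1 + c / real n) ^ (2 * n - i) * (1 + c / real n) ^ i = (1 + c / real n) ^ (2 * n)"
      using elim(2) by (simp flip: power_add)
    then have "(1 + c / real n) ^ (2 * n - i) = ((1 + c / real n) ^ n)\<^sup>2 / (1 + c / real n) ^ i"
      using pos by (simp add: field_simps power_mult[symmetric] mult.commute)
    then show ?case using elim(1) by (simp only: beta_weight_def if_True eq)
  qed
  from Lim_transform_eventually[OF lim this] show ?thesis .
qed

text \<open>The bound \<open>1 - v \<le> exp (- v)\<close> applied to the \<open>n\<close>-th power yields a Gaussian majorant that is independent of
  \<open>n\<close>; it is here that the exponent \<open>2 n - i\<close> has to be at least \<open>n\<close>.\<close>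
lemma beta_weight_le_exp:
  assumes "1 \<le> i" "i \<le> n"
  shows "beta_weight (2 * n) i (z / sqrt (4 * real n)) \<le> exp (- z\<^sup>2 / 4)"
proof (cases "\<bar>z / sqrt (4 * real n)\<bar> < 1")
  case True
  define v where "v = (z / sqrt (4 * real n))\<^sup>2"
  have v: "v = z\<^sup>2 / (4 * real n)" by (simp add: v_def power_divide)
  have "0 \<le> 1 - v" "1 - v \<le> 1" using True by (auto simp: v_def abs_square_le_1 less_imp_le)
  then have "(1 - v) ^ (2 * n - i) \<le> (1 - v) ^ n" using assms by (intro power_decreasing) auto
  also have "\<dots> \<le> exp (- v) ^ n"
    using exp_ge_add_one_self[of "- v"] \<open>0 \<le> 1 - v\<close> by (intro power_mono) auto
  also have "\<dots> = exp (- z\<^sup>2 / 4)"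
    using assms by (simp add: v flip: exp_of_nat_mult)
  finally show ?thesis using True by (simp add: beta_weight_def v_def)
qed (simp add: beta_weight_def)

lemma integrable_exp_square: "integrable lborel (\<lambda>z::real. exp (- z\<^sup>2 / 4))"
proof -
  have "(\<lambda>z::real. exp (- z\<^sup>2 / 4)) = (\<lambda>z. sqrt (2 * pi * (sqrt 2)\<^sup>2) * normal_density 0 (sqrt 2) z)"
    by (auto simp: normal_density_def)
  then show ?thesis by simp
qed

abbreviation normal_law :: "real measure" where
  "normal_law \<equiv> density lborel (\<lambda>x. ennreal (std_normal_density x))"

lemma prob_normal_law: "prob_space normal_law"
  by (rule prob_space_normal_density) simp

lemma distr_tri_inv_differences:
  "distr (PiM {1..k} (\<lambda>_. lborel)) (PiM {1..k} (\<lambda>_. borel)) (tri_inv (\<lambda>j y. \<Sum>i\<in>{1..j}. y i) (\<lambda>_ _. 1) k) =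
     PiM {1..k} (\<lambda>_. lborel :: real measure)"
proof -
  note [measurable_cong] = sets_PiM_lborel
  interpret diff: triangular "\<lambda>j y. \<Sum>i\<in>{1..j}. y i" "\<lambda>_ _. 1"
    by unfold_locales auto
  note [measurable] = diff.measurable_tri_inv[of k, OF order_refl]
  show ?thesis
  proof (rule measure_eqI)
    fix A assume "A \<in> sets (distr (PiM {1..k} (\<lambda>_. lborel)) (PiM {1..k} (\<lambda>_. borel)) (tri_inv (\<lambda>j y. \<Sum>i\<in>{1..j}. y i) (\<lambda>_ _. 1) k))"
    then have A [measurable]: "A \<in> sets (PiM {1..k} (\<lambda>_. borel))" by simp
    have "emeasure (distr (PiM {1..k} (\<lambda>_. lborel)) (PiM {1..k} (\<lambda>_. borel)) (tri_inv (\<lambda>j y. \<Sum>i\<in>{1..j}. y i) (\<lambda>_ _. 1) k)) A =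
        (\<integral>\<^sup>+x. indicator A x \<partial>distr (PiM {1..k} (\<lambda>_. lborel)) (PiM {1..k} (\<lambda>_. borel)) (tri_inv (\<lambda>j y. \<Sum>i\<in>{1..j}. y i) (\<lambda>_ _. 1) k))"
      by simp
    also have "\<dots> = (\<integral>\<^sup>+x. indicator A (tri_inv (\<lambda>j y. \<Sum>i\<in>{1..j}. y i) (\<lambda>_ _. 1) k x) \<partial>PiM {1..k} (\<lambda>_. lborel))"
      by (rule nn_integral_distr) measurable
    also have "\<dots> = (\<integral>\<^sup>+x. indicator A x \<partial>PiM {1..k} (\<lambda>_. lborel))"
      by (subst diff.nn_integral_tri_inv) auto
    finally show "emeasure (distr (PiM {1..k} (\<lambda>_. lborel)) (PiM {1..k} (\<lambda>_. borel)) (tri_inv (\<lambda>j y. \<Sum>i\<in>{1..j}. y i) (\<lambda>_ _. 1) k)) A =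
        emeasure (PiM {1..k} (\<lambda>_. lborel)) A"
      by (simp add: sets_PiM_lborel)
  qed (simp add: sets_PiM_lborel)
qed

text \<open>The normal law with covariance \<open>min i j\<close> is the law of the partial sums of independent standard normal
  variables: passing to increments preserves Lebesgue measure and turns the density into a product.\<close>
lemma integral_multivariate_normal_min:
  fixes f :: "(nat \<Rightarrow> real) \<Rightarrow> real"
  assumes f [measurable]: "f \<in> borel_measurable (PiM {1..k} (\<lambda>_. borel))"
  shows "(\<integral>x. f x \<partial>multivariate_normal k (\<lambda>_. 0) (\<lambda>i j. real (min i j))) =
    (\<integral>y. f (\<lambda>l\<in>{1..k}. \<Sum>j\<in>{1..l}. y j) \<partial>PiM {1..k} (\<lambda>_. normal_law))"
proof -
  note [measurable_cong] = sets_PiM_lborel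
  interpret diff: triangular "\<lambda>j y. \<Sum>i\<in>{1..j}. y i" "\<lambda>_ _. 1"
    by unfold_locales auto
  note [measurable] = diff.measurable_tri_inv[of k, OF order_refl]
  let ?L = "PiM {1..k} (\<lambda>_::nat. lborel :: real measure)"
  let ?t = "tri_inv (\<lambda>j y. \<Sum>i\<in>{1..j}. y i) (\<lambda>_ _. 1) k"
  let ?\<phi> = "\<lambda>y :: nat \<Rightarrow> real. \<Prod>i\<in>{1..k}. std_normal_density (y i)"
  let ?S = "\<lambda>y :: nat \<Rightarrow> real. \<lambda>l\<in>{1..k}. \<Sum>j\<in>{1..l}. y j"
  have S [measurable]: "?S \<in> measurable (PiM {1..k} (\<lambda>_. borel)) (PiM {1..k} (\<lambda>_. borel))"
    by (intro measurable_restrict borel_measurable_sum measurable_component_singleton) auto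
  have "multivariate_normal k (\<lambda>_. 0) (\<lambda>i j. real (min i j)) = density ?L (\<lambda>x. ennreal (?\<phi> (?t x)))"
  proof -
    define q where "q x = exp (- (scalar_prod (Matrix.vec k (\<lambda>i. x (i + 1)))
        (mult_mat_vec (the (mat_inverse (Matrix.mat k k (\<lambda>(i, j). real (min (i + 1) (j + 1))))))
          (Matrix.vec k (\<lambda>i. x (i + 1))))) / 2) /
      sqrt ((2 * pi) ^ k * Determinant.det (Matrix.mat k k (\<lambda>(i, j). real (min (i + 1) (j + 1)))))" for x :: "nat \<Rightarrow> real"
    have "multivariate_normal k (\<lambda>_. 0) (\<lambda>i j. real (min i j)) = density ?L (\<lambda>x. ennreal (q x))"
      by (simp add: multivariate_normal_def Let_def q_def)
    moreover have "q x = ?\<phi> (?t x)" for x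
    proof -
      define u where "u i = ?t x (i + 1)" for i
      have vec: "Matrix.vec k (\<lambda>i. x (i + 1)) = Matrix.vec k (\<lambda>i. \<Sum>j\<le>i. u j)"
      proof (rule eq_vecI)
        fix i assume "i < dim_vec (Matrix.vec k (\<lambda>i. \<Sum>j\<le>i. u j))"
        then have i: "i < k" by simp
        have "(\<Sum>j\<le>i. u j) = (\<Sum>j\<in>{1..i+1}. ?t x j)"
          unfolding u_def by (rule sum.reindex_bij_witness[where i="\<lambda>j. j - 1" and j="\<lambda>j. j + 1"]) auto
        also have "\<dots> = x (i + 1)" using tri_inv_differences[of "i + 1" k x] i by simp
        finally show "Matrix.vec k (\<lambda>i. x (i + 1)) $ i = Matrix.vec k (\<lambda>i. \<Sum>j\<le>i. u j) $ i"
          using i by simp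
      qed simp
      have "q x = exp (- (\<Sum>i<k. (u i)\<^sup>2) / 2) / sqrt ((2 * pi) ^ k)"
        unfolding q_def vec mat_inverse_min by simp
      also have "(\<Sum>i<k. (u i)\<^sup>2) = (\<Sum>i\<in>{1..k}. (?t x i)\<^sup>2)"
        unfolding u_def by (rule sum.reindex_bij_witness[where i="\<lambda>j. j - 1" and j="\<lambda>j. j + 1"]) auto
      also have "exp (- \<dots> / 2) / sqrt ((2 * pi) ^ k) = ?\<phi> (?t x)"
      proof -
        have "?\<phi> (?t x) = (\<Prod>i\<in>{1..k}. 1 / sqrt (2 * pi)) * (\<Prod>i\<in>{1..k}. exp (- (?t x i)\<^sup>2 / 2))"
          unfolding std_normal_density_def prod.distrib ..
        also have "(\<Prod>i\<in>{1..k}. 1 / sqrt (2 * pi)) = 1 / sqrt ((2 * pi) ^ k)"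
          by (simp only: prod_constant card_atLeastAtMost power_one_over real_sqrt_power) simp
        also have "(\<Prod>i\<in>{1..k}. exp (- (?t x i)\<^sup>2 / 2)) = exp (- (\<Sum>i\<in>{1..k}. (?t x i)\<^sup>2) / 2)"
          by (simp only: exp_sum[symmetric] finite_atLeastAtMost sum_divide_distrib[symmetric] sum_negf)
        finally show ?thesis by (simp only: times_divide_eq_left mult_1)
      qed
      finally show ?thesis .
    qed
    ultimately show ?thesis by (simp only:)
  qed
  then have "(\<integral>x. f x \<partial>multivariate_normal k (\<lambda>_. 0) (\<lambda>i j. real (min i j))) =
      (\<integral>x. ?\<phi> (?t x) *\<^sub>R f x \<partial>?L)"
    by (simp only:) (rule integral_density, auto intro!: prod_nonneg AE_I2)
  also have "\<dots> = (\<integral>x. ?\<phi> (?t x) *\<^sub>R f (?S (?t x)) \<partial>?L)"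
  proof (intro Bochner_Integration.integral_cong refl)
    fix x assume "x \<in> space ?L"
    then have "?S (?t x) = x"
      by (auto simp: tri_inv_differences fun_eq_iff space_PiM PiE_def extensional_def)
    then show "?\<phi> (?t x) *\<^sub>R f x = ?\<phi> (?t x) *\<^sub>R f (?S (?t x))" by (simp only:)
  qed
  also have "\<dots> = (\<integral>y. ?\<phi> y *\<^sub>R f (?S y) \<partial>distr ?L (PiM {1..k} (\<lambda>_. borel)) ?t)"
    by (rule integral_distr[symmetric]) measurable
  also have "\<dots> = (\<integral>y. ?\<phi> y *\<^sub>R f (?S y) \<partial>?L)"
    by (simp only: distr_tri_inv_differences)
  also have "\<dots> = (\<integral>y. f (?S y) \<partial>density ?L (\<lambda>y. ennreal (?\<phi> y)))"
    by (rule integral_density[symmetric]) (auto intro!: prod_nonneg AE_I2)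
  also have "density ?L (\<lambda>y. ennreal (?\<phi> y)) = PiM {1..k} (\<lambda>_. normal_law)"
    by (rule PiM_density[symmetric]) (auto intro: prob_normal_law)
  finally show ?thesis .
qed

lemma integral_even_coordinates:
  fixes f :: "(nat \<Rightarrow> real) \<Rightarrow> real"
  assumes f [measurable]: "f \<in> borel_measurable (PiM {1..k} (\<lambda>_. borel))"
  shows "(\<integral>z. f (\<lambda>l\<in>{1..k}. \<Sum>j\<in>{1..l}. z (2 * j)) \<partial>PiM {1..2*k} (\<lambda>_. normal_law)) =
    (\<integral>x. f x \<partial>multivariate_normal k (\<lambda>_. 0) (\<lambda>i j. real (min i j)))"
proof -
  let ?S = "\<lambda>y :: nat \<Rightarrow> real. \<lambda>l\<in>{1..k}. \<Sum>j\<in>{1..l}. y j"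
  have sets_eq: "sets (PiM {1..k} (\<lambda>_. normal_law)) = sets (PiM {1..k} (\<lambda>_. borel))"
    by (rule sets_PiM_cong) auto
  have S [measurable]: "?S \<in> measurable (PiM {1..k} (\<lambda>_. borel)) (PiM {1..k} (\<lambda>_. borel))"
    by (intro measurable_restrict borel_measurable_sum measurable_component_singleton) auto
  have "distr (PiM {1..2*k} (\<lambda>_. normal_law)) (PiM {1..k} (\<lambda>_. normal_law)) (\<lambda>z. \<lambda>j\<in>{1..k}. z (2 * j)) =
      PiM {1..k} (\<lambda>_. normal_law)"
    using distr_PiM_reindex[of "{1..2*k}" "\<lambda>_. normal_law" "\<lambda>j. 2 * j" "{1..k}"] prob_normal_law
    by (auto simp: inj_on_def)
  then have "(\<integral>y. f (?S y) \<partial>PiM {1..k} (\<lambda>_. normal_law)) =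
      (\<integral>y. f (?S y) \<partial>distr (PiM {1..2*k} (\<lambda>_. normal_law)) (PiM {1..k} (\<lambda>_. normal_law)) (\<lambda>z. \<lambda>j\<in>{1..k}. z (2 * j)))"
    by simp
  also have "\<dots> = (\<integral>z. f (?S (\<lambda>j\<in>{1..k}. z (2 * j))) \<partial>PiM {1..2*k} (\<lambda>_. normal_law))"
  proof (rule integral_distr)
    show "(\<lambda>z. \<lambda>j\<in>{1..k}. z (2 * j)) \<in> measurable (PiM {1..2*k} (\<lambda>_. normal_law)) (PiM {1..k} (\<lambda>_. normal_law))"
      by (intro measurable_restrict measurable_component_singleton) auto
    show "(\<lambda>y. f (?S y)) \<in> borel_measurable (PiM {1..k} (\<lambda>_. normal_law))"
      by (subst measurable_cong_sets[OF sets_eq refl]) measurable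
  qed
  also have "\<dots> = (\<integral>z. f (\<lambda>l\<in>{1..k}. \<Sum>j\<in>{1..l}. z (2 * j)) \<partial>PiM {1..2*k} (\<lambda>_. normal_law))"
  proof -
    have "?S (\<lambda>j\<in>{1..k}. z (2 * j)) = (\<lambda>l\<in>{1..k}. \<Sum>j\<in>{1..l}. z (2 * j))" for z :: "nat \<Rightarrow> real"
      by (intro restrict_ext sum.cong) auto
    then show ?thesis by (simp only:)
  qed
  finally show ?thesis by (simp only: integral_multivariate_normal_min[OF f])
qed

section \<open>Convergence in distribution\<close>

text \<open>The unnormalised joint density of the first \<open>K\<close> canonical coordinates of the moment space of order \<open>2 n\<close>,
  scaled by \<open>\<surd>(4n)\<close>.\<close>
definition weight :: "nat \<Rightarrow> nat \<Rightarrow> (nat \<Rightarrow> real) \<Rightarrow> real" where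
  "weight K n z = (\<Prod>i\<in>{1..K}. beta_weight (2 * n) i (z i / sqrt (4 * real n)))"

lemma weight_nonneg: "weight K n z \<ge> 0"
  by (simp add: weight_def prod_nonneg beta_weight_nonneg)

lemma measurable_weight [measurable]: "weight K n \<in> borel_measurable (PiM {1..K} (\<lambda>_. borel))"
  unfolding weight_def[abs_def] by measurable

lemma weight_le: "K \<le> n \<Longrightarrow> weight K n z \<le> (\<Prod>i\<in>{1..K}. exp (- (z i)\<^sup>2 / 4))"
  unfolding weight_def by (intro prod_mono conjI beta_weight_nonneg beta_weight_le_exp) auto

lemma integrable_prod_exp:
  "integrable (PiM {1..K} (\<lambda>_::nat. lborel)) (\<lambda>z. \<Prod>i\<in>{1..K}. exp (- (z i :: real)\<^sup>2 / 4))"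
proof -
  interpret product_sigma_finite "\<lambda>_::nat. lborel :: real measure" ..
  show ?thesis by (rule product_integrable_prod[OF _ integrable_exp_square]) simp
qed

lemma integrable_weight:
  assumes "K \<le> n"
  shows "integrable (PiM {1..K} (\<lambda>_. lborel)) (weight K n)"
proof -
  note [measurable_cong] = sets_PiM_lborel
  show ?thesis
    by (rule Bochner_Integration.integrable_bound[OF integrable_prod_exp[of K]])
      (use weight_le[OF assms] in \<open>auto intro!: AE_I2 simp: weight_nonneg prod_nonneg\<close>)
qed

lemma tendsto_integral_weight:
  fixes h :: "nat \<Rightarrow> (nat \<Rightarrow> real) \<Rightarrow> real"
  assumes h [measurable]: "\<And>n. h n \<in> borel_measurable (PiM {1..K} (\<lambda>_. borel))"
    and g [measurable]: "g \<in> borel_measurable (PiM {1..K} (\<lambda>_. borel))"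
    and bound: "\<And>n z. z \<in> space (PiM {1..K} (\<lambda>_. borel)) \<Longrightarrow> \<bar>h n z\<bar> \<le> B"
    and lim: "\<And>z. z \<in> space (PiM {1..K} (\<lambda>_. borel)) \<Longrightarrow> (\<lambda>n. h n z) \<longlonglongrightarrow> g z"
  shows "(\<lambda>n. \<integral>z. weight K n z * h n z \<partial>PiM {1..K} (\<lambda>_. lborel)) \<longlonglongrightarrow>
    sqrt (2 * pi) ^ K * (\<integral>z. g z \<partial>PiM {1..K} (\<lambda>_. normal_law))"
proof -
  note [measurable_cong] = sets_PiM_lborel
  let ?L = "PiM {1..K} (\<lambda>_::nat. lborel :: real measure)"
  have spL: "space ?L = space (PiM {1..K} (\<lambda>_. borel))" by (simp add: space_PiM)
  (* The Gaussian majorant is valid from n = K on. *)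
  have "(\<lambda>n. \<integral>z. weight K (n + K) z * h (n + K) z \<partial>?L) \<longlonglongrightarrow>
      (\<integral>z. (\<Prod>i\<in>{1..K}. exp (- (z i)\<^sup>2 / 2)) * g z \<partial>?L)"
  proof (rule integral_dominated_convergence)
    show "integrable ?L (\<lambda>z. B * (\<Prod>i\<in>{1..K}. exp (- (z i)\<^sup>2 / 4)))"
      by (intro integrable_mult_right integrable_prod_exp)
    show "AE z in ?L. (\<lambda>n. weight K (n + K) z * h (n + K) z) \<longlonglongrightarrow> (\<Prod>i\<in>{1..K}. exp (- (z i)\<^sup>2 / 2)) * g z"
    proof (rule AE_I2)
      fix z assume "z \<in> space ?L"
      then have "(\<lambda>n. weight K n z * h n z) \<longlonglongrightarrow> (\<Prod>i\<in>{1..K}. exp (- (z i)\<^sup>2 / 2)) * g z"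
        unfolding weight_def spL by (intro tendsto_mult tendsto_prod tendsto_beta_weight lim)
      then show "(\<lambda>n. weight K (n + K) z * h (n + K) z) \<longlonglongrightarrow> (\<Prod>i\<in>{1..K}. exp (- (z i)\<^sup>2 / 2)) * g z"
        by (rule LIMSEQ_ignore_initial_segment)
    qed
    fix n
    show "AE z in ?L. norm (weight K (n + K) z * h (n + K) z) \<le> B * (\<Prod>i\<in>{1..K}. exp (- (z i)\<^sup>2 / 4))"
    proof (rule AE_I2)
      fix z assume "z \<in> space ?L"
      then have "\<bar>h (n + K) z\<bar> \<le> B" unfolding spL by (rule bound)
      then have "weight K (n + K) z * \<bar>h (n + K) z\<bar> \<le> (\<Prod>i\<in>{1..K}. exp (- (z i)\<^sup>2 / 4)) * B"
        by (intro mult_mono weight_le) (auto simp: prod_nonneg)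
      then show "norm (weight K (n + K) z * h (n + K) z) \<le> B * (\<Prod>i\<in>{1..K}. exp (- (z i)\<^sup>2 / 4))"
        by (simp add: abs_mult weight_nonneg mult.commute)
    qed
  qed measurable
  then have "(\<lambda>n. \<integral>z. weight K n z * h n z \<partial>?L) \<longlonglongrightarrow> (\<integral>z. (\<Prod>i\<in>{1..K}. exp (- (z i)\<^sup>2 / 2)) * g z \<partial>?L)"
    by (rule LIMSEQ_offset)
  also have "(\<integral>z. (\<Prod>i\<in>{1..K}. exp (- (z i)\<^sup>2 / 2)) * g z \<partial>?L) =
      (\<integral>z. sqrt (2 * pi) ^ K * ((\<Prod>i\<in>{1..K}. std_normal_density (z i)) *\<^sub>R g z) \<partial>?L)"
  proof (intro Bochner_Integration.integral_cong refl)
    fix z :: "nat \<Rightarrow> real"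
    have "(\<Prod>i\<in>{1..K}. exp (- (z i)\<^sup>2 / 2)) = (\<Prod>i\<in>{1..K}. sqrt (2 * pi) * std_normal_density (z i))"
      by (intro prod.cong refl) (simp add: std_normal_density_def)
    also have "\<dots> = sqrt (2 * pi) ^ K * (\<Prod>i\<in>{1..K}. std_normal_density (z i))"
      by (simp only: prod.distrib prod_constant card_atLeastAtMost) simp
    finally show "(\<Prod>i\<in>{1..K}. exp (- (z i)\<^sup>2 / 2)) * g z =
        sqrt (2 * pi) ^ K * ((\<Prod>i\<in>{1..K}. std_normal_density (z i)) *\<^sub>R g z)"
      by (simp only: real_scaleR_def mult.assoc)
  qed
  also have "\<dots> = sqrt (2 * pi) ^ K * (\<integral>z. (\<Prod>i\<in>{1..K}. std_normal_density (z i)) *\<^sub>R g z \<partial>?L)"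
    by (rule integral_mult_right_zero)
  also have "(\<integral>z. (\<Prod>i\<in>{1..K}. std_normal_density (z i)) *\<^sub>R g z \<partial>?L) =
      (\<integral>z. g z \<partial>density ?L (\<lambda>z. ennreal (\<Prod>i\<in>{1..K}. std_normal_density (z i))))"
    by (rule integral_density[symmetric]) (auto intro!: prod_nonneg AE_I2)
  also have "density ?L (\<lambda>z. ennreal (\<Prod>i\<in>{1..K}. std_normal_density (z i))) = PiM {1..K} (\<lambda>_. normal_law)"
    by (rule PiM_density[symmetric]) (auto intro: prob_normal_law)
  finally show ?thesis .
qed

lemma integral_normalized_density:
  fixes h W :: "'a \<Rightarrow> real"
  assumes prob: "prob_space (density L (\<lambda>z. \<kappa> * ennreal (W z)))"
    and W: "integrable L W" "\<And>z. W z \<ge> 0" and h [measurable]: "h \<in> borel_measurable L"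
  shows "(\<integral>z. h z \<partial>density L (\<lambda>z. \<kappa> * ennreal (W z))) = (\<integral>z. W z * h z \<partial>L) / (\<integral>z. W z \<partial>L)"
proof -
  have [measurable]: "W \<in> borel_measurable L" using W by simp
  define d where "d = (\<integral>z. W z \<partial>L)"
  have "1 = emeasure (density L (\<lambda>z. \<kappa> * ennreal (W z))) (space L)"
    using prob_space.emeasure_space_1[OF prob] by simp
  also have "\<dots> = (\<integral>\<^sup>+z. \<kappa> * ennreal (W z) \<partial>L)"
    by (subst emeasure_density) (auto intro!: nn_integral_cong)
  also have "\<dots> = \<kappa> * ennreal d"
    unfolding d_def using W by (simp add: nn_integral_cmult nn_integral_eq_integral)
  finally have \<kappa>d: "\<kappa> * ennreal d = 1" ..
  have d0: "d \<ge> 0" unfolding d_def using W by (intro integral_nonneg_AE) auto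
  have "d \<noteq> 0" using \<kappa>d by auto
  with d0 have d: "d > 0" by simp
  have "\<kappa> \<noteq> \<top>" using \<kappa>d d by (auto simp: ennreal_top_mult)
  then obtain c where c: "\<kappa> = ennreal c" "c \<ge> 0" by (cases \<kappa>) auto
  then have "ennreal (c * d) = ennreal 1" using \<kappa>d d by (simp add: ennreal_mult)
  then have "c * d = 1" using c d by (subst (asm) ennreal_inj) auto
  then have cd: "c = 1 / d" using d by (simp add: field_simps)
  have "(\<integral>z. h z \<partial>density L (\<lambda>z. \<kappa> * ennreal (W z))) = (\<integral>z. h z \<partial>density L (\<lambda>z. ennreal (c * W z)))"
    using c W by (simp add: ennreal_mult)
  also have "\<dots> = (\<integral>z. (c * W z) *\<^sub>R h z \<partial>L)"
    using c W by (intro integral_density) auto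
  also have "\<dots> = c * (\<integral>z. W z * h z \<partial>L)"
    by (simp add: mult.assoc)
  finally show ?thesis by (simp add: cd d_def)
qed

text \<open>The vector of the theorem as a function of the scaled canonical coordinates.\<close>
definition log_det_scaled :: "nat \<Rightarrow> nat \<Rightarrow> (nat \<Rightarrow> real) \<Rightarrow> nat \<Rightarrow> real" where
  "log_det_scaled k n z = (\<lambda>l\<in>{1..k}. sqrt (4 * real n) *
     (\<Sum>j\<in>{1..l}. ln (verblunsky_energy (\<lambda>i. z i / sqrt (4 * real n)) (2 * j - 1)) + ln (1 + z (2 * j) / sqrt (4 * real n))))"

lemma measurable_log_det_scaled [measurable]:
  "log_det_scaled k n \<in> measurable (PiM {1..2*k} (\<lambda>_. borel)) (PiM {1..k} (\<lambda>_. borel))"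
proof -
  have comp: "(\<lambda>z. z i) \<in> borel_measurable (PiM {1..2*k} (\<lambda>_. borel :: real measure))" if "i \<in> {1..2*k}" for i
    using that by (rule measurable_component_singleton)
  show ?thesis
    unfolding log_det_scaled_def[abs_def] verblunsky_energy_def
    by (intro measurable_restrict borel_measurable_times borel_measurable_const borel_measurable_sum
        borel_measurable_add borel_measurable_ln borel_measurable_prod borel_measurable_diff
        borel_measurable_power borel_measurable_divide comp) auto
qed

lemma tendsto_log_det_scaled:
  "(\<lambda>n. log_det_scaled k n z) \<longlonglongrightarrow> (\<lambda>l\<in>{1..k}. \<Sum>j\<in>{1..l}. z (2 * j))"
proof (rule tendsto_coordinatewise)
  fix l
  show "(\<lambda>n. log_det_scaled k n z l) \<longlonglongrightarrow> (\<lambda>l\<in>{1..k}. \<Sum>j\<in>{1..l}. z (2 * j)) l"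
  proof (cases "l \<in> {1..k}")
    case True
    have "(\<lambda>n. \<Sum>j\<in>{1..l}. (\<Sum>i\<in>{1..2*j-1}. sqrt (4 * real n) * ln (1 - (z i / sqrt (4 * real n))\<^sup>2)) +
        sqrt (4 * real n) * ln (1 + z (2 * j) / sqrt (4 * real n))) \<longlonglongrightarrow>
        (\<Sum>j\<in>{1..l}. (\<Sum>i\<in>{1..2*j-1}. 0) + z (2 * j))"
      by (intro tendsto_sum tendsto_add tendsto_scaled_ln tendsto_scaled_ln_square)
    then have lim: "(\<lambda>n. \<Sum>j\<in>{1..l}. (\<Sum>i\<in>{1..2*j-1}. sqrt (4 * real n) * ln (1 - (z i / sqrt (4 * real n))\<^sup>2)) +
        sqrt (4 * real n) * ln (1 + z (2 * j) / sqrt (4 * real n))) \<longlonglongrightarrow> (\<Sum>j\<in>{1..l}. z (2 * j))"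
      by simp
    have "eventually (\<lambda>n. \<forall>i\<in>{1..2*l}. \<bar>z i / sqrt (4 * real n)\<bar> < 1) sequentially"
      by (intro eventually_ball_finite ballI eventually_scaled_less_1) simp
    then have "eventually (\<lambda>n. (\<Sum>j\<in>{1..l}. (\<Sum>i\<in>{1..2*j-1}. sqrt (4 * real n) * ln (1 - (z i / sqrt (4 * real n))\<^sup>2)) +
        sqrt (4 * real n) * ln (1 + z (2 * j) / sqrt (4 * real n))) = log_det_scaled k n z l) sequentially"
    proof eventually_elim
      case (elim n)
      have "ln (verblunsky_energy (\<lambda>i. z i / sqrt (4 * real n)) (2 * j - 1)) =
          (\<Sum>i\<in>{1..2*j-1}. ln (1 - (z i / sqrt (4 * real n))\<^sup>2))" if "j \<in> {1..l}" for j
        unfolding verblunsky_energy_def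
      proof (rule ln_prod)
        fix i assume "i \<in> {1..2*j-1}"
        then have "\<bar>z i / sqrt (4 * real n)\<bar> < 1" using elim that by auto
        then have "(z i / sqrt (4 * real n))\<^sup>2 < 1" by (simp only: abs_square_less_1)
        then show "1 - (z i / sqrt (4 * real n))\<^sup>2 \<noteq> 0" by simp
      qed simp
      then show ?case
        using True by (simp add: log_det_scaled_def sum_distrib_left distrib_left)
    qed
    from Lim_transform_eventually[OF lim this] show ?thesis using True by simp
  next
    case False
    then have "log_det_scaled k n z l = undefined" "(\<lambda>l\<in>{1..k}. \<Sum>j\<in>{1..l}. z (2 * j)) l = undefined" for n
      by (auto simp: log_det_scaled_def)
    then show ?thesis by (simp only: tendsto_const)
  qed
qed

lemma measurable_D_moments:
  assumes "l \<le> n"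
  shows "D_moments l \<in> borel_measurable (PiM {1..2*n} (\<lambda>_. borel))"
proof -
  have comp: "(\<lambda>m. (m(0 := 1)) i) \<in> borel_measurable (PiM {1..2*n} (\<lambda>_. borel :: real measure))" if "i \<le> 2 * l" for i
  proof (cases "i = 0")
    case False
    then have "i \<in> {1..2*n}" using that assms by simp
    then show ?thesis using False by simp
  qed simp
  have "D_moments l = (\<lambda>m. ln (\<Sum>p | p permutes {0..<l+1}. signof p * (\<Prod>i = 0..<l+1. ((m :: nat \<Rightarrow> real)(0 := 1)) (i + p i))))"
  proof
    fix m :: "nat \<Rightarrow> real"
    have "Determinant.det (Matrix.mat (l + 1) (l + 1) (\<lambda>(i, j). (m(0 := 1)) (i + j))) =
        (\<Sum>p | p permutes {0..<l+1}. signof p * (\<Prod>i = 0..<l+1. Matrix.mat (l + 1) (l + 1) (\<lambda>(i, j). (m(0 := 1)) (i + j)) $$ (i, p i)))"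
      by (rule det_def') simp
    also have "\<dots> = (\<Sum>p | p permutes {0..<l+1}. signof p * (\<Prod>i = 0..<l+1. (m(0 := 1)) (i + p i)))"
    proof (intro sum.cong refl arg_cong2[where f="(*)"] prod.cong)
      fix p i assume "p \<in> {p. p permutes {0..<l+1}}" "i \<in> {0..<l+1}"
      then have "i < l + 1" "p i < l + 1" using permutes_in_image[of p "{0..<l+1}" i] by auto
      then show "Matrix.mat (l + 1) (l + 1) (\<lambda>(i, j). (m(0 := 1)) (i + j)) $$ (i, p i) = (m(0 := 1)) (i + p i)"
        by simp
    qed
    finally show "D_moments l m = ln (\<Sum>p | p permutes {0..<l+1}. signof p * (\<Prod>i = 0..<l+1. (m(0 := 1)) (i + p i)))"
      unfolding D_moments_def log_hankel_det_def by (rule arg_cong)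
  qed
  moreover have "(\<lambda>m. ln (\<Sum>p | p permutes {0..<l+1}. signof p * (\<Prod>i = 0..<l+1. (m(0 := 1)) (i + p i)) :: real))
      \<in> borel_measurable (PiM {1..2*n} (\<lambda>_. borel))"
  proof (intro borel_measurable_ln borel_measurable_sum borel_measurable_times borel_measurable_const borel_measurable_prod comp)
    fix p i assume "p \<in> {p. p permutes {0..<l+1}}" "i \<in> {0..<l+1}"
    then have "i < l + 1" "p i < l + 1" using permutes_in_image[of p "{0..<l+1}" i] by auto
    then show "i + p i \<le> 2 * l" by simp
  qed
  ultimately show ?thesis by (simp only:)
qed

text \<open>Expressing the expectation as a quotient of two integrals against the same weight removes the normalising
  constants, so that only dominated convergence is needed in the limit.\<close>
lemma expectation_log_det:
  fixes f :: "(nat \<Rightarrow> real) \<Rightarrow> real"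
  assumes M: "prob_space M" and m: "m \<in> measurable M (PiM {1..2*n} (\<lambda>_. borel))"
    and distr: "distr M (PiM {1..2*n} (\<lambda>_. borel)) m = uniform_moment_space (2 * n)"
    and n: "2 * k \<le> n" "1 \<le> n"
    and f [measurable]: "f \<in> borel_measurable (PiM {1..k} (\<lambda>_. borel))"
  shows "(\<integral>x. f x \<partial>distr M (PiM {1..k} (\<lambda>_. borel))
      (\<lambda>\<omega>. \<lambda>i\<in>{1..k}. sqrt (4 * real n) * (D_moments i (m \<omega>) - D_arcsine i))) =
    (\<integral>z. weight (2 * k) n z * f (log_det_scaled k n z) \<partial>PiM {1..2*k} (\<lambda>_. lborel)) /
    (\<integral>z. weight (2 * k) n z \<partial>PiM {1..2*k} (\<lambda>_. lborel))"
proof -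
  note [measurable_cong] = sets_PiM_lborel
  let ?U = "uniform_moment_space (2 * n)"
  let ?G = "\<lambda>m. \<lambda>i\<in>{1..k}. sqrt (4 * real n) * (D_moments i m - D_arcsine i)"
  let ?Z = "\<lambda>m. \<lambda>i\<in>{1..2*k}. sqrt (4 * real n) * canonical (2 * n) m i"
  have prob: "prob_space ?U"
    unfolding distr[symmetric] by (rule prob_space.prob_space_distr[OF M m])
  have sets_U [measurable_cong]: "sets ?U = sets (PiM {1..2*n} (\<lambda>_. borel))"
    by (simp add: uniform_moment_space_def sets_PiM_lborel)
  have G [measurable]: "?G \<in> measurable (PiM {1..2*n} (\<lambda>_. borel)) (PiM {1..k} (\<lambda>_. borel))"
    using n by (intro measurable_restrict borel_measurable_times borel_measurable_diff borel_measurable_const measurable_D_moments) auto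
  have comp: "(\<lambda>x. x i) \<in> borel_measurable (PiM {1..2*n} (\<lambda>_. borel :: real measure))" if "i \<in> {1..2*k}" for i
    using that n by (intro measurable_component_singleton) auto
  have "(\<lambda>x. \<lambda>i\<in>{1..2*k}. sqrt (4 * real n) * x i) \<in> measurable (PiM {1..2*n} (\<lambda>_. borel)) (PiM {1..2*k} (\<lambda>_. borel))"
    by (intro measurable_restrict borel_measurable_times borel_measurable_const comp) auto
  from measurable_compose[OF canonical.measurable_tri_inv[OF order_refl] this]
  have Z [measurable]: "?Z \<in> measurable (PiM {1..2*n} (\<lambda>_. borel)) (PiM {1..2*k} (\<lambda>_. borel))" by simp
  have Z' [measurable]: "?Z \<in> measurable ?U (PiM {1..2*k} (\<lambda>_. borel))"
    unfolding measurable_cong_sets[OF sets_U refl] by (rule Z)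
  have "(\<integral>x. f x \<partial>distr M (PiM {1..k} (\<lambda>_. borel)) (\<lambda>\<omega>. ?G (m \<omega>))) = (\<integral>\<omega>. f (?G (m \<omega>)) \<partial>M)"
    by (rule integral_distr[OF measurable_compose[OF m G] f])
  also have "\<dots> = (\<integral>x. f (?G x) \<partial>distr M (PiM {1..2*n} (\<lambda>_. borel)) m)"
    by (rule integral_distr[OF m measurable_compose[OF G f], symmetric])
  also have "\<dots> = (\<integral>x. f (?G x) \<partial>?U)" by (simp only: distr)
  also have "\<dots> = (\<integral>x. f (log_det_scaled k n (?Z x)) \<partial>?U)"
  proof (rule integral_cong_AE)
    have "AE x in PiM {1..2*n} (\<lambda>_. lborel). x \<in> moment_space (2 * n) \<longrightarrow> ?G x = log_det_scaled k n (?Z x)"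
      using AE_moment_space_iff[of "2 * n"]
    proof eventually_elim
      case (elim x)
      show ?case
      proof
        assume "x \<in> moment_space (2 * n)"
        with elim have a: "\<And>i. i \<in> {1..2*n} \<Longrightarrow> \<bar>canonical (2 * n) x i\<bar> < 1" by blast
        have "verblunsky_energy (\<lambda>i. ?Z x i / sqrt (4 * real n)) (2 * j - 1) =
            verblunsky_energy (canonical (2 * n) x) (2 * j - 1)" if "j \<in> {1..k}" for j
          using that n by (intro verblunsky_energy_cong) auto
        moreover have "?Z x (2 * j) / sqrt (4 * real n) = canonical (2 * n) x (2 * j)" if "j \<in> {1..k}" for j
          using that n by auto
        ultimately show "?G x = log_det_scaled k n (?Z x)"
          unfolding log_det_scaled_def using n
          by (intro restrict_ext) (subst D_moments_canonical[OF a], auto intro!: sum.cong)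
      qed
    qed
    then have "AE x in ?U. ?G x = log_det_scaled k n (?Z x)"
      unfolding uniform_moment_space_def
      using uniform_measure_prob_space_imp_sets prob
      by (intro AE_uniform_measureI) (auto simp: uniform_moment_space_def)
    then show "AE x in ?U. f (?G x) = f (log_det_scaled k n (?Z x))"
      by eventually_elim (simp only:)
  qed measurable
  also have "\<dots> = (\<integral>z. f (log_det_scaled k n z) \<partial>distr ?U (PiM {1..2*k} (\<lambda>_. borel)) ?Z)"
    by (rule integral_distr[OF Z', symmetric]) measurable
  also have "\<dots> = (\<integral>z. weight (2 * k) n z * f (log_det_scaled k n z) \<partial>PiM {1..2*k} (\<lambda>_. lborel)) /
    (\<integral>z. weight (2 * k) n z \<partial>PiM {1..2*k} (\<lambda>_. lborel))"
  proof -
    have "2 * k \<le> 2 * n" "sqrt (4 * real n) > 0" using n by auto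
    from distr_scaled_canonical[OF this prob] obtain \<kappa> where \<kappa>:
      "distr ?U (PiM {1..2*k} (\<lambda>_. borel)) ?Z =
        density (PiM {1..2*k} (\<lambda>_. lborel)) (\<lambda>z. \<kappa> * ennreal (weight (2 * k) n z))"
      unfolding weight_def by blast
    have "prob_space (distr ?U (PiM {1..2*k} (\<lambda>_. borel)) ?Z)"
      by (rule prob_space.prob_space_distr[OF prob Z'])
    then show ?thesis
      unfolding \<kappa> by (intro integral_normalized_density integrable_weight weight_nonneg n) measurable
  qed
  finally show ?thesis .
qed

theorem theorem3p1:
  fixes k :: nat
    and M :: "nat \<Rightarrow> 'a measure"
    and m :: "nat \<Rightarrow> 'a \<Rightarrow> nat \<Rightarrow> real"
  assumes "\<And>n. n \<ge> k \<Longrightarrow> prob_space (M n)"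
    and "\<And>n. n \<ge> k \<Longrightarrow> m n \<in> measurable (M n) (PiM {1..2 * n} (\<lambda>_. borel))"
    and "\<And>n. n \<ge> k \<Longrightarrow> distr (M n) (PiM {1..2 * n} (\<lambda>_. borel)) (m n) = uniform_moment_space (2 * n)"
  shows "conv_in_distribution {1..k} M
           (\<lambda>n \<omega>. \<lambda>i\<in>{1..k}. sqrt (4 * real n) * (D_moments i (m n \<omega>) - D_arcsine i))
           (multivariate_normal k (\<lambda>_. 0) (\<lambda>i j. real (min i j)))"
  unfolding conv_in_distribution_def weak_conv_PiM_def
proof (intro allI impI, elim conjE)
  fix f :: "(nat \<Rightarrow> real) \<Rightarrow> real"
  assume cont: "continuous_on (PiE {1..k} (\<lambda>_. UNIV)) f" and "bounded (f ` PiE {1..k} (\<lambda>_. UNIV))"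
  then obtain B where B: "\<And>x. x \<in> PiE {1..k} (\<lambda>_. UNIV) \<Longrightarrow> \<bar>f x\<bar> \<le> B"
    by (auto simp: bounded_iff)
  have f [measurable]: "f \<in> borel_measurable (PiM {1..k} (\<lambda>_. borel))"
    by (rule measurable_continuous_on_PiE[OF cont])
  let ?L = "PiM {1..2*k} (\<lambda>_::nat. lborel :: real measure)"
  let ?g = "\<lambda>z :: nat \<Rightarrow> real. f (\<lambda>l\<in>{1..k}. \<Sum>j\<in>{1..l}. z (2 * j))"
  have "(\<lambda>z :: nat \<Rightarrow> real. \<lambda>l\<in>{1..k}. \<Sum>j\<in>{1..l}. z (2 * j)) \<in> measurable (PiM {1..2*k} (\<lambda>_. borel)) (PiM {1..k} (\<lambda>_. borel))"
    by (intro measurable_restrict borel_measurable_sum measurable_component_singleton) auto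
  then have g [measurable]: "?g \<in> borel_measurable (PiM {1..2*k} (\<lambda>_. borel))"
    by (rule measurable_compose) (rule f)
  have "(\<lambda>n. \<integral>z. weight (2 * k) n z * f (log_det_scaled k n z) \<partial>?L) \<longlonglongrightarrow>
      sqrt (2 * pi) ^ (2 * k) * (\<integral>z. ?g z \<partial>PiM {1..2*k} (\<lambda>_. normal_law))"
  proof (rule tendsto_integral_weight)
    show "\<bar>f (log_det_scaled k n z)\<bar> \<le> B" for n z
      by (rule B) (auto simp: log_det_scaled_def)
    show "(\<lambda>n. f (log_det_scaled k n z)) \<longlonglongrightarrow> ?g z" for z
      by (rule continuous_on_tendsto_compose[OF cont tendsto_log_det_scaled])
        (auto simp: log_det_scaled_def)
  qed measurable
  moreover have "(\<lambda>n. \<integral>z. weight (2 * k) n z * 1 \<partial>?L) \<longlonglongrightarrow>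
      sqrt (2 * pi) ^ (2 * k) * (\<integral>z. 1 \<partial>PiM {1..2*k} (\<lambda>_::nat. normal_law))"
    by (rule tendsto_integral_weight[where B=1]) auto
  moreover have "(\<integral>z. 1 \<partial>PiM {1..2*k} (\<lambda>_::nat. normal_law)) = (1::real)"
    using prob_space.prob_space[OF prob_space_PiM[of "{1..2*k}" "\<lambda>_. normal_law", OF prob_normal_law]] by simp
  ultimately have "(\<lambda>n. (\<integral>z. weight (2 * k) n z * f (log_det_scaled k n z) \<partial>?L) / (\<integral>z. weight (2 * k) n z \<partial>?L)) \<longlonglongrightarrow>
      (sqrt (2 * pi) ^ (2 * k) * (\<integral>z. ?g z \<partial>PiM {1..2*k} (\<lambda>_. normal_law))) / (sqrt (2 * pi) ^ (2 * k) * 1)"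
    by (intro tendsto_divide) (simp_all only: mult_1_right, simp)
  also have "(sqrt (2 * pi) ^ (2 * k) * (\<integral>z. ?g z \<partial>PiM {1..2*k} (\<lambda>_. normal_law))) / (sqrt (2 * pi) ^ (2 * k) * 1) =
      (\<integral>z. ?g z \<partial>PiM {1..2*k} (\<lambda>_. normal_law))"
    by simp
  also have "\<dots> = (\<integral>x. f x \<partial>multivariate_normal k (\<lambda>_. 0) (\<lambda>i j. real (min i j)))"
    by (rule integral_even_coordinates[OF f])
  finally have lim: "(\<lambda>n. (\<integral>z. weight (2 * k) n z * f (log_det_scaled k n z) \<partial>?L) / (\<integral>z. weight (2 * k) n z \<partial>?L)) \<longlonglongrightarrow>
      (\<integral>x. f x \<partial>multivariate_normal k (\<lambda>_. 0) (\<lambda>i j. real (min i j)))" .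
  show "(\<lambda>n. \<integral>x. f x \<partial>distr (M n) (PiM {1..k} (\<lambda>_. borel))
        (\<lambda>\<omega>. \<lambda>i\<in>{1..k}. sqrt (4 * real n) * (D_moments i (m n \<omega>) - D_arcsine i))) \<longlonglongrightarrow>
      (\<integral>x. f x \<partial>multivariate_normal k (\<lambda>_. 0) (\<lambda>i j. real (min i j)))"
  proof (rule Lim_transform_eventually[OF lim])
    show "eventually (\<lambda>n. (\<integral>z. weight (2 * k) n z * f (log_det_scaled k n z) \<partial>?L) / (\<integral>z. weight (2 * k) n z \<partial>?L) =
        (\<integral>x. f x \<partial>distr (M n) (PiM {1..k} (\<lambda>_. borel))
        (\<lambda>\<omega>. \<lambda>i\<in>{1..k}. sqrt (4 * real n) * (D_moments i (m n \<omega>) - D_arcsine i)))) sequentially"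
      using eventually_ge_at_top[of "max 1 (2 * k)"]
    proof eventually_elim
      case (elim n)
      then show ?case
        using assms by (intro expectation_log_det[symmetric] f) auto
    qed
  qed
qed

end
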